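(* Let $(X,\|\cdot\|)$ be a normed space and $\tau\subseteq\tau_{\|\cdot\|}$ a Hausdorff locally convex topology on $X$ such that $(X,\tau)$ is sequentially complete, $\tau$-bounded sets are also $\|\cdot\|$-bounded, and $\mathcal N_\tau$ is countably quasi-convex. Let $(A,D(A))$ be a linear operator on $X$, $\omega\in\mathbb R$ and $M\ge1$. Then the following assertions are equivalent. (a) $A$ is the generator of a $\tau$-strongly continuous semigroup $(S(t))_{t\ge0}$ on $X$ such that for all $t_0\ge0$ and $p\in\mathcal N_\tau$ there exists $q\in\mathcal N_\tau$ such that $$p(e^{-\omega t}S(t)x)\le Mq(x)\quad(t\in[0,t_0],\ x\in X).$$ (b) $A$ is the generator of a $\tau$-strongly continuous semigroup $(S(t))_{t\ge0}$ on $X$ such that for all $\alpha>\omega$ and $p\in\mathcal N_\tau$ there exists $q\in\mathcal N_\tau$ such that $$p(e^{-\alpha t}S(t)x)\le Mq(x)\quad(t\ge0,\ x\in X).$$ (c) $A$ is $\tau$-densely defined, $(\omega,\infty)\subseteq\rho_\tau(A)$, and for all $\alpha>\omega$ and all $p\in\mathcal N_\tau$ there exists $q\in\mathcal N_\tau$ such that $$p((\lambda-\alpha)^mR(\lambda,A)^mx)\le Mq(x)\quad(\lambda>\alpha,\ m\in\mathbb N,\ x\in X).$$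
   Context: Linear spaces are over $\mathbb R$ or $\mathbb C$; $\mathbb N=\{1,2,\dots\}$; $\tau_{\|\cdot\|}$ is the norm topology; $\mathcal L(X,\tau)$ is the space of $\tau$-continuous linear maps $X\to X$. $\mathcal N_\tau$ is the set of all $\tau$-continuous seminorms $p$ on $X$ with $p\le\|\cdot\|$. It is countably quasi-convex if for every sequence $(p_n)_{n\in\mathbb N}$ in $\mathcal N_\tau$ and every non-negative sequence $(a_n)_{n\in\mathbb N}$ with $\sum_{n=1}^\infty a_n=1$ there is $p\in\mathcal N_\tau$ with $\sup_na_np_n\le p$. A semigroup on $X$ is a family of linear maps $S(t)\colon X\to X$, $t\ge0$, with $S(0)=\mathrm{id}$, $S(t)S(s)=S(t+s)$ (no continuity of $S(t)$ is assumed a priori). It is $\tau$-strongly continuous if $t\mapsto S(t)x\in(X,\tau)$ is continuous on $[0,\infty)$ for every $x\in X$; its generator is $Ax:=\tau\text{-}\lim_{t\to0+}\frac1t(S(t)x-x)$ with $D(A)$ the set of all $x\in X$ for which this limit exists. A linear operator $(A,D(A))$ on $X$ is a linear map $A\colon D(A)\to X$ on a linear subspace $D(A)\subseteq X$; it is $\tau$-densely defined if $D(A)$ is $\tau$-dense in $X$. $\rho_\tau(A)$ is the set of scalars $\lambda$ such that $\lambda-A\colon D(A)\to X$ is bijective and $R(\lambda,A):=(\lambda-A)^{-1}\in\mathcal L(X,\tau)$. *)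

theory Defs
  imports "HOL-Analysis.Analysis"
begin

text \<open>
  The scalar field is a type of class \<open>real_normed_field\<close>; by the Gelfand-Mazur theorem such
  a field is isometrically isomorphic to the reals or to the complex numbers. The type class of
  the space carries the norm and the underlying real scalar multiplication, while \<open>smul\<close> is
  the multiplication by the actual scalars.
\<close>

locale normed_space_over = vector_space smul
  for smul :: "'k::real_normed_field \<Rightarrow> 'a::real_normed_vector \<Rightarrow> 'a" +
  assumes smul_of_real: "smul (of_real r) x = r *\<^sub>R x"
    and norm_smul: "norm (smul c x) = norm c * norm x"

definition locally_convex_topology ::
    "('k::real_normed_field \<Rightarrow> 'a::real_normed_vector \<Rightarrow> 'a) \<Rightarrow> 'a topology \<Rightarrow> bool" where
  "locally_convex_topology smul \<tau> \<longleftrightarrow>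
     topspace \<tau> = UNIV \<and>
     continuous_map (prod_topology \<tau> \<tau>) \<tau> (\<lambda>(x, y). x + y) \<and>
     continuous_map (prod_topology euclidean \<tau>) \<tau> (\<lambda>(c, x). smul c x) \<and>
     (\<forall>U. openin \<tau> U \<and> 0 \<in> U \<longrightarrow>
        (\<exists>V. openin \<tau> V \<and> 0 \<in> V \<and> convex V \<and> V \<subseteq> U))"

definition seq_complete :: "'a::ab_group_add topology \<Rightarrow> bool" where
  "seq_complete \<tau> \<longleftrightarrow>
     (\<forall>x :: nat \<Rightarrow> 'a.
        (\<forall>U. openin \<tau> U \<and> 0 \<in> U \<longrightarrow> (\<exists>N. \<forall>m\<ge>N. \<forall>n\<ge>N. x m - x n \<in> U)) \<longrightarrow>
        (\<exists>l. limitin \<tau> x l sequentially))"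

definition bounded_in ::
    "('k::real_normed_field \<Rightarrow> 'a::real_normed_vector \<Rightarrow> 'a) \<Rightarrow> 'a topology \<Rightarrow> 'a set \<Rightarrow> bool" where
  "bounded_in smul \<tau> B \<longleftrightarrow>
     (\<forall>U. openin \<tau> U \<and> 0 \<in> U \<longrightarrow> (\<exists>r>0. \<forall>c. norm c \<ge> r \<longrightarrow> B \<subseteq> smul c ` U))"

definition seminorm ::
    "('k::real_normed_field \<Rightarrow> 'a::real_normed_vector \<Rightarrow> 'a) \<Rightarrow> ('a \<Rightarrow> real) \<Rightarrow> bool" where
  "seminorm smul p \<longleftrightarrow>
     (\<forall>x y. p (x + y) \<le> p x + p y) \<and> (\<forall>c x. p (smul c x) = norm c * p x)"

definition cont_seminorms ::
    "('k::real_normed_field \<Rightarrow> 'a::real_normed_vector \<Rightarrow> 'a) \<Rightarrow> 'a topology \<Rightarrow> ('a \<Rightarrow> real) set" where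
  "cont_seminorms smul \<tau> =
     {p. seminorm smul p \<and> continuous_map \<tau> euclideanreal p \<and> (\<forall>x. p x \<le> norm x)}"

text \<open>
  The supremum below is a supremum of a bounded set whenever the family consists of seminorms
  dominated by the norm, since all weights are then at most 1.
\<close>

definition countably_quasi_convex :: "('a \<Rightarrow> real) set \<Rightarrow> bool" where
  "countably_quasi_convex P \<longleftrightarrow>
     (\<forall>(p :: nat \<Rightarrow> 'a \<Rightarrow> real) (a :: nat \<Rightarrow> real).
        (\<forall>n. p n \<in> P) \<and> (\<forall>n. 0 \<le> a n) \<and> a sums 1 \<longrightarrow>
        (\<exists>q\<in>P. \<forall>x. (SUP n. a n * p n x) \<le> q x))"

definition cont_linear_maps ::
    "('k::real_normed_field \<Rightarrow> 'a::real_normed_vector \<Rightarrow> 'a) \<Rightarrow> 'a topology \<Rightarrow> ('a \<Rightarrow> 'a) set" where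
  "cont_linear_maps smul \<tau> =
     {T. Vector_Spaces.linear smul smul T \<and> continuous_map \<tau> \<tau> T}"

text \<open>
  An operator is given by a function \<open>A\<close> and its domain \<open>D\<close>; the values of \<open>A\<close> outside \<open>D\<close>
  are irrelevant. Likewise, only the values of a semigroup at non-negative times matter.
\<close>

definition linear_operator ::
    "('k::real_normed_field \<Rightarrow> 'a::real_normed_vector \<Rightarrow> 'a) \<Rightarrow> 'a set \<Rightarrow> ('a \<Rightarrow> 'a) \<Rightarrow> bool" where
  "linear_operator smul D A \<longleftrightarrow>
     module.subspace smul D \<and>
     (\<forall>x\<in>D. \<forall>y\<in>D. A (x + y) = A x + A y) \<and> (\<forall>c. \<forall>x\<in>D. A (smul c x) = smul c (A x))"

definition semigroup_on ::
    "('k::real_normed_field \<Rightarrow> 'a::real_normed_vector \<Rightarrow> 'a) \<Rightarrow> (real \<Rightarrow> 'a \<Rightarrow> 'a) \<Rightarrow> bool" where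
  "semigroup_on smul S \<longleftrightarrow>
     (\<forall>t\<ge>0. Vector_Spaces.linear smul smul (S t)) \<and>
     S 0 = id \<and> (\<forall>t\<ge>0. \<forall>s\<ge>0. S (t + s) = S t \<circ> S s)"

definition strongly_continuous ::
    "'a topology \<Rightarrow> (real \<Rightarrow> 'a \<Rightarrow> 'a) \<Rightarrow> bool" where
  "strongly_continuous \<tau> S \<longleftrightarrow> (\<forall>x. continuous_map (top_of_set {0..}) \<tau> (\<lambda>t. S t x))"

definition is_generator ::
    "'a::real_normed_vector topology \<Rightarrow> (real \<Rightarrow> 'a \<Rightarrow> 'a) \<Rightarrow> 'a set \<Rightarrow> ('a \<Rightarrow> 'a) \<Rightarrow> bool" where
  "is_generator \<tau> S D A \<longleftrightarrow>
     D = {x. \<exists>y. limitin \<tau> (\<lambda>t. (1 / t) *\<^sub>R (S t x - x)) y (at_right 0)} \<and>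
     (\<forall>x\<in>D. limitin \<tau> (\<lambda>t. (1 / t) *\<^sub>R (S t x - x)) (A x) (at_right 0))"

definition resolvent ::
    "('k::real_normed_field \<Rightarrow> 'a::real_normed_vector \<Rightarrow> 'a) \<Rightarrow> 'a set \<Rightarrow> ('a \<Rightarrow> 'a) \<Rightarrow> 'k \<Rightarrow> 'a \<Rightarrow> 'a" where
  "resolvent smul D A \<mu> = inv_into D (\<lambda>x. smul \<mu> x - A x)"

definition resolvent_set ::
    "('k::real_normed_field \<Rightarrow> 'a::real_normed_vector \<Rightarrow> 'a) \<Rightarrow> 'a topology \<Rightarrow> 'a set \<Rightarrow> ('a \<Rightarrow> 'a) \<Rightarrow> 'k set" where
  "resolvent_set smul \<tau> D A =
     {\<mu>. bij_betw (\<lambda>x. smul \<mu> x - A x) D UNIV \<and>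
         resolvent smul D A \<mu> \<in> cont_linear_maps smul \<tau>}"

end

theory Submission
  imports Defs
begin

text \<open>
  The \<open>\<tau>\<close>-continuous seminorms dominated by the norm generate \<open>\<tau>\<close>, so all limits are taken seminorm
  by seminorm.

  (a) to (b): cover \<open>[0, \<infinity>)\<close> by unit intervals; the factor \<open>exp (-(\<alpha> - \<omega>) n)\<close> gained on the \<open>n\<close>-th
  interval is summable, so the corresponding seminorms can be merged into one. (b) to (a): a seminorm
  with \<open>p (exp (-\<omega> t) S(t) x) \<le> M q(x)\<close> on \<open>[0, t\<^sub>0]\<close> is the supremum of the left-hand sides, divided by
  \<open>M\<close>, and letting \<open>\<alpha> \<rightarrow> \<omega>\<close> shows that it is dominated by the norm.

  (b) to (c): for \<open>\<mu> > \<alpha> > \<omega>\<close> the Laplace transform of \<open>S\<close> is the limit \<open>R\<close> of dyadic Riemann sums of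
  \<open>T(t) = exp (-\<mu> t) S(t)\<close>. In the equivalent seminorm \<open>p'(x) = sup\<^sub>t p (exp (-\<alpha> t) S(t) x)\<close> the operator
  \<open>T(t)\<close> has norm at most \<open>exp (-(\<mu> - \<alpha>) t)\<close>, hence \<open>p' ((\<mu> - \<alpha>) R x) \<le> p'(x)\<close>, which can be iterated.

  (c) to (b): with \<open>F(h) = (1 - h A)\<^sup>-\<^sup>1\<close>, halving the step changes \<open>F(h)\<close> on the domain of \<open>A\<^sup>2\<close> by
  \<open>F(h/2)\<^sup>2 x - F(h) x = - (h\<^sup>2 / 4) F(h/2)\<^sup>2 F(h) A\<^sup>2 x\<close>. The resolvent bounds make products of the \<open>F(h)\<close>
  stable, so the implicit Euler scheme with step \<open>2\<^sup>-\<^sup>j\<close> converges geometrically to a semigroup.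
\<close>

text \<open>An estimate of one operator replaces \<open>p\<close> by another seminorm
  \<open>q\<close>, so bounds for single operators cannot be iterated as they could in a normed
  space; and \<open>M\<close> must come out unchanged. For a given semigroup both difficulties are
  met by the supremum over the orbit: it is a single seminorm in which the rescaled operators are
  contractions, and it is compared with \<open>M * q\<close> only once, after all iterations. Being
  bounded only by \<open>M * q\<close>, it may exceed the norm and leave \<open>N\<close>, which is
  why limits are also treated for a wider class of seminorms. In the converse direction the assumed
  bound on all powers of the resolvent, with one \<open>q\<close>, takes the place of iteration.

  Only Cauchy sequences, not nets, are known to converge. Both limits therefore run along the nested
  grids of mesh \<open>1 / 2 ^ j\<close>, whose levels can be compared by the semigroup law or by an
  exact operator identity.\<close>

lemma eventually_dyadic_lt: "d > 0 \<Longrightarrow> \<forall>\<^sub>F j in sequentially. 1 / 2 ^ j < (d :: real)"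
  using order_tendstoD(2)[OF LIMSEQ_inverse_realpow_zero[of 2]] by (simp add: inverse_eq_divide)

section \<open>Seminorms and the topology they generate\<close>

context normed_space_over
begin

lemma seminorm_triangle: "seminorm smul p \<Longrightarrow> p (x + y) \<le> p x + p y"
  and seminorm_smul: "seminorm smul p \<Longrightarrow> p (smul c x) = norm c * p x"
  by (auto simp: seminorm_def)

lemma seminorm_scaleR: "seminorm smul p \<Longrightarrow> p (r *\<^sub>R x) = \<bar>r\<bar> * p x"
  using seminorm_smul[of p "of_real r" x] by (simp add: smul_of_real)

lemma seminorm_zero: "seminorm smul p \<Longrightarrow> p 0 = 0"
  using seminorm_scaleR[of p 0 0] by simp

lemma seminorm_minus: "seminorm smul p \<Longrightarrow> p (- x) = p x"
  using seminorm_scaleR[of p "-1" x] by simp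

lemma seminorm_nonneg: "seminorm smul p \<Longrightarrow> 0 \<le> p x"
  using seminorm_triangle[of p x "- x"] seminorm_zero[of p] seminorm_minus[of p x] by simp

lemma seminorm_diff: "seminorm smul p \<Longrightarrow> p (x - y) \<le> p x + p y"
  using seminorm_triangle[of p x "- y"] seminorm_minus[of p y] by simp

lemma seminorm_commute: "seminorm smul p \<Longrightarrow> p (x - y) = p (y - x)"
  using seminorm_minus[of p "x - y"] by simp

lemma seminorm_triangle_sub: "seminorm smul p \<Longrightarrow> p x \<le> p y + p (x - y)"
  using seminorm_triangle[of p y "x - y"] by simp

lemma seminorm_diff_trans: "seminorm smul p \<Longrightarrow> p (x - z) \<le> p (x - y) + p (y - z)"
  using seminorm_triangle[of p "x - y" "y - z"] by simp

lemma seminorm_abs_diff: "seminorm smul p \<Longrightarrow> \<bar>p x - p y\<bar> \<le> p (x - y)"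
  using seminorm_triangle_sub[of p x y] seminorm_triangle_sub[of p y x] seminorm_commute[of p x y]
  by linarith

lemma seminorm_sum: "seminorm smul p \<Longrightarrow> p (sum f I) \<le> (\<Sum>i\<in>I. p (f i))"
proof (induction I rule: infinite_finite_induct)
  case (insert i I)
  then show ?case
    using seminorm_triangle[of p "f i" "sum f I"] by simp
qed (auto simp: seminorm_zero)

lemma smul_scaleR: "smul c (r *\<^sub>R x) = r *\<^sub>R smul c x"
  by (metis smul_of_real scale_left_commute)

lemma linear_smul_imp_linear:
  assumes "Vector_Spaces.linear smul smul T"
  shows "linear T"
proof -
  interpret T: Vector_Spaces.linear smul smul T by fact
  show ?thesis
    by (rule linearI) (auto simp: T.add T.scale simp flip: smul_of_real)
qed

lemma linear_smulI:
  assumes "\<And>x y. T (x + y) = T x + T y" "\<And>c x. T (smul c x) = smul c (T x)"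
  shows "Vector_Spaces.linear smul smul T"
  using assms vector_space_axioms by (simp add: Vector_Spaces.linear_iff)

end

locale seq_complete_lcs = normed_space_over smul
  for smul :: "'k::real_normed_field \<Rightarrow> 'a::real_normed_vector \<Rightarrow> 'a" +
  fixes \<tau> :: "'a topology"
  assumes locally_convex: "locally_convex_topology smul \<tau>"
    and Hausdorff: "Hausdorff_space \<tau>"
    and coarser: "\<And>U. openin \<tau> U \<Longrightarrow> open U"
    and complete: "seq_complete \<tau>"
begin

abbreviation N :: "('a \<Rightarrow> real) set"
  where "N \<equiv> cont_seminorms smul \<tau>"

lemma N_seminorm: "p \<in> N \<Longrightarrow> seminorm smul p"
  and N_continuous: "p \<in> N \<Longrightarrow> continuous_map \<tau> euclideanreal p"
  and N_le_norm: "p \<in> N \<Longrightarrow> p x \<le> norm x"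
  by (auto simp: cont_seminorms_def)

lemmas N_nonneg = seminorm_nonneg[OF N_seminorm]

lemma topspace [simp]: "topspace \<tau> = UNIV"
  using locally_convex by (simp add: locally_convex_topology_def)

lemma continuous_affine: "continuous_map \<tau> \<tau> (\<lambda>x. smul c x + v)"
proof -
  have "continuous_map \<tau> \<tau> (\<lambda>x. smul c x)"
    using locally_convex continuous_map_compose[of \<tau> "prod_topology euclidean \<tau>" "\<lambda>x. (c, x)" \<tau>
        "\<lambda>(c, x). smul c x"]
    by (simp add: locally_convex_topology_def o_def continuous_map_pairedI)
  then show ?thesis
    using locally_convex continuous_map_compose[of \<tau> "prod_topology \<tau> \<tau>" "\<lambda>x. (smul c x, v)" \<tau>
        "\<lambda>(x, y). x + y"]
    by (simp add: locally_convex_topology_def o_def continuous_map_pairedI)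
qed

lemma openin_affine_preimage:
  assumes "openin \<tau> U"
  shows "openin \<tau> {x. r *\<^sub>R x + v \<in> U}"
  using openin_continuous_map_preimage[OF continuous_affine[of "of_real r" v] assms]
  by (simp add: smul_of_real)

lemma seminorm_continuous:
  assumes p: "seminorm smul p" and V: "openin \<tau> V" "0 \<in> V" and le: "\<And>x. x \<in> V \<Longrightarrow> p x \<le> 1"
  shows "continuous_map \<tau> euclideanreal p"
  unfolding continuous_map_def
proof (intro conjI allI impI)
  fix U :: "real set" assume "openin euclidean U"
  then have U: "open U" by simp
  show "openin \<tau> {x \<in> topspace \<tau>. p x \<in> U}"
  proof (subst openin_subopen, safe)
    fix x assume "p x \<in> U"
    then obtain e where e: "e > 0" "ball (p x) e \<subseteq> U"
      using U open_contains_ball by blast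
    \<comment> \<open>This is the neighbourhood \<open>x + (e / 2) V\<close>. On \<open>V\<close>
      only \<open>p \<le> 1\<close> is known; the factor 2 turns this into a strict bound by
      \<open>e\<close>.\<close>
    let ?T = "{y. (2 / e) *\<^sub>R y + (- (2 / e) *\<^sub>R x) \<in> V}"
    have "p y \<in> U" if "y \<in> ?T" for y
    proof -
      have "(2 / e) * p (y - x) = p ((2 / e) *\<^sub>R (y - x))"
        using seminorm_scaleR[OF p, of "2 / e" "y - x"] e by simp
      also have "\<dots> \<le> 1"
        using that le by (simp add: scaleR_diff_right)
      finally have "p (y - x) < e"
        using e by (simp add: field_simps)
      then have "\<bar>p x - p y\<bar> < e"
        using seminorm_abs_diff[OF p, of y x] by linarith
      then show ?thesis
        using e by (auto simp: dist_real_def)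
    qed
    moreover have "openin \<tau> ?T"
      using openin_affine_preimage[OF V(1)] .
    moreover have "x \<in> ?T"
      using V(2) by simp
    ultimately show "\<exists>T. openin \<tau> T \<and> x \<in> T \<and> T \<subseteq> {x \<in> topspace \<tau>. p x \<in> U}"
      by (intro exI[of _ ?T]) auto
  qed
qed simp

lemma seminorm_ball_open:
  assumes p: "seminorm smul p" "continuous_map \<tau> euclideanreal p"
  shows "openin \<tau> {y. p (y - x) < e}"
proof -
  have "openin \<tau> {y. p y < e}"
    using openin_continuous_map_preimage[OF p(2), of "{..<e}"] by simp
  then show ?thesis
    using openin_affine_preimage[of _ 1 "- x"] by fastforce
qed

text \<open>The Minkowski functional of the largest balanced subset of a convex neighbourhood.\<close>

lemma neighbourhood_contains_unit_ball:
  assumes U: "openin \<tau> U" "0 \<in> U"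
  shows "\<exists>p. seminorm smul p \<and> continuous_map \<tau> euclideanreal p \<and> {x. p x < 1} \<subseteq> U"
proof -
  obtain C where C: "openin \<tau> C" "0 \<in> C" "convex C" "C \<subseteq> U"
    using locally_convex U unfolding locally_convex_topology_def by blast
  define W where "W = {x. \<forall>c::'k. norm c \<le> 1 \<longrightarrow> smul c x \<in> C}"
  define p where "p x = Inf {r. r > 0 \<and> (1 / r) *\<^sub>R x \<in> W}" for x
  have W_sub: "W \<subseteq> U"
    using C(4) unfolding W_def by (metis (mono_tags, lifting) mem_Collect_eq norm_one order_refl scale_one subset_iff)
  have W_bal: "smul c x \<in> W" if "x \<in> W" "norm c \<le> 1" for c x
    using that unfolding W_def by (auto simp: norm_mult mult_le_one)
  have W_conv: "convex W"
    using C(3) unfolding W_def convex_alt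
    by (auto simp: scale_right_distrib smul_scaleR)
  \<comment> \<open>Joint continuity of scalar multiplication at \<open>(0, 0)\<close> provides a
    neighbourhood of 0 inside the balanced set \<open>W\<close>.\<close>
  have "continuous_map (prod_topology euclidean \<tau>) \<tau> (\<lambda>(c, x). smul c x)"
    using locally_convex by (simp add: locally_convex_topology_def)
  from openin_continuous_map_preimage[OF this C(1)]
  have "openin (prod_topology euclidean \<tau>) {z. smul (fst z) (snd z) \<in> C}"
    by (simp add: case_prod_beta)
  moreover have "(0, 0) \<in> {z. smul (fst z :: 'k) (snd z) \<in> C}"
    using C(2) by simp
  ultimately obtain B V where BV: "open B" "openin \<tau> V" "(0::'k) \<in> B" "0 \<in> V"
      "B \<times> V \<subseteq> {z. smul (fst z) (snd z) \<in> C}"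
    by (auto simp: openin_prod_topology_alt dest!: spec[of _ 0])
  obtain d where d: "d > 0" "cball 0 d \<subseteq> B"
    using BV(1,3) open_contains_cball by blast
  \<comment> \<open>In short \<open>V' = d V\<close>: a scalar of norm at most 1 times a point of
    \<open>V'\<close> is a scalar of norm at most \<open>d\<close> times a point of
    \<open>V\<close>, and such products lie in \<open>C\<close>.\<close>
  define V' where "V' = {x. (1 / d) *\<^sub>R x + 0 \<in> V}"
  have V': "openin \<tau> V'" "0 \<in> V'"
    using openin_affine_preimage[OF BV(2), of "1 / d" 0] BV(4) by (auto simp: V'_def)
  have V'_W: "V' \<subseteq> W"
  proof
    fix x assume "x \<in> V'"
    then have x: "(1 / d) *\<^sub>R x \<in> V" by (simp add: V'_def)
    have "smul c x \<in> C" if "norm c \<le> 1" for c :: 'k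
    proof -
      have "of_real d * c \<in> B"
        using d that by (intro subsetD[OF d(2)]) (auto simp: norm_mult mult_left_le)
      then have "smul (of_real d * c) ((1 / d) *\<^sub>R x) \<in> C"
        using BV(5) x by auto
      moreover have "smul (of_real d * c) ((1 / d) *\<^sub>R x) = smul c x"
        using d by (simp add: smul_scaleR smul_of_real flip: scale_scale)
      ultimately show ?thesis by simp
    qed
    then show "x \<in> W" by (simp add: W_def)
  qed
  have W_smaller: "(1 / s) *\<^sub>R x \<in> W" if "(1 / r) *\<^sub>R x \<in> W" "0 < r" "r \<le> s" for r s x
    using W_bal[OF that(1), of "of_real (r / s)"] that
    by (simp only: smul_of_real norm_of_real scaleR_scaleR) simp
  \<comment> \<open>\<open>W\<close> is absorbing because \<open>\<tau>\<close> is coarser than the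
    norm topology, so that \<open>V'\<close> contains a norm ball.\<close>
  have ex: "\<exists>r>0. (1 / r) *\<^sub>R x \<in> W" for x
  proof -
    have "open V'" using V'(1) coarser by blast
    then obtain e where e: "e > 0" "ball 0 e \<subseteq> V'"
      using V'(2) open_contains_ball by blast
    define r where "r = 2 * (norm x + 1) / e"
    have r: "r > 0"
      using e by (simp add: r_def add_nonneg_pos)
    have "e * r = 2 * (norm x + 1)"
      using e by (simp add: r_def)
    then have "norm x < e * r"
      by (smt (verit) norm_ge_zero)
    then have "norm ((1 / r) *\<^sub>R x) < e"
      using r by (simp add: divide_less_eq)
    then have "(1 / r) *\<^sub>R x \<in> W"
      using e V'_W mem_ball_0 by blast
    with r show ?thesis by blast
  qed
  have bdd: "bdd_below {r. r > 0 \<and> (1 / r) *\<^sub>R x \<in> W}" for x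
    by (intro bdd_belowI[of _ 0]) auto
  have p_le: "p x \<le> r" if "r > 0" "(1 / r) *\<^sub>R x \<in> W" for x r
    unfolding p_def using that bdd by (intro cInf_lower) auto
  have p_lt: "(1 / r) *\<^sub>R x \<in> W \<and> r > 0" if less: "p x < r" for x r
  proof -
    obtain s where "s > 0" "(1 / s) *\<^sub>R x \<in> W" "s < r"
      using cInf_lessD[of "{r. r > 0 \<and> (1 / r) *\<^sub>R x \<in> W}" r, folded p_def, OF _ less] ex[of x]
      by blast
    then show ?thesis using W_smaller by fastforce
  qed
  have p_nonneg: "0 \<le> p x" for x
    unfolding p_def using ex[of x] by (intro cInf_greatest) auto
  have tri: "p (x + y) \<le> p x + p y" for x y
  proof (rule field_le_epsilon)
    fix e :: real assume e: "e > 0"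
    define r s where "r = p x + e / 2" and "s = p y + e / 2"
    have rs: "r > 0" "s > 0" "(1 / r) *\<^sub>R x \<in> W" "(1 / s) *\<^sub>R y \<in> W"
      using p_lt[of x r] p_lt[of y s] e by (auto simp: r_def s_def)
    have "(r / (r + s)) *\<^sub>R ((1 / r) *\<^sub>R x) + (s / (r + s)) *\<^sub>R ((1 / s) *\<^sub>R y) \<in> W"
      using rs by (intro convexD[OF W_conv]) (auto simp flip: add_divide_distrib)
    then have "(1 / (r + s)) *\<^sub>R (x + y) \<in> W"
      using rs by (simp add: scaleR_add_right)
    then have "p (x + y) \<le> r + s"
      using rs by (intro p_le) auto
    then show "p (x + y) \<le> p x + p y + e"
      by (simp add: r_def s_def)
  qed
  \<comment> \<open>One inequality suffices, since it can be applied to \<open>inverse c\<close> as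
    well. The scalar \<open>c / of_real (norm c)\<close> has norm 1, so multiplication by it does
    not leave the balanced set \<open>W\<close>.\<close>
  have hom_le: "p (smul c x) \<le> norm c * p x" if c: "c \<noteq> 0" for c x
  proof (rule field_le_epsilon)
    fix e :: real assume e: "e > 0"
    define r where "r = p x + e / norm c"
    have r: "r > 0" "(1 / r) *\<^sub>R x \<in> W"
      using p_lt[of x r] e c by (auto simp: r_def)
    have "smul (c / of_real (norm c)) ((1 / r) *\<^sub>R x) \<in> W"
      using c by (intro W_bal[OF r(2)]) (simp add: norm_divide)
    moreover have "smul (c / of_real (norm c)) ((1 / r) *\<^sub>R x) = (1 / (norm c * r)) *\<^sub>R smul c x"
    proof -
      have "smul (c / of_real (norm c)) ((1 / r) *\<^sub>R x)
          = smul (of_real (1 / norm c)) (smul c ((1 / r) *\<^sub>R x))"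
        by (simp add: field_simps)
      then show ?thesis
        by (simp only: smul_scaleR smul_of_real scaleR_scaleR) (simp add: field_simps)
    qed
    ultimately have "p (smul c x) \<le> norm c * r"
      using r c by (intro p_le) auto
    then show "p (smul c x) \<le> norm c * p x + e"
      using c by (simp add: r_def distrib_left)
  qed
  have p0: "p 0 = 0"
  proof -
    have "p 0 \<le> 0 + e" if "e > 0" for e
      using that p_le[of e 0] V'(2) V'_W by auto
    then show ?thesis
      using p_nonneg[of 0] field_le_epsilon[of "p 0" 0] by force
  qed
  have "p (smul c x) = norm c * p x" for c x
  proof (cases "c = 0")
    case False
    have "p x = p (smul (inverse c) (smul c x))"
      using False by simp
    also have "\<dots> \<le> norm (inverse c) * p (smul c x)"
      using False by (intro hom_le) auto
    finally have "norm c * p x \<le> p (smul c x)"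
      using False by (simp add: norm_divide inverse_eq_divide field_simps)
    with hom_le[OF False] show ?thesis by (intro antisym)
  qed (simp add: p0)
  with tri have p: "seminorm smul p"
    by (simp add: seminorm_def)
  have "p x \<le> 1" if "x \<in> V'" for x
    using p_le[of 1 x] that V'_W by auto
  with p V' have "continuous_map \<tau> euclideanreal p"
    by (intro seminorm_continuous) auto
  moreover have "{x. p x < 1} \<subseteq> U"
    using p_lt[of _ 1] W_sub by auto
  ultimately show ?thesis using p by blast
qed

text \<open>This allows every continuous seminorm to be rescaled into \<open>N\<close>. The unit
  ball of \<open>p\<close> is norm open because \<open>\<tau>\<close> is coarser than the norm
  topology.\<close>

lemma seminorm_bounded_by_norm:
  assumes p: "seminorm smul p" "continuous_map \<tau> euclideanreal p"
  shows "\<exists>C>0. \<forall>x. p x \<le> C * norm x"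
proof -
  have "open {y. p y < 1}"
    using coarser[OF seminorm_ball_open[OF p, of 0 1]] by simp
  then obtain e where e: "e > 0" "cball 0 e \<subseteq> {y. p y < 1}"
    using seminorm_zero[OF p(1)] by (metis mem_Collect_eq open_contains_cball zero_less_one)
  have "p x \<le> (1 / e) * norm x" for x
  proof (cases "x = 0")
    case False
    have "(e / norm x) *\<^sub>R x \<in> cball 0 e"
      using False e by simp
    then have "(e / norm x) * p x < 1"
      using e seminorm_scaleR[OF p(1), of "e / norm x" x] by (metis (mono_tags, lifting) abs_of_nonneg
          divide_nonneg_nonneg less_imp_le mem_Collect_eq norm_ge_zero subsetD)
    then show ?thesis
      using False e by (simp add: field_simps)
  qed (simp add: seminorm_zero[OF p(1)])
  with e show ?thesis by (intro exI[of _ "1 / e"]) auto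
qed

text \<open>The supremum over an orbit segment enters \<open>N\<close> through this rule: domination
  by a multiple of one member already gives continuity.\<close>

lemma N_I:
  assumes "seminorm smul p" "r \<in> N" "\<And>x. p x \<le> C * r x" "\<And>x. p x \<le> norm x"
  shows "p \<in> N"
proof -
  have "continuous_map \<tau> euclideanreal p"
  proof (rule seminorm_continuous)
    let ?V = "{y. r (y - 0) < 1 / (\<bar>C\<bar> + 1)}"
    show "openin \<tau> ?V"
      using assms(2) by (intro seminorm_ball_open N_seminorm N_continuous)
    show "0 \<in> ?V"
      using seminorm_zero[OF N_seminorm[OF assms(2)]] by (simp add: add_nonneg_pos)
    show "p x \<le> 1" if "x \<in> ?V" for x
    proof -
      have "p x \<le> (\<bar>C\<bar> + 1) * r x"
        using assms(3)[of x] N_nonneg[OF assms(2), of x]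
        by (smt (verit) mult_right_mono)
      also have "\<dots> \<le> (\<bar>C\<bar> + 1) * (1 / (\<bar>C\<bar> + 1))"
        using that by (intro mult_left_mono) auto
      also have "\<dots> = 1"
        by (simp add: add_pos_nonneg less_imp_neq[symmetric])
      finally show ?thesis .
    qed
  qed fact
  with assms show ?thesis by (simp add: cont_seminorms_def)
qed

lemma neighbourhood_contains_seminorm_ball:
  assumes U: "openin \<tau> U" "x \<in> U"
  shows "\<exists>p\<in>N. \<exists>e>0. {y. p (y - x) < e} \<subseteq> U"
proof -
  have "openin \<tau> {y. y + x \<in> U}"
    using openin_affine_preimage[OF U(1), of 1 x] by simp
  then obtain p where p: "seminorm smul p" "continuous_map \<tau> euclideanreal p" "{y. p y < 1} \<subseteq> {y. y + x \<in> U}"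
    using neighbourhood_contains_unit_ball[of "{y. y + x \<in> U}"] U(2) by auto
  obtain C where C: "C > 0" "\<And>y. p y \<le> C * norm y"
    using seminorm_bounded_by_norm[OF p(1,2)] by blast
  let ?q = "\<lambda>y. p ((1 / C) *\<^sub>R y)"
  have q: "?q y = p y / C" for y
    using C by (simp add: seminorm_scaleR[OF p(1)])
  have "continuous_map \<tau> euclideanreal ?q"
    using continuous_map_compose[OF continuous_affine[of "of_real (1 / C)" 0] p(2)]
    by (simp add: o_def smul_of_real del: of_real_divide)
  then have "?q \<in> N"
    using C p(1) unfolding cont_seminorms_def q
    by (auto simp: seminorm_def add_divide_distrib[symmetric] divide_right_mono field_simps)
  moreover have "{y. ?q (y - x) < 1 / C} \<subseteq> U"
  proof
    fix y assume "y \<in> {y. ?q (y - x) < 1 / C}"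
    then have "p (y - x) < 1"
      using C unfolding q by (simp add: divide_less_cancel)
    then show "y \<in> U"
      using p(3) by auto
  qed
  ultimately show ?thesis
    using C by (intro bexI[of _ ?q] exI[of _ "1 / C"]) auto
qed

lemma N_ball_open: "p \<in> N \<Longrightarrow> openin \<tau> {y. p (y - x) < e}"
  by (simp add: seminorm_ball_open N_seminorm N_continuous)

lemma limitin_iff: "limitin \<tau> f l F \<longleftrightarrow> (\<forall>p\<in>N. ((\<lambda>i. p (f i - l)) \<longlongrightarrow> 0) F)"
proof safe
  fix p assume lim: "limitin \<tau> f l F" and p: "p \<in> N"
  show "((\<lambda>i. p (f i - l)) \<longlongrightarrow> 0) F"
    unfolding tendsto_iff
  proof (intro allI impI)
    fix e :: real assume e: "e > 0"
    have "openin \<tau> {y. p (y - l) < e}" "l \<in> {y. p (y - l) < e}"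
      using N_ball_open[OF p] e seminorm_zero[OF N_seminorm[OF p]] by auto
    then have "\<forall>\<^sub>F i in F. f i \<in> {y. p (y - l) < e}"
      using lim unfolding limitin_def by blast
    then show "\<forall>\<^sub>F i in F. dist (p (f i - l)) 0 < e"
      using N_nonneg[OF p] by simp
  qed
next
  assume lim: "\<forall>p\<in>N. ((\<lambda>i. p (f i - l)) \<longlongrightarrow> 0) F"
  show "limitin \<tau> f l F"
    unfolding limitin_def
  proof (intro conjI allI impI)
    fix U assume "openin \<tau> U \<and> l \<in> U"
    then obtain p e where pe: "p \<in> N" "e > 0" "{y. p (y - l) < e} \<subseteq> U"
      using neighbourhood_contains_seminorm_ball by blast
    have "\<forall>\<^sub>F i in F. p (f i - l) < e"
      by (rule order_tendstoD(2)[OF lim[rule_format, OF pe(1)] pe(2)])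
    then show "\<forall>\<^sub>F i in F. f i \<in> U"
      by eventually_elim (use pe(3) in auto)
  qed simp
qed

lemma closure_eq_UNIV_iff:
  "\<tau> closure_of D = UNIV \<longleftrightarrow> (\<forall>p\<in>N. \<forall>x. \<forall>e>0. \<exists>y\<in>D. p (x - y) < e)"
proof safe
  fix p x and e :: real assume cl: "\<tau> closure_of D = UNIV" and p: "p \<in> N" and e: "e > 0"
  have "openin \<tau> {y. p (y - x) < e}" "x \<in> {y. p (y - x) < e}"
    using N_ball_open[OF p] e seminorm_zero[OF N_seminorm[OF p]] by auto
  moreover have "\<forall>T. x \<in> T \<and> openin \<tau> T \<longrightarrow> (\<exists>y. y \<in> D \<and> y \<in> T)"
    using cl in_closure_of[of x \<tau> D] by simp
  ultimately have "\<exists>y. y \<in> D \<and> y \<in> {y. p (y - x) < e}"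
    by meson
  then obtain y where "y \<in> D" "p (y - x) < e"
    by auto
  then show "\<exists>y\<in>D. p (x - y) < e"
    using seminorm_commute[OF N_seminorm[OF p], of x y] by force
next
  fix x assume *: "\<forall>p\<in>N. \<forall>x. \<forall>e>0. \<exists>y\<in>D. p (x - y) < e"
  show "x \<in> \<tau> closure_of D"
    unfolding in_closure_of
  proof (intro conjI allI impI)
    fix U assume "x \<in> U \<and> openin \<tau> U"
    then obtain p e where pe: "p \<in> N" "e > 0" "{y. p (y - x) < e} \<subseteq> U"
      using neighbourhood_contains_seminorm_ball by blast
    then obtain y where "y \<in> D" "p (x - y) < e"
      using * by blast
    then show "\<exists>y. y \<in> D \<and> y \<in> U"
      using pe seminorm_commute[OF N_seminorm[OF pe(1)], of x y] by auto
  qed simp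
qed auto

lemma Cauchy_convergent:
  assumes "\<And>p e. p \<in> N \<Longrightarrow> e > 0 \<Longrightarrow> \<exists>n0. \<forall>m\<ge>n0. \<forall>n\<ge>n0. p (f m - f n) < e"
  shows "\<exists>l. limitin \<tau> f l sequentially"
proof -
  have "\<exists>n0. \<forall>m\<ge>n0. \<forall>n\<ge>n0. f m - f n \<in> U" if U: "openin \<tau> U" "0 \<in> U" for U
  proof -
    obtain p e where pe: "p \<in> N" "e > 0" "{y. p (y - 0) < e} \<subseteq> U"
      using neighbourhood_contains_seminorm_ball[OF U] by blast
    then show ?thesis
      using assms[OF pe(1,2)] by (metis (mono_tags, lifting) diff_zero mem_Collect_eq subsetD)
  qed
  then show ?thesis
    using complete unfolding seq_complete_def by blast
qed

lemma continuous_linear_mapI: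
  assumes "linear T" "\<And>p. p \<in> N \<Longrightarrow> \<exists>q\<in>N. \<exists>C. \<forall>x. p (T x) \<le> C * q x"
  shows "continuous_map \<tau> \<tau> T"
  unfolding continuous_map_def
proof (intro conjI allI impI)
  fix U assume U: "openin \<tau> U"
  show "openin \<tau> {x \<in> topspace \<tau>. T x \<in> U}"
  proof (subst openin_subopen, safe)
    fix x assume "T x \<in> U"
    then obtain p e where pe: "p \<in> N" "e > 0" "{y. p (y - T x) < e} \<subseteq> U"
      using neighbourhood_contains_seminorm_ball U by blast
    obtain q C where qC: "q \<in> N" "\<And>x. p (T x) \<le> C * q x"
      using assms(2)[OF pe(1)] by blast
    have "T y \<in> U" if "q (y - x) < e / (\<bar>C\<bar> + 1)" for y
    proof -
      have "p (T y - T x) = p (T (y - x))"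
        using assms(1) by (simp add: linear_diff)
      also have "\<dots> \<le> (\<bar>C\<bar> + 1) * q (y - x)"
        using qC(2)[of "y - x"] N_nonneg[OF qC(1), of "y - x"] by (smt (verit) mult_right_mono)
      also have "\<dots> < e"
        using that by (simp add: field_simps)
      finally show ?thesis using pe(3) by auto
    qed
    then show "\<exists>T'. openin \<tau> T' \<and> x \<in> T' \<and> T' \<subseteq> {x \<in> topspace \<tau>. T x \<in> U}"
      using N_ball_open[OF qC(1), of x "e / (\<bar>C\<bar> + 1)"] pe(2) seminorm_zero[OF N_seminorm[OF qC(1)]]
      by (intro exI[of _ "{y. q (y - x) < e / (\<bar>C\<bar> + 1)}"]) (auto simp: add_nonneg_pos)
  qed
qed simp

lemma strongly_continuous_iff:
  "strongly_continuous \<tau> S \<longleftrightarrow>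
    (\<forall>x. \<forall>t\<ge>0. \<forall>p\<in>N. \<forall>e>0. \<exists>d>0. \<forall>s\<ge>0. \<bar>s - t\<bar> < d \<longrightarrow> p (S s x - S t x) < e)"
  (is "_ \<longleftrightarrow> (\<forall>x. ?C x)")
  unfolding strongly_continuous_def
proof (rule all_cong1)
  fix x
  show "continuous_map (top_of_set {0..}) \<tau> (\<lambda>t. S t x) \<longleftrightarrow> ?C x"
  proof safe
    fix t :: real and p and e :: real
    assume cont: "continuous_map (top_of_set {0..}) \<tau> (\<lambda>t. S t x)" and t: "0 \<le> t" "p \<in> N" "0 < e"
    have "openin (top_of_set {0..}) {s \<in> {0..}. S s x \<in> {y. p (y - S t x) < e}}"
      using openin_continuous_map_preimage[OF cont N_ball_open[OF t(2)]] by simp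
    moreover have "t \<in> {s \<in> {0..}. S s x \<in> {y. p (y - S t x) < e}}"
      using t seminorm_zero[OF N_seminorm[OF t(2)]] by simp
    ultimately obtain d where "d > 0" "\<forall>s\<in>{0..}. dist s t < d \<longrightarrow> s \<in> {s \<in> {0..}. S s x \<in> {y. p (y - S t x) < e}}"
      unfolding openin_euclidean_subtopology_iff by blast
    then show "\<exists>d>0. \<forall>s\<ge>0. \<bar>s - t\<bar> < d \<longrightarrow> p (S s x - S t x) < e"
      by (auto simp: dist_real_def)
  next
    assume C: "?C x"
    show "continuous_map (top_of_set {0..}) \<tau> (\<lambda>t. S t x)"
      unfolding continuous_map_def
    proof (intro conjI allI impI)
      fix U assume U: "openin \<tau> U"
      have "\<exists>d>0. \<forall>s\<in>{0..}. dist s t < d \<longrightarrow> S s x \<in> U" if t: "0 \<le> t" "S t x \<in> U" for t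
      proof -
        obtain p e where pe: "p \<in> N" "e > 0" "{y. p (y - S t x) < e} \<subseteq> U"
          using neighbourhood_contains_seminorm_ball U t by blast
        then obtain d where d: "d > 0" "\<And>s. s \<ge> 0 \<Longrightarrow> \<bar>s - t\<bar> < d \<Longrightarrow> p (S s x - S t x) < e"
          using C t by blast
        then show ?thesis
          using pe(3) by (intro exI[of _ d]) (auto simp: dist_real_def)
      qed
      then show "openin (top_of_set {0..}) {t \<in> topspace (top_of_set {0..}). S t x \<in> U}"
        unfolding openin_euclidean_subtopology_iff by auto
    qed simp
  qed
qed

text \<open>Makes \<open>N\<close> directed, so that smallness in finitely many seminorms can be
  achieved by one choice.\<close>

lemma N_max:
  assumes "p \<in> N" "q \<in> N"
  shows "(\<lambda>x. max (p x) (q x)) \<in> N"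
proof -
  have "seminorm smul (\<lambda>x. max (p x) (q x))"
    using seminorm_triangle[OF N_seminorm] seminorm_smul[OF N_seminorm] assms
    unfolding seminorm_def
    by (smt (verit) max_def mult_left_mono norm_ge_zero)
  moreover have "continuous_map \<tau> euclideanreal (\<lambda>x. max (p x) (q x))"
    using assms by (intro continuous_map_real_max N_continuous)
  ultimately show ?thesis
    using assms by (simp add: cont_seminorms_def)
qed

text \<open>Scaling by \<open>c\<close> first gives only an inequality between the suprema; for
  nonzero \<open>c\<close> it is reversed by applying it to \<open>inverse c\<close>.\<close>

lemma seminorm_SUP:
  fixes T :: "'i \<Rightarrow> 'a \<Rightarrow> 'a"
  assumes p: "seminorm smul p" and I: "I \<noteq> {}"
    and T: "\<And>i. i \<in> I \<Longrightarrow> Vector_Spaces.linear smul smul (T i)"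
    and bdd: "\<And>x. bdd_above ((\<lambda>i. p (T i x)) ` I)"
  shows "seminorm smul (\<lambda>x. SUP i\<in>I. p (T i x))"
  unfolding seminorm_def
proof (intro conjI allI)
  let ?q = "\<lambda>x. SUP i\<in>I. p (T i x)"
  have up: "p (T i x) \<le> ?q x" if "i \<in> I" for i x
    using that bdd by (intro cSUP_upper)
  have add: "T i (x + y) = T i x + T i y" and scale: "T i (smul c x) = smul c (T i x)" if "i \<in> I" for i x y c
    using T[OF that] by (auto simp: Vector_Spaces.linear_iff)
  show "?q (x + y) \<le> ?q x + ?q y" for x y
  proof (rule cSUP_least[OF I])
    fix i assume i: "i \<in> I"
    show "p (T i (x + y)) \<le> ?q x + ?q y"
      unfolding add[OF i]
      using seminorm_triangle[OF p, of "T i x" "T i y"] up[OF i, of x] up[OF i, of y] by linarith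
  qed
  have le: "?q (smul c x) \<le> norm c * ?q x" for c x
    using up by (intro cSUP_least[OF I]) (auto simp: scale seminorm_smul[OF p] mult_left_mono)
  have "?q 0 = 0"
    using I scale[of _ 0 0] by (simp add: seminorm_zero[OF p] cong: SUP_cong_simp)
  then show "?q (smul c x) = norm c * ?q x" for c x
  proof (cases "c = 0")
    case False
    have "norm c * ?q x = norm c * ?q (smul (inverse c) (smul c x))"
      using False by simp
    also have "\<dots> \<le> norm c * (norm (inverse c) * ?q (smul c x))"
      by (intro mult_left_mono le norm_ge_zero)
    also have "\<dots> = ?q (smul c x)"
      using False by (simp add: norm_inverse)
    finally show ?thesis
      using le by (intro antisym)
  qed auto
qed

end

section \<open>Limits measured in seminorms dominated by members of \<open>N\<close>\<close>

context seq_complete_lcs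
begin

text \<open>Members of \<open>N\<close> must lie below the norm, and an orbit supremum need not. A
  bound by a multiple of a member of \<open>N\<close> is all that passing to limits
  requires.\<close>

definition controlled :: "('a \<Rightarrow> real) \<Rightarrow> bool"
  where "controlled p \<longleftrightarrow> seminorm smul p \<and> (\<exists>q\<in>N. \<exists>C. \<forall>x. p x \<le> C * q x)"

lemma N_controlled: "p \<in> N \<Longrightarrow> controlled p"
  unfolding controlled_def by (auto intro!: N_seminorm bexI[of _ p] exI[of _ 1])

lemma controlled_seminorm: "controlled p \<Longrightarrow> seminorm smul p"
  by (simp add: controlled_def)

lemma limitin_controlled_diff:
  assumes "controlled p" "limitin \<tau> f l F"
  shows "((\<lambda>i. p (f i - l)) \<longlongrightarrow> 0) F"
proof -
  obtain q C where q: "q \<in> N" "\<And>x. p x \<le> C * q x"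
    using assms(1) unfolding controlled_def by blast
  have "((\<lambda>i. C * q (f i - l)) \<longlongrightarrow> 0) F"
    using assms(2) q(1) unfolding limitin_iff by (auto intro!: tendsto_mult_right_zero)
  then show ?thesis
    by (rule tendsto_0_le[where K = 1])
       (auto simp: seminorm_nonneg[OF controlled_seminorm[OF assms(1)]] intro!: always_eventually
          order_trans[OF q(2)])
qed

lemma limitin_controlled:
  assumes "controlled p" "limitin \<tau> f l F"
  shows "((\<lambda>i. p (f i)) \<longlongrightarrow> p l) F"
proof (rule LIM_zero_cancel, rule tendsto_0_le[where K = 1])
  show "((\<lambda>i. p (f i - l)) \<longlongrightarrow> 0) F"
    by (rule limitin_controlled_diff[OF assms])
  show "\<forall>\<^sub>F i in F. norm (p (f i) - p l) \<le> norm (p (f i - l)) * 1"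
    using seminorm_abs_diff[OF controlled_seminorm[OF assms(1)]]
    by (auto intro!: always_eventually order_trans[OF _ abs_ge_self])
qed

lemma limitin_N:
  "p \<in> N \<Longrightarrow> limitin \<tau> f l F \<Longrightarrow> ((\<lambda>i. p (f i)) \<longlongrightarrow> p l) F"
  by (simp add: limitin_controlled N_controlled)

lemma limitinI_le:
  assumes "\<And>p. p \<in> N \<Longrightarrow> \<exists>g. (g \<longlongrightarrow> 0) F \<and> (\<forall>\<^sub>F i in F. p (f i - l) \<le> g i)"
  shows "limitin \<tau> f l F"
  unfolding limitin_iff
proof
  fix p assume p: "p \<in> N"
  obtain g where g: "(g \<longlongrightarrow> 0) F" "\<forall>\<^sub>F i in F. p (f i - l) \<le> g i"
    using assms[OF p] by blast
  show "((\<lambda>i. p (f i - l)) \<longlongrightarrow> 0) F"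
    by (rule tendsto_sandwich[OF _ g(2) tendsto_const g(1)]) (simp add: N_nonneg[OF p])
qed

lemma limitin_add:
  assumes "limitin \<tau> f l F" "limitin \<tau> g m F"
  shows "limitin \<tau> (\<lambda>i. f i + g i) (l + m) F"
proof (rule limitinI_le)
  fix p assume p: "p \<in> N"
  have "((\<lambda>i. p (f i - l) + p (g i - m)) \<longlongrightarrow> 0) F"
    using assms p unfolding limitin_iff by (auto intro: tendsto_add_zero)
  moreover have "p (f i + g i - (l + m)) \<le> p (f i - l) + p (g i - m)" for i
    using seminorm_triangle[OF N_seminorm[OF p], of "f i - l" "g i - m"] by (simp add: algebra_simps)
  ultimately show "\<exists>h. (h \<longlongrightarrow> 0) F \<and> (\<forall>\<^sub>F i in F. p (f i + g i - (l + m)) \<le> h i)"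
    by (auto intro!: exI[of _ "\<lambda>i. p (f i - l) + p (g i - m)"])
qed

lemma limitin_smul:
  assumes "limitin \<tau> f l F"
  shows "limitin \<tau> (\<lambda>i. smul c (f i)) (smul c l) F"
  unfolding limitin_iff
proof
  fix p assume p: "p \<in> N"
  have "((\<lambda>i. norm c * p (f i - l)) \<longlongrightarrow> 0) F"
    using assms p unfolding limitin_iff by (auto intro: tendsto_mult_right_zero)
  then show "((\<lambda>i. p (smul c (f i) - smul c l)) \<longlongrightarrow> 0) F"
    by (simp add: seminorm_smul[OF N_seminorm[OF p]] flip: scale_right_diff_distrib)
qed

lemma limitin_scaleR: "limitin \<tau> f l F \<Longrightarrow> limitin \<tau> (\<lambda>i. r *\<^sub>R f i) (r *\<^sub>R l) F"
  using limitin_smul[of f l F "of_real r"] by (simp add: smul_of_real)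

lemma limitin_diff:
  "limitin \<tau> f l F \<Longrightarrow> limitin \<tau> g m F \<Longrightarrow> limitin \<tau> (\<lambda>i. f i - g i) (l - m) F"
  using limitin_add[of f l F "\<lambda>i. (- 1) *\<^sub>R g i" "(- 1) *\<^sub>R m"] limitin_scaleR[of g m F "- 1"] by simp

lemma limitin_scaleR_tendsto:
  assumes "(a \<longlongrightarrow> c) F" "limitin \<tau> f l F"
  shows "limitin \<tau> (\<lambda>i. a i *\<^sub>R f i) (c *\<^sub>R l) F"
proof (rule limitinI_le)
  fix p assume p: "p \<in> N"
  have "((\<lambda>i. \<bar>a i\<bar> * p (f i - l) + \<bar>a i - c\<bar> * p l) \<longlongrightarrow> \<bar>c\<bar> * 0 + \<bar>c - c\<bar> * p l) F"
    using assms p unfolding limitin_iff by (intro tendsto_intros) auto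
  moreover have "p (a i *\<^sub>R f i - c *\<^sub>R l) \<le> \<bar>a i\<bar> * p (f i - l) + \<bar>a i - c\<bar> * p l" for i
  proof -
    have "a i *\<^sub>R f i - c *\<^sub>R l = a i *\<^sub>R (f i - l) + (a i - c) *\<^sub>R l"
      by (simp add: algebra_simps)
    then show ?thesis
      using seminorm_triangle[OF N_seminorm[OF p]] by (metis seminorm_scaleR[OF N_seminorm[OF p]])
  qed
  ultimately show "\<exists>g. (g \<longlongrightarrow> 0) F \<and> (\<forall>\<^sub>F i in F. p (a i *\<^sub>R f i - c *\<^sub>R l) \<le> g i)"
    by (auto intro!: exI[of _ "\<lambda>i. \<bar>a i\<bar> * p (f i - l) + \<bar>a i - c\<bar> * p l"])
qed

lemma limitin_scaleR_left: "(a \<longlongrightarrow> c) F \<Longrightarrow> limitin \<tau> (\<lambda>i. a i *\<^sub>R x) (c *\<^sub>R x) F"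
  by (rule limitin_scaleR_tendsto) simp_all

lemma limitin_unique: "limitin \<tau> f l F \<Longrightarrow> limitin \<tau> f m F \<Longrightarrow> F \<noteq> bot \<Longrightarrow> l = m"
  by (rule limitin_Hausdorff_unique[OF _ _ _ Hausdorff])

text \<open>Linearity is asked only eventually because the Euler operators are known to be linear
  only once their step is small.\<close>

lemma linear_limitin:
  assumes linear: "\<forall>\<^sub>F i in F. Vector_Spaces.linear smul smul (T i)"
    and lim: "\<And>x. limitin \<tau> (\<lambda>i. T i x) (R x) F" and F: "F \<noteq> bot"
  shows "Vector_Spaces.linear smul smul R"
proof (rule linear_smulI)
  fix x y
  have "\<forall>\<^sub>F i in F. T i x + T i y = T i (x + y)"
    using linear by eventually_elim (simp add: Vector_Spaces.linear_iff)
  then have "limitin \<tau> (\<lambda>i. T i (x + y)) (R x + R y) F"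
    by (rule limitin_transform_eventually[OF _ limitin_add[OF lim lim]])
  then show "R (x + y) = R x + R y"
    by (rule limitin_unique[OF lim _ F])
next
  fix c x
  have "\<forall>\<^sub>F i in F. smul c (T i x) = T i (smul c x)"
    using linear by eventually_elim (simp add: Vector_Spaces.linear_iff)
  then have "limitin \<tau> (\<lambda>i. T i (smul c x)) (smul c (R x)) F"
    by (rule limitin_transform_eventually[OF _ limitin_smul[OF lim]])
  then show "R (smul c x) = smul c (R x)"
    by (rule limitin_unique[OF lim _ F])
qed

text \<open>There is no constant in front of the exponential, so the estimate can be composed with
  itself; the positive rate makes integrals over \<open>[0, \<infinity>)\<close> converge.\<close>

definition contractive :: "(real \<Rightarrow> 'a \<Rightarrow> 'a) \<Rightarrow> real \<Rightarrow> ('a \<Rightarrow> real) \<Rightarrow> bool"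
  where "contractive T \<delta> p \<longleftrightarrow> controlled p \<and> \<delta> > 0 \<and> (\<forall>t\<ge>0. \<forall>x. p (T t x) \<le> exp (- \<delta> * t) * p x)"

end

section \<open>The resolvent of an exponentially stable semigroup\<close>

text \<open>Abstracts \<open>exp (- \<mu> * t) *\<^sub>R S t x\<close> with
  \<open>\<mu> > \<omega>\<close>. The shift by \<open>\<mu>\<close> turns the resolvent at
  \<open>\<mu>\<close> into the inverse of the negative generator, that is, into the integral of the
  orbit over \<open>[0, \<infinity>)\<close>.\<close>

locale stable_semigroup = seq_complete_lcs +
  fixes T :: "real \<Rightarrow> 'b \<Rightarrow> 'b"
  assumes linear_T: "t \<ge> 0 \<Longrightarrow> Vector_Spaces.linear smul smul (T t)"
    and T_0 [simp]: "T 0 x = x"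
    and T_add: "t \<ge> 0 \<Longrightarrow> s \<ge> 0 \<Longrightarrow> T (t + s) x = T t (T s x)"
    and T_right_continuous: "p \<in> N \<Longrightarrow> e > 0 \<Longrightarrow> \<exists>d>0. \<forall>s. 0 \<le> s \<and> s < d \<longrightarrow> p (T s x - x) < e"
    and ex_contractive: "p \<in> N \<Longrightarrow> \<exists>p' \<delta>. contractive T \<delta> p' \<and> (\<forall>x. p x \<le> p' x)"
begin

lemma T_plus: "t \<ge> 0 \<Longrightarrow> T t (x + y) = T t x + T t y"
  and T_smul: "t \<ge> 0 \<Longrightarrow> T t (smul c x) = smul c (T t x)"
  using linear_T[of t] by (auto simp: Vector_Spaces.linear_iff)

lemma real_linear_T: "t \<ge> 0 \<Longrightarrow> linear (T t)"
  by (simp add: linear_smul_imp_linear linear_T)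

lemma contractive_le:
  assumes "contractive T \<delta> p" "t \<ge> 0"
  shows "p (T t x) \<le> exp (- \<delta> * t) * p x" "p (T t x) \<le> p x"
proof -
  show 1: "p (T t x) \<le> exp (- \<delta> * t) * p x"
    using assms by (simp add: contractive_def)
  have "exp (- \<delta> * t) * p x \<le> 1 * p x"
    using assms by (intro mult_right_mono) (auto simp: contractive_def controlled_def seminorm_nonneg)
  with 1 show "p (T t x) \<le> p x" by simp
qed

lemma contractive_seminorm: "contractive T \<delta> p \<Longrightarrow> seminorm smul p"
  by (simp add: contractive_def controlled_seminorm)

lemma contractive_controlled: "contractive T \<delta> p \<Longrightarrow> controlled p"
  by (simp add: contractive_def)

lemma T_continuous: 
  assumes "t \<ge> 0"
  shows "continuous_map \<tau> \<tau> (T t)"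
proof (rule continuous_linear_mapI)
  fix p assume "p \<in> N"
  then obtain p' \<delta> where p': "contractive T \<delta> p'" "\<And>x. p x \<le> p' x"
    using ex_contractive by blast
  then obtain q C where "q \<in> N" "\<And>x. p' x \<le> C * q x"
    unfolding contractive_def controlled_def by blast
  then show "\<exists>q\<in>N. \<exists>C. \<forall>x. p (T t x) \<le> C * q x"
    using p'(2) contractive_le(2)[OF p'(1) assms] by (meson order_trans)
qed (simp add: assms real_linear_T)

lemma contractive_right_continuous:
  assumes "contractive T \<delta> p" "e > 0"
  shows "\<exists>d>0. \<forall>s. 0 \<le> s \<and> s < d \<longrightarrow> p (T s x - x) \<le> e"
proof -
  obtain q C where q: "q \<in> N" "\<And>x. p x \<le> C * q x"
    using assms(1) unfolding contractive_def controlled_def by blast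
  obtain d where d: "d > 0" "\<forall>s. 0 \<le> s \<and> s < d \<longrightarrow> q (T s x - x) < e / (\<bar>C\<bar> + 1)"
    using T_right_continuous[OF q(1), of "e / (\<bar>C\<bar> + 1)" x] assms(2)
    by (auto simp: add_nonneg_pos)
  have "p (T s x - x) \<le> e" if "0 \<le> s" "s < d" for s
  proof -
    have "p (T s x - x) \<le> (\<bar>C\<bar> + 1) * q (T s x - x)"
      using q(2)[of "T s x - x"] N_nonneg[OF q(1), of "T s x - x"] by (smt (verit) mult_right_mono)
    also have "\<dots> \<le> e"
      using d(2)[rule_format, of s] that
      by (simp add: pos_less_divide_eq mult.commute add_nonneg_pos)
    finally show ?thesis .
  qed
  with d(1) show ?thesis by blast
qed

section \<open>Dyadic Riemann sums for the integral of an orbit over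
  \<open>[0, m / 2 ^ n]\<close>\<close>

definition V :: "nat \<Rightarrow> nat \<Rightarrow> 'b \<Rightarrow> 'b"
  where "V n m x = (1 / 2 ^ n) *\<^sub>R (\<Sum>k<m. T (real k / 2 ^ n) x)"

lemma V_plus: "V n m (x + y) = V n m x + V n m y"
  and V_smul: "V n m (smul c x) = smul c (V n m x)"
  by (simp_all add: V_def T_plus T_smul sum.distrib scaleR_add_right scale_sum_right smul_scaleR)

lemma V_linear: "linear (V n m)"
  by (intro linear_smul_imp_linear linear_smulI V_plus V_smul)

lemma T_V: "t \<ge> 0 \<Longrightarrow> T t (V n m x) = V n m (T t x)"
  unfolding V_def
  by (simp add: linear_scale[OF real_linear_T] linear_sum[OF real_linear_T] T_add[symmetric] add.commute)

text \<open>Additivity of the integral over adjacent intervals: the semigroup law moves the second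
  interval to the origin.\<close>

lemma V_add: "V n (a + b) x = V n a x + T (a / 2 ^ n) (V n b x)"
proof -
  have "T ((a + k) / 2 ^ n) x = T (a / 2 ^ n) (T (real k / 2 ^ n) x)" for k
    by (simp add: T_add[symmetric] add_divide_distrib)
  then have "(\<Sum>k<a + b. T (real k / 2 ^ n) x) = (\<Sum>k<a. T (real k / 2 ^ n) x) + (\<Sum>k<b. T (a / 2 ^ n) (T (real k / 2 ^ n) x))"
    by (induction b) (simp_all add: add.assoc)
  then show ?thesis
    by (simp add: V_def scaleR_add_right linear_scale[OF real_linear_T] linear_sum[OF real_linear_T])
qed

text \<open>Each block of fine steps is a translate of the first block. So refining the mesh amounts
  to keeping the coarse sum and replacing \<open>x\<close> by the mean of its orbit over the first
  coarse interval; the refinement error thus depends only on continuity at time 0.\<close>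

lemma V_refine: "V (n + d) (K * 2 ^ d) x = V n K (2 ^ n *\<^sub>R V (n + d) (2 ^ d) x)"
proof -
  have inner: "(\<Sum>k\<in>{i * 2 ^ d..<i * 2 ^ d + 2 ^ d}. T (real k / 2 ^ (n + d)) x)
      = T (i / 2 ^ n) (\<Sum>j<2 ^ d. T (real j / 2 ^ (n + d)) x)" for i :: nat
  proof -
    have "T (real (j + i * 2 ^ d) / 2 ^ (n + d)) x = T (i / 2 ^ n) (T (real j / 2 ^ (n + d)) x)" for j
      by (simp add: T_add[symmetric] add_divide_distrib power_add add.commute)
    then show ?thesis
      using sum.shift_bounds_nat_ivl[of "\<lambda>k. T (real k / 2 ^ (n + d)) x" 0 "i * 2 ^ d" "2 ^ d"]
      by (simp add: add.commute linear_sum[OF real_linear_T] atLeast0LessThan)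
  qed
  have "(\<Sum>k<K * 2 ^ d. T (real k / 2 ^ (n + d)) x) = (\<Sum>i<K. T (i / 2 ^ n) (\<Sum>j<2 ^ d. T (real j / 2 ^ (n + d)) x))"
    unfolding inner[symmetric] by (rule sum.nat_group[symmetric])
  then show ?thesis
    by (simp add: V_def linear_scale[OF real_linear_T] power_add flip: scaleR_sum_right)
qed

text \<open>A geometric series with ratio \<open>y = exp (- \<delta> * h)\<close>, where
  \<open>h / (1 - y) \<le> 1 / \<delta> + h\<close> follows from
  \<open>1 + \<delta> * h \<le> exp (\<delta> * h)\<close>. The mesh term disappears in the limit
  and leaves exactly \<open>1 / \<delta>\<close>, the constant that can be iterated without
  loss.\<close>

lemma V_bound:
  assumes "contractive T \<delta> p"
  shows "p (V n m x) \<le> (1 / \<delta> + 1 / 2 ^ n) * p x"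
proof -
  define h :: real where "h = 1 / 2 ^ n"
  define y where "y = exp (- \<delta> * h)"
  have h: "h > 0" and \<delta>: "\<delta> > 0"
    using assms by (auto simp: h_def contractive_def)
  note p = contractive_seminorm[OF assms]
  have y: "0 < y" "y < 1"
    using h \<delta> by (auto simp: y_def)
  have "(1 + \<delta> * h) * y \<le> exp (\<delta> * h) * y"
    using y by (intro mult_right_mono) auto
  also have "\<dots> = 1"
    by (simp add: y_def flip: exp_add)
  finally have hy: "h \<le> (1 / \<delta> + h) * (1 - y)"
    using \<delta> by (simp add: field_simps)
  have G: "(1 - y) * (\<Sum>k<m. y ^ k) \<le> 1"
    using y by (simp flip: one_diff_power_eq)
  have "p (V n m x) = h * p (\<Sum>k<m. T (real k / 2 ^ n) x)"
    by (simp add: V_def h_def seminorm_scaleR[OF p])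
  also have "\<dots> \<le> h * (\<Sum>k<m. y ^ k * p x)"
  proof (intro mult_left_mono order_trans[OF seminorm_sum[OF p]] sum_mono)
    fix k
    show "p (T (real k / 2 ^ n) x) \<le> y ^ k * p x"
      using contractive_le(1)[OF assms, of "k / 2 ^ n" x]
      by (simp add: y_def h_def mult_ac flip: exp_of_nat_mult)
  qed (use h in auto)
  also have "\<dots> = h * (\<Sum>k<m. y ^ k) * p x"
    by (simp add: sum_distrib_right)
  also have "\<dots> \<le> ((1 / \<delta> + h) * (1 - y) * (\<Sum>k<m. y ^ k)) * p x"
    using hy y by (intro mult_right_mono seminorm_nonneg[OF p] sum_nonneg) auto
  also have "\<dots> \<le> (1 / \<delta> + h) * p x"
    using G h \<delta> mult_left_mono[OF G, of "1 / \<delta> + h"]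
    by (intro mult_right_mono seminorm_nonneg[OF p]) (auto simp: mult.assoc)
  finally show ?thesis by (simp add: h_def)
qed

lemma V_bound':
  assumes "contractive T \<delta> p"
  shows "p (V n m x) \<le> (1 / \<delta> + 1) * p x"
  by (rule order_trans[OF V_bound[OF assms]])
     (intro mult_right_mono seminorm_nonneg[OF contractive_seminorm[OF assms]], simp)

lemma V_approx:
  assumes p: "seminorm smul p" and e: "\<And>s. 0 \<le> s \<Longrightarrow> s \<le> m / 2 ^ n \<Longrightarrow> p (T s x - x) \<le> e"
  shows "p (V n m x - (m / 2 ^ n) *\<^sub>R x) \<le> m / 2 ^ n * e"
proof -
  have "V n m x - (m / 2 ^ n) *\<^sub>R x = (1 / 2 ^ n) *\<^sub>R (\<Sum>k<m. T (real k / 2 ^ n) x - x)"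
    by (simp add: V_def sum_subtractf scaleR_diff_right sum_constant_scaleR)
  also have "p \<dots> \<le> (1 / 2 ^ n) * (\<Sum>k<m. p (T (real k / 2 ^ n) x - x))"
    unfolding seminorm_scaleR[OF p] by (auto intro!: mult_left_mono seminorm_sum p divide_right_mono)
  also have "\<dots> \<le> (1 / 2 ^ n) * (\<Sum>k<m. e)"
    using e by (intro mult_left_mono sum_mono) (auto simp: divide_right_mono)
  finally show ?thesis by simp
qed

text \<open>Mesh \<open>1 / 2 ^ n\<close> and horizon \<open>n\<close> change together, so that one
  sequence approximates the integral over all of \<open>[0, \<infinity>)\<close>.\<close>

abbreviation r :: "nat \<Rightarrow> 'b \<Rightarrow> 'b"
  where "r n \<equiv> V n (n * 2 ^ n)"

text \<open>Two errors add up. On \<open>[0, n]\<close> the refinement replaces \<open>x\<close> by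
  an orbit mean at distance at most \<open>e\<close>; the part beyond time \<open>n\<close> is an
  image under \<open>T n\<close> and decays like \<open>exp (- \<delta> * n)\<close>.\<close>

lemma r_diff_le:
  assumes c: "contractive T \<delta> p" and e: "\<And>s. 0 \<le> s \<Longrightarrow> s \<le> 1 / 2 ^ n \<Longrightarrow> p (T s x - x) \<le> e"
  shows "p (r (n + d) x - r n x) \<le> (1 / \<delta> + 1) * (e + exp (- \<delta> * n) * p x)"
proof -
  note p = contractive_seminorm[OF c]
  have \<delta>: "\<delta> > 0" using c by (simp add: contractive_def)
  define y where "y = 2 ^ n *\<^sub>R V (n + d) (2 ^ d) x - x"
  define z where "z = V (n + d) (d * 2 ^ (n + d)) x"
  have "r (n + d) x = V (n + d) ((n * 2 ^ n) * 2 ^ d) x + T n z"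
    unfolding z_def using V_add[of "n + d" "(n * 2 ^ n) * 2 ^ d" "d * 2 ^ (n + d)" x]
    by (simp add: power_add algebra_simps)
  then have eq: "r (n + d) x - r n x = V n (n * 2 ^ n) y + T n z"
    by (simp add: V_refine y_def linear_diff[OF V_linear])
  have "p y = 2 ^ n * p (V (n + d) (2 ^ d) x - (1 / 2 ^ n) *\<^sub>R x)"
    using seminorm_scaleR[OF p, of "2 ^ n" "V (n + d) (2 ^ d) x - (1 / 2 ^ n) *\<^sub>R x"]
    by (simp add: y_def scaleR_diff_right)
  also have "\<dots> \<le> 2 ^ n * (1 / 2 ^ n * e)"
    using V_approx[OF p, of "2 ^ d" "n + d" x e] e
    by (intro mult_left_mono) (auto simp: power_add)
  finally have y: "p y \<le> e" by simp
  have "p (V n (n * 2 ^ n) y) \<le> (1 / \<delta> + 1) * e"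
    using \<delta> by (intro order_trans[OF V_bound'[OF c]] mult_left_mono y) auto
  moreover have "p (T n z) \<le> exp (- \<delta> * n) * ((1 / \<delta> + 1) * p x)"
    unfolding z_def
    by (intro order_trans[OF contractive_le(1)[OF c]] mult_left_mono V_bound'[OF c]) auto
  ultimately show ?thesis
    unfolding eq using seminorm_triangle[OF p, of "V n (n * 2 ^ n) y" "T n z"]
    by (simp add: algebra_simps)
qed

lemma r_convergent: "\<exists>l. limitin \<tau> (\<lambda>n. r n x) l sequentially"
proof (rule Cauchy_convergent)
  fix p and e :: real assume pN: "p \<in> N" and e: "e > 0"
  obtain p' \<delta> where p': "contractive T \<delta> p'" "\<And>x. p x \<le> p' x"
    using ex_contractive[OF pN] by blast
  have \<delta>: "\<delta> > 0" using p' by (simp add: contractive_def)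
  define C where "C = 1 / \<delta> + 1"
  have C: "C > 0" using \<delta> by (simp add: C_def add_pos_pos)
  \<comment> \<open>Both errors in \<open>r_diff_le\<close> are made at most
    \<open>e / (8 * C)\<close>, which puts every later \<open>r m x\<close> within
    \<open>e / 4\<close> of \<open>r n x\<close>.\<close>
  obtain d where d: "d > 0" "\<And>s. 0 \<le> s \<Longrightarrow> s < d \<Longrightarrow> p' (T s x - x) \<le> e / (8 * C)"
    using contractive_right_continuous[OF p'(1), of "e / (8 * C)" x] e C by auto
  have "(\<lambda>n. exp (- \<delta>) ^ n * p' x) \<longlonglongrightarrow> 0"
    using \<delta> by (intro tendsto_mult_left_zero LIMSEQ_realpow_zero) auto
  then have "\<forall>\<^sub>F n in sequentially. exp (- \<delta>) ^ n * p' x < e / (8 * C)"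
    by (rule order_tendstoD(2)) (use e C in auto)
  moreover note eventually_dyadic_lt[OF d(1)]
  ultimately have "\<forall>\<^sub>F n in sequentially. exp (- \<delta>) ^ n * p' x < e / (8 * C) \<and> 1 / 2 ^ n < d"
    by eventually_elim simp
  then obtain n where n: "exp (- \<delta> * n) * p' x < e / (8 * C)" "1 / 2 ^ n < d"
    by (auto simp: eventually_sequentially mult.commute simp flip: exp_of_nat_mult)
  have close: "p (r m x - r n x) \<le> e / 4" if "m \<ge> n" for m
  proof -
    have "p' (r (n + (m - n)) x - r n x) \<le> C * (e / (8 * C) + exp (- \<delta> * n) * p' x)"
      unfolding C_def using d(2) n(2) by (intro r_diff_le[OF p'(1)]) (auto simp flip: C_def)
    also have "\<dots> \<le> C * (e / (8 * C) + e / (8 * C))"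
      using n(1) C by (intro mult_left_mono add_mono) auto
    finally show ?thesis
      using that p'(2)[of "r m x - r n x"] C by (simp add: field_simps)
  qed
  have "p (r i x - r j x) < e" if "i \<ge> n" "j \<ge> n" for i j
    using seminorm_diff_trans[OF N_seminorm[OF pN], of "r i x" "r j x" "r n x"]
      close[OF that(1)] close[OF that(2)] e seminorm_commute[OF N_seminorm[OF pN], of "r j x" "r n x"]
    by linarith
  then show "\<exists>n0. \<forall>i\<ge>n0. \<forall>j\<ge>n0. p (r i x - r j x) < e"
    by blast
qed

section \<open>The integral over \<open>[0, \<infinity>)\<close> and its relation to the
  generator\<close>

definition R :: "'b \<Rightarrow> 'b"
  where "R x = (SOME l. limitin \<tau> (\<lambda>n. r n x) l sequentially)"

lemma limitin_R: "limitin \<tau> (\<lambda>n. r n x) (R x) sequentially"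
  unfolding R_def by (rule someI_ex[OF r_convergent])

lemma R_linear: "Vector_Spaces.linear smul smul R"
  by (rule linear_limitin[OF _ limitin_R]) (intro always_eventually allI linear_smulI V_plus V_smul, simp)

lemma T_R: "t \<ge> 0 \<Longrightarrow> T t (R x) = R (T t x)"
  using continuous_map_limit[OF T_continuous limitin_R[of x], of t] limitin_R[of "T t x"]
  by (auto simp: o_def T_V intro: limitin_unique)

lemma R_bound:
  assumes "contractive T \<delta> p"
  shows "p (R x) \<le> 1 / \<delta> * p x"
proof (rule LIMSEQ_le)
  show "(\<lambda>n. p (r n x)) \<longlonglongrightarrow> p (R x)"
    by (rule limitin_controlled[OF contractive_controlled[OF assms] limitin_R])
  have "(\<lambda>n. (1 / \<delta> + (1 / 2) ^ n) * p x) \<longlonglongrightarrow> (1 / \<delta> + 0) * p x"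
    by (intro tendsto_intros LIMSEQ_realpow_zero) auto
  then show "(\<lambda>n. (1 / \<delta> + 1 / 2 ^ n) * p x) \<longlonglongrightarrow> 1 / \<delta> * p x"
    by (simp add: power_one_over)
qed (use V_bound[OF assms] in blast)

text \<open>Discrete form of the fact that \<open>R x - T s (R x)\<close> is the integral of
  \<open>T u x\<close> over \<open>[0, s]\<close>. Since \<open>s\<close> need not be a grid point,
  the grid point \<open>m / 2 ^ n\<close> below it is used. The four terms stem from the oscillation
  on \<open>[0, s]\<close>, the remainder \<open>\<rho>\<close>, the cut-off at time
  \<open>n\<close>, and the shift by \<open>\<rho>\<close> inside \<open>r n\<close>.\<close>

lemma r_quotient_le:
  assumes c: "contractive T \<delta> p" and s: "s \<ge> 0"
    and e: "\<And>u. 0 \<le> u \<Longrightarrow> u \<le> s \<Longrightarrow> p (T u x - x) \<le> e"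
    and e': "\<And>u. 0 \<le> u \<Longrightarrow> u \<le> 1 / 2 ^ n \<Longrightarrow> p (T u x - x) \<le> e'"
  shows "p (r n x - T s (r n x) - s *\<^sub>R x)
    \<le> s * e + 1 / 2 ^ n * p x + (1 / \<delta> + 1) * (exp (- \<delta> * n) * p x + e')"
proof -
  note p = contractive_seminorm[OF c]
  have \<delta>: "\<delta> > 0" using c by (simp add: contractive_def)
  have e0: "e \<ge> 0" using e[of 0] s by (simp add: seminorm_zero[OF p])
  define m where "m = nat \<lfloor>s * 2 ^ n\<rfloor>"
  define \<rho> where "\<rho> = s - m / 2 ^ n"
  have m: "real m = of_int \<lfloor>s * 2 ^ n\<rfloor>"
    using s by (simp add: m_def)
  have "real m \<le> s * 2 ^ n" "s * 2 ^ n < real m + 1"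
    unfolding m by linarith+
  then have \<rho>: "0 \<le> \<rho>" "\<rho> \<le> 1 / 2 ^ n" and ms: "m / 2 ^ n \<le> s"
    by (simp_all add: \<rho>_def diff_le_eq pos_divide_le_eq pos_le_divide_eq less_imp_le
        flip: add_divide_distrib)
  let ?K = "n * 2 ^ n" and ?m = "m / 2 ^ n"
  \<comment> \<open>The sum over \<open>[0, n + m / 2 ^ n]\<close> is split once at \<open>n\<close>
    and once at \<open>m / 2 ^ n\<close>.\<close>
  have "V n ?K x + T n (V n m x) = V n m x + T ?m (r n x)"
    using V_add[of n ?K m x] V_add[of n m ?K x] by (simp add: add.commute)
  then have 1: "r n x - T ?m (r n x) = V n m x - T n (V n m x)"
    by (simp add: algebra_simps)
  have "T s (r n x) = T ?m (T \<rho> (r n x))"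
    using T_add[of ?m \<rho>] \<rho> by (simp add: \<rho>_def)
  then have 2: "T ?m (r n x) - T s (r n x) = T ?m (r n (x - T \<rho> x))"
    using \<rho> by (simp add: linear_diff[OF real_linear_T] linear_diff[OF V_linear] T_V)
  have "r n x - T s (r n x) - s *\<^sub>R x
      = (V n m x - ?m *\<^sub>R x) - \<rho> *\<^sub>R x - T n (V n m x) + T ?m (r n (x - T \<rho> x))"
    unfolding 2[symmetric] using 1 by (simp add: algebra_simps \<rho>_def)
  also have "p \<dots> \<le> p (V n m x - ?m *\<^sub>R x) + p (\<rho> *\<^sub>R x) + p (T n (V n m x)) + p (T ?m (r n (x - T \<rho> x)))"
    by (intro order_trans[OF seminorm_triangle[OF p]] order_trans[OF seminorm_diff[OF p]] add_mono order_refl)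
  also have "p (V n m x - ?m *\<^sub>R x) \<le> s * e"
    using e ms e0 by (intro order_trans[OF V_approx[OF p, of m n x e]] mult_right_mono) auto
  also have "p (\<rho> *\<^sub>R x) \<le> 1 / 2 ^ n * p x"
    using \<rho> unfolding seminorm_scaleR[OF p] by (intro mult_right_mono seminorm_nonneg[OF p]) simp
  also have "p (T n (V n m x)) \<le> exp (- \<delta> * n) * ((1 / \<delta> + 1) * p x)"
    by (intro order_trans[OF contractive_le(1)[OF c]] mult_left_mono V_bound'[OF c]) auto
  also have "p (T ?m (r n (x - T \<rho> x))) \<le> (1 / \<delta> + 1) * e'"
    using \<delta> e'[OF \<rho>] seminorm_commute[OF p, of x "T \<rho> x"]
    by (intro order_trans[OF contractive_le(2)[OF c]] order_trans[OF V_bound'[OF c]] mult_left_mono) auto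
  finally show ?thesis
    by (simp add: algebra_simps)
qed

text \<open>As \<open>n\<close> tends to infinity, only the oscillation on \<open>[0, s]\<close> and
  an arbitrarily small shift error \<open>\<eta>\<close> survive. The factor \<open>s\<close> on the
  right is what permits division by \<open>s\<close> afterwards.\<close>

lemma R_quotient_le:
  assumes c: "contractive T \<delta> p" and s: "s \<ge> 0"
    and e: "\<And>u. 0 \<le> u \<Longrightarrow> u \<le> s \<Longrightarrow> p (T u x - x) \<le> e"
  shows "p (R x - T s (R x) - s *\<^sub>R x) \<le> s * e"
proof -
  have \<delta>: "\<delta> > 0" using c by (simp add: contractive_def)
  have "p (R x - T s (R x) - s *\<^sub>R x) \<le> s * e + (1 / \<delta> + 1) * \<eta>" if \<eta>: "\<eta> > 0" for \<eta>
  proof (rule tendsto_le[OF sequentially_bot])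
    have "limitin \<tau> (\<lambda>n. r n x - T s (r n x) - s *\<^sub>R x) (R x - T s (R x) - s *\<^sub>R x) sequentially"
      using continuous_map_limit[OF T_continuous[OF s] limitin_R]
      by (intro limitin_diff limitin_R) (auto simp: o_def)
    then show "(\<lambda>n. p (r n x - T s (r n x) - s *\<^sub>R x)) \<longlonglongrightarrow> p (R x - T s (R x) - s *\<^sub>R x)"
      by (rule limitin_controlled[OF contractive_controlled[OF c]])
    have "(\<lambda>n. s * e + (1 / 2) ^ n * p x + (1 / \<delta> + 1) * (exp (- \<delta>) ^ n * p x + \<eta>))
        \<longlonglongrightarrow> s * e + 0 * p x + (1 / \<delta> + 1) * (0 * p x + \<eta>)"
      using \<delta> by (intro tendsto_intros LIMSEQ_realpow_zero) auto
    then show "(\<lambda>n. s * e + (1 / 2) ^ n * p x + (1 / \<delta> + 1) * (exp (- \<delta>) ^ n * p x + \<eta>))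
        \<longlonglongrightarrow> s * e + (1 / \<delta> + 1) * \<eta>"
      by simp
    obtain d where d: "d > 0" "\<And>u. 0 \<le> u \<Longrightarrow> u < d \<Longrightarrow> p (T u x - x) \<le> \<eta>"
      using contractive_right_continuous[OF c \<eta>] by blast
    show "\<forall>\<^sub>F n in sequentially. p (r n x - T s (r n x) - s *\<^sub>R x)
        \<le> s * e + (1 / 2) ^ n * p x + (1 / \<delta> + 1) * (exp (- \<delta>) ^ n * p x + \<eta>)"
      using eventually_dyadic_lt[OF d(1)]
    proof eventually_elim
      case (elim n)
      then show ?case
        using r_quotient_le[OF c s e, where n = n and e' = \<eta>] d(2)
        by (simp add: power_one_over mult.commute flip: exp_of_nat_mult)
    qed
  qed
  note * = this
  show ?thesis
  proof (rule field_le_epsilon)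
    fix \<eta> :: real assume "\<eta> > 0"
    then show "p (R x - T s (R x) - s *\<^sub>R x) \<le> s * e + \<eta>"
      using *[of "\<eta> / (1 / \<delta> + 1)"] \<delta> by (simp add: add_pos_pos less_imp_neq[symmetric])
  qed
qed

text \<open>In other words, \<open>R x\<close> lies in the domain of the generator of
  \<open>T\<close>, which sends it to \<open>- x\<close>.\<close>

lemma R_quotient: "limitin \<tau> (\<lambda>s. (1 / s) *\<^sub>R (R x - T s (R x))) x (at_right 0)"
  unfolding limitin_iff tendsto_iff
proof (intro ballI allI impI)
  fix p and e :: real assume pN: "p \<in> N" and e: "e > 0"
  obtain p' \<delta> where p': "contractive T \<delta> p'" "\<And>x. p x \<le> p' x"
    using ex_contractive[OF pN] by blast
  obtain d where d: "d > 0" "\<And>u. 0 \<le> u \<Longrightarrow> u < d \<Longrightarrow> p' (T u x - x) \<le> e / 2"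
    using contractive_right_continuous[OF p'(1), of "e / 2" x] e by auto
  have "p ((1 / s) *\<^sub>R (R x - T s (R x)) - x) < e" if "0 < s" "s < d" for s
  proof -
    have "p ((1 / s) *\<^sub>R (R x - T s (R x)) - x) \<le> p' ((1 / s) *\<^sub>R (R x - T s (R x) - s *\<^sub>R x))"
      using that p'(2) by (simp add: scaleR_diff_right)
    also have "\<dots> = (1 / s) * p' (R x - T s (R x) - s *\<^sub>R x)"
      using that by (subst seminorm_scaleR[OF contractive_seminorm[OF p'(1)]]) simp
    also have "\<dots> \<le> (1 / s) * (s * (e / 2))"
      using that d(2) by (intro mult_left_mono R_quotient_le[OF p'(1)]) auto
    also have "\<dots> < e"
      using that e by simp
    finally show ?thesis .
  qed
  then show "\<forall>\<^sub>F s in at_right 0. dist (p ((1 / s) *\<^sub>R (R x - T s (R x)) - x)) 0 < e"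
    unfolding eventually_at_right_field using d(1) N_nonneg[OF pN] by auto
qed

end

section \<open>From semigroups to resolvents\<close>

locale exp_bounded_semigroup = seq_complete_lcs +
  fixes S :: "real \<Rightarrow> 'b \<Rightarrow> 'b" and D :: "'b set" and A :: "'b \<Rightarrow> 'b" and \<omega> M :: real
  assumes semigroup: "semigroup_on smul S"
    and strongly_cont: "strongly_continuous \<tau> S"
    and generator: "is_generator \<tau> S D A"
    and bound: "\<alpha> > \<omega> \<Longrightarrow> p \<in> N \<Longrightarrow> \<exists>q\<in>N. \<forall>t\<ge>0. \<forall>x. p (exp (- \<alpha> * t) *\<^sub>R S t x) \<le> M * q x"
begin

text \<open>The classical renorming that turns a bounded semigroup into a contraction semigroup,
  carried out for a single seminorm. For \<open>\<alpha> > \<omega>\<close> and \<open>p\<close> in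
  \<open>N\<close> it lies between \<open>p\<close> and some \<open>M * q\<close>.\<close>

definition hat :: "real \<Rightarrow> ('b \<Rightarrow> real) \<Rightarrow> 'b \<Rightarrow> real"
  where "hat \<alpha> p x = (SUP t\<in>{0..}. p (exp (- \<alpha> * t) *\<^sub>R S t x))"

lemma S_0 [simp]: "S 0 x = x"
  and S_add: "t \<ge> 0 \<Longrightarrow> s \<ge> 0 \<Longrightarrow> S (t + s) x = S t (S s x)"
  and linear_S: "t \<ge> 0 \<Longrightarrow> Vector_Spaces.linear smul smul (S t)"
  using semigroup by (auto simp: semigroup_on_def)

lemma rescaled_linear: "t \<ge> 0 \<Longrightarrow> Vector_Spaces.linear smul smul (\<lambda>x. c *\<^sub>R S t x)"
  using linear_S[of t] by (auto intro!: linear_smulI simp: Vector_Spaces.linear_iff scaleR_add_right smul_scaleR)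

lemma rescaled_add:
  assumes "t \<ge> 0" "s \<ge> 0"
  shows "exp (- \<alpha> * (t + s)) *\<^sub>R S (t + s) x = exp (- \<alpha> * t) *\<^sub>R S t (exp (- \<alpha> * s) *\<^sub>R S s x)"
proof -
  interpret linear "S t" by (rule linear_smul_imp_linear[OF linear_S[OF assms(1)]])
  have "exp (- \<alpha> * (t + s)) = exp (- \<alpha> * t) * exp (- \<alpha> * s)"
    by (simp add: algebra_simps flip: exp_add)
  then show ?thesis
    by (simp add: S_add[OF assms] scale)
qed

context
  fixes \<alpha> p assumes \<alpha>: "\<alpha> > \<omega>" and p: "p \<in> N"
begin

lemma hat_bdd: "bdd_above ((\<lambda>t. p (exp (- \<alpha> * t) *\<^sub>R S t x)) ` {0..})"
proof -
  obtain q where "\<forall>t\<ge>0. \<forall>x. p (exp (- \<alpha> * t) *\<^sub>R S t x) \<le> M * q x"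
    using bound[OF \<alpha> p] by blast
  then show ?thesis
    by (intro bdd_aboveI2[where M = "M * q x"]) simp
qed

lemma hat_upper: "t \<ge> 0 \<Longrightarrow> p (exp (- \<alpha> * t) *\<^sub>R S t x) \<le> hat \<alpha> p x"
  unfolding hat_def using hat_bdd by (auto intro: cSUP_upper)

lemma le_hat: "p x \<le> hat \<alpha> p x"
  using hat_upper[of 0 x] by simp

lemma hat_contract: "t \<ge> 0 \<Longrightarrow> hat \<alpha> p (exp (- \<alpha> * t) *\<^sub>R S t x) \<le> hat \<alpha> p x"
  unfolding hat_def[of _ _ "exp (- \<alpha> * t) *\<^sub>R S t x"]
proof (rule cSUP_least)
  fix s :: real assume t: "t \<ge> 0" and s: "s \<in> {0..}"
  then show "p (exp (- \<alpha> * s) *\<^sub>R S s (exp (- \<alpha> * t) *\<^sub>R S t x)) \<le> hat \<alpha> p x"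
    using rescaled_add[of s t \<alpha> x] hat_upper[of "s + t" x] by simp
qed simp

lemma hat_seminorm: "seminorm smul (hat \<alpha> p)"
  unfolding hat_def by (intro seminorm_SUP rescaled_linear hat_bdd N_seminorm[OF p]) auto

lemma hat_controlled: "controlled (hat \<alpha> p)"
proof -
  obtain q where "q \<in> N" "\<forall>t\<ge>0. \<forall>x. p (exp (- \<alpha> * t) *\<^sub>R S t x) \<le> M * q x"
    using bound[OF \<alpha> p] by blast
  then have "\<forall>x. hat \<alpha> p x \<le> M * q x"
    unfolding hat_def by (auto intro!: cSUP_least)
  with \<open>q \<in> N\<close> show ?thesis
    unfolding controlled_def using hat_seminorm by blast
qed

lemma hat_decay:
  assumes "t \<ge> 0"
  shows "hat \<alpha> p (exp (- \<mu> * t) *\<^sub>R S t x) \<le> exp (- (\<mu> - \<alpha>) * t) * hat \<alpha> p x"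
proof -
  have "exp (- \<mu> * t) *\<^sub>R S t x = exp (- (\<mu> - \<alpha>) * t) *\<^sub>R (exp (- \<alpha> * t) *\<^sub>R S t x)"
    by (simp add: algebra_simps flip: exp_add)
  then have "hat \<alpha> p (exp (- \<mu> * t) *\<^sub>R S t x)
      = exp (- (\<mu> - \<alpha>) * t) * hat \<alpha> p (exp (- \<alpha> * t) *\<^sub>R S t x)"
    by (simp only: seminorm_scaleR[OF hat_seminorm, of "exp (- (\<mu> - \<alpha>) * t)"] abs_exp_cancel)
  then show ?thesis
    using hat_contract[OF assms] by (simp add: mult_left_mono)
qed

end

lemma rescaled_stable:
  assumes \<mu>: "\<mu> > \<omega>"
  shows "stable_semigroup smul \<tau> (\<lambda>t x. exp (- \<mu> * t) *\<^sub>R S t x)"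
proof (intro stable_semigroup.intro stable_semigroup_axioms.intro seq_complete_lcs_axioms)
  fix p and e :: real and x assume p: "p \<in> N" and e: "e > 0"
  let ?F = "at_right (0::real)"
  have cont: "limitin \<tau> (\<lambda>t. S t x) x ?F"
    unfolding limitin_iff tendsto_iff
  proof (intro ballI allI impI)
    fix q and e :: real assume q: "q \<in> N" "e > 0"
    then obtain d where "d > 0" "\<forall>s\<ge>0. \<bar>s - 0\<bar> < d \<longrightarrow> q (S s x - S 0 x) < e"
      using strongly_cont unfolding strongly_continuous_iff by blast
    then show "\<forall>\<^sub>F t in ?F. dist (q (S t x - x)) 0 < e"
      unfolding eventually_at_right_field using N_nonneg[OF q(1)] by auto
  qed
  have "((\<lambda>t. exp (- \<mu> * t)) \<longlongrightarrow> exp (- \<mu> * 0)) ?F"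
    by (intro tendsto_intros)
  then have "limitin \<tau> (\<lambda>t. exp (- \<mu> * t) *\<^sub>R S t x) (1 *\<^sub>R x) ?F"
    using cont by (intro limitin_scaleR_tendsto) auto
  then have "((\<lambda>t. p (exp (- \<mu> * t) *\<^sub>R S t x - x)) \<longlongrightarrow> 0) ?F"
    using p unfolding limitin_iff by auto
  then have "\<forall>\<^sub>F t in ?F. p (exp (- \<mu> * t) *\<^sub>R S t x - x) < e"
    using e by (auto dest: order_tendstoD(2))
  then obtain d where d: "d > 0" "\<And>s. 0 < s \<Longrightarrow> s < d \<Longrightarrow> p (exp (- \<mu> * s) *\<^sub>R S s x - x) < e"
    unfolding eventually_at_right_field by auto
  have "p (exp (- \<mu> * s) *\<^sub>R S s x - x) < e" if "0 \<le> s" "s < d" for s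
    using that d(2)[of s] e seminorm_zero[OF N_seminorm[OF p]] by (cases "s = 0") auto
  with d(1) show "\<exists>d>0. \<forall>s. 0 \<le> s \<and> s < d \<longrightarrow> p (exp (- \<mu> * s) *\<^sub>R S s x - x) < e"
    by blast
next
  fix p assume p: "p \<in> N"
  \<comment> \<open>Above \<open>\<omega>\<close>, so that \<open>hat \<alpha> p\<close> is a finite
    supremum, and below \<open>\<mu>\<close>, so that the decay rate \<open>\<mu> - \<alpha>\<close>
    is positive.\<close>
  define \<alpha> where "\<alpha> = (\<omega> + \<mu>) / 2"
  have \<alpha>: "\<omega> < \<alpha>" "\<alpha> < \<mu>" using \<mu> by (auto simp: \<alpha>_def)
  then show "\<exists>p' \<delta>. contractive (\<lambda>t x. exp (- \<mu> * t) *\<^sub>R S t x) \<delta> p' \<and> (\<forall>x. p x \<le> p' x)"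
    using hat_controlled[OF _ p] hat_decay[OF _ p] le_hat[OF _ p]
    by (intro exI[of _ "hat \<alpha> p"] exI[of _ "\<mu> - \<alpha>"]) (auto simp: contractive_def)
qed (simp_all only: rescaled_linear rescaled_add, simp_all)

lemma hat_contractive:
  assumes "\<omega> < \<alpha>" "\<alpha> < \<mu>" "p \<in> N"
  shows "contractive (\<lambda>t x. exp (- \<mu> * t) *\<^sub>R S t x) (\<mu> - \<alpha>) (hat \<alpha> p)"
  using assms hat_controlled hat_decay by (auto simp: contractive_def)

lemma generatorI: "limitin \<tau> (\<lambda>t. (1 / t) *\<^sub>R (S t x - x)) y (at_right 0) \<Longrightarrow> x \<in> D \<and> A x = y"
  using generator limitin_unique[OF _ _ trivial_limit_at_right_real] unfolding is_generator_def by blast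

lemma generator_limit: "x \<in> D \<Longrightarrow> limitin \<tau> (\<lambda>t. (1 / t) *\<^sub>R (S t x - x)) (A x) (at_right 0)"
  using generator unfolding is_generator_def by blast

lemma exp_quotient: "((\<lambda>t::real. (exp (c * t) - 1) / t) \<longlongrightarrow> c) (at_right 0)"
proof -
  have "((\<lambda>t. exp (c * t)) has_field_derivative c) (at 0)"
    by (auto intro!: derivative_eq_intros)
  then show ?thesis
    using filterlim_at_split by (fastforce simp: has_field_derivative_iff)
qed

text \<open>The operator depends on \<open>\<mu>\<close> alone, while the seminorm in which it is
  estimated may use any \<open>\<alpha>\<close> between \<open>\<omega>\<close> and
  \<open>\<mu>\<close>; hence one \<open>R\<close> serves all these bounds.\<close>

lemma resolvent_exists:
  assumes \<mu>: "\<mu> > \<omega>"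
  shows "\<exists>R. Vector_Spaces.linear smul smul R \<and> (\<forall>x. R x \<in> D \<and> \<mu> *\<^sub>R R x - A (R x) = x) \<and>
    (\<forall>x\<in>D. R (\<mu> *\<^sub>R x - A x) = x) \<and>
    (\<forall>\<alpha> p x. \<omega> < \<alpha> \<longrightarrow> \<alpha> < \<mu> \<longrightarrow> p \<in> N \<longrightarrow> hat \<alpha> p (R x) \<le> 1 / (\<mu> - \<alpha>) * hat \<alpha> p x) \<and>
    \<tau> closure_of D = UNIV"
proof -
  interpret T: stable_semigroup smul \<tau> "\<lambda>t x. exp (- \<mu> * t) *\<^sub>R S t x"
    by (rule rescaled_stable[OF \<mu>])
  let ?T = "\<lambda>t x. exp (- \<mu> * t) *\<^sub>R S t x" and ?F = "at_right (0::real)"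
  have bound_R: "hat \<alpha> p (T.R x) \<le> 1 / (\<mu> - \<alpha>) * hat \<alpha> p x" if "\<omega> < \<alpha>" "\<alpha> < \<mu>" "p \<in> N" for \<alpha> p x
    by (rule T.R_bound[OF hat_contractive[OF that]])
  have real_linear_R: "linear T.R"
    by (rule linear_smul_imp_linear[OF T.R_linear])
  have R_continuous: "continuous_map \<tau> \<tau> T.R"
  proof (rule continuous_linear_mapI[OF real_linear_R])
    fix p assume p: "p \<in> N"
    define \<alpha> where "\<alpha> = (\<omega> + \<mu>) / 2"
    have \<alpha>: "\<omega> < \<alpha>" "\<alpha> < \<mu>" using \<mu> by (auto simp: \<alpha>_def)
    obtain q C where q: "q \<in> N" "\<And>x. hat \<alpha> p x \<le> C * q x"
      using hat_controlled[OF \<alpha>(1) p] unfolding controlled_def by blast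
    have "p (T.R x) \<le> 1 / (\<mu> - \<alpha>) * C * q x" for x
    proof -
      have "p (T.R x) \<le> 1 / (\<mu> - \<alpha>) * hat \<alpha> p x"
        using le_hat[OF \<alpha>(1) p] bound_R[OF \<alpha> p] order_trans by blast
      also have "\<dots> \<le> 1 / (\<mu> - \<alpha>) * (C * q x)"
        using \<alpha> by (intro mult_left_mono q) auto
      finally show ?thesis by simp
    qed
    with q(1) show "\<exists>q\<in>N. \<exists>C. \<forall>x. p (T.R x) \<le> C * q x" by blast
  qed
  \<comment> \<open>A product rule: from \<open>S s = exp (\<mu> * s) T s\<close> the quotient of
    \<open>S\<close> splits into that of the exponential, tending to \<open>\<mu>\<close>, and
    \<open>- exp (\<mu> * s)\<close> times the quotient of \<open>R_quotient\<close>.\<close>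
  have R_gen: "T.R x \<in> D \<and> A (T.R x) = \<mu> *\<^sub>R T.R x - x" for x
  proof (rule generatorI)
    have "((\<lambda>s. - exp (\<mu> * s)) \<longlongrightarrow> -1) ?F"
      by (rule tendsto_eq_intros refl | simp)+
    then have "limitin \<tau> (\<lambda>s. ((exp (\<mu> * s) - 1) / s) *\<^sub>R T.R x
        + (- exp (\<mu> * s)) *\<^sub>R ((1 / s) *\<^sub>R (T.R x - ?T s (T.R x)))) (\<mu> *\<^sub>R T.R x + (-1) *\<^sub>R x) ?F"
      by (rule limitin_add[OF limitin_scaleR_left[OF exp_quotient]
            limitin_scaleR_tendsto[OF _ T.R_quotient]])
    moreover have "((exp (\<mu> * s) - 1) / s) *\<^sub>R T.R x
        + (- exp (\<mu> * s)) *\<^sub>R ((1 / s) *\<^sub>R (T.R x - ?T s (T.R x))) = (1 / s) *\<^sub>R (S s (T.R x) - T.R x)" for s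
      by (simp add: algebra_simps diff_divide_distrib flip: exp_add)
    ultimately show "limitin \<tau> (\<lambda>s. (1 / s) *\<^sub>R (S s (T.R x) - T.R x)) (\<mu> *\<^sub>R T.R x - x) ?F"
      by simp
  qed
  \<comment> \<open>\<open>R\<close> applied to the quotients \<open>(x - T s x) / s\<close> is
    evaluated twice: by continuity the limit is \<open>R (\<mu> x - A x)\<close>, and since
    \<open>R\<close> commutes with \<open>T\<close> these are the quotients of
    \<open>R_quotient\<close>, which tend to \<open>x\<close>.\<close>
  have R_inv: "T.R (\<mu> *\<^sub>R x - A x) = x" if x: "x \<in> D" for x
  proof (rule limitin_unique)
    have "((\<lambda>s. - exp (- \<mu> * s)) \<longlongrightarrow> -1) ?F"
      by (rule tendsto_eq_intros refl | simp)+
    then have "limitin \<tau> (\<lambda>s. (- ((exp (- \<mu> * s) - 1) / s)) *\<^sub>R x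
        + (- exp (- \<mu> * s)) *\<^sub>R ((1 / s) *\<^sub>R (S s x - x))) ((- (- \<mu>)) *\<^sub>R x + (-1) *\<^sub>R A x) ?F"
      by (rule limitin_add[OF limitin_scaleR_left[OF tendsto_minus[OF exp_quotient]]
            limitin_scaleR_tendsto[OF _ generator_limit[OF x]]])
    moreover have "(- ((exp (- \<mu> * s) - 1) / s)) *\<^sub>R x
        + (- exp (- \<mu> * s)) *\<^sub>R ((1 / s) *\<^sub>R (S s x - x)) = (1 / s) *\<^sub>R (x - ?T s x)" for s
      by (simp add: algebra_simps diff_divide_distrib)
    ultimately have "limitin \<tau> (\<lambda>s. (1 / s) *\<^sub>R (x - ?T s x)) (\<mu> *\<^sub>R x - A x) ?F"
      by simp
    then have "limitin \<tau> (\<lambda>s. T.R ((1 / s) *\<^sub>R (x - ?T s x))) (T.R (\<mu> *\<^sub>R x - A x)) ?F"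
      using continuous_map_limit[OF R_continuous] by (force simp: o_def)
    moreover have "\<forall>\<^sub>F s in ?F. T.R ((1 / s) *\<^sub>R (x - ?T s x)) = (1 / s) *\<^sub>R (T.R x - ?T s (T.R x))"
      using eventually_at_right_less[of 0]
    proof eventually_elim
      case (elim s)
      then show ?case
        unfolding T.T_R[OF less_imp_le[OF elim]]
        by (simp only: linear_scale[OF real_linear_R] linear_diff[OF real_linear_R])
    qed
    ultimately show "limitin \<tau> (\<lambda>s. (1 / s) *\<^sub>R (T.R x - ?T s (T.R x))) (T.R (\<mu> *\<^sub>R x - A x)) ?F"
      using limitin_transform_eventually by fastforce
  qed (use T.R_quotient in auto)
  \<comment> \<open>The quotients of \<open>R_quotient\<close> converge to \<open>x\<close> and are
    themselves values of \<open>R\<close>, hence elements of \<open>D\<close>.\<close>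
  have "\<tau> closure_of D = UNIV"
    unfolding closure_eq_UNIV_iff
  proof (intro ballI allI impI)
    fix p x and e :: real assume p: "p \<in> N" and e: "e > 0"
    have "((\<lambda>s. p ((1 / s) *\<^sub>R (T.R x - ?T s (T.R x)) - x)) \<longlongrightarrow> 0) ?F"
      using T.R_quotient[of x] p unfolding limitin_iff by blast
    from order_tendstoD(2)[OF this e] eventually_at_right_less[of 0]
    have "\<forall>\<^sub>F s in ?F. s > 0 \<and> p ((1 / s) *\<^sub>R (T.R x - ?T s (T.R x)) - x) < e"
      by eventually_elim simp
    then obtain s where s: "s > 0" "p ((1 / s) *\<^sub>R (T.R x - ?T s (T.R x)) - x) < e"
      using eventually_happens'[OF trivial_limit_at_right_real] by blast
    define y where "y = (1 / s) *\<^sub>R (T.R x - ?T s (T.R x))"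
    have "y = T.R ((1 / s) *\<^sub>R (x - ?T s x))"
      unfolding y_def T.T_R[OF less_imp_le[OF s(1)]]
      by (simp only: linear_scale[OF real_linear_R] linear_diff[OF real_linear_R])
    then have "y \<in> D"
      using R_gen by simp
    moreover have "p (x - y) < e"
      using s(2) seminorm_commute[OF N_seminorm[OF p], of x y] unfolding y_def by argo
    ultimately show "\<exists>y\<in>D. p (x - y) < e" ..
  qed
  then show ?thesis
    using R_gen R_inv bound_R T.R_linear by (intro exI[of _ T.R]) auto
qed

lemma dense: "\<tau> closure_of D = UNIV"
  using resolvent_exists[of "\<omega> + 1"] by auto

lemma bij_resolvent:
  assumes "\<mu> > \<omega>"
  shows "bij_betw (\<lambda>x. smul (of_real \<mu>) x - A x) D UNIV"
proof -
  obtain R where "\<And>x. R x \<in> D \<and> \<mu> *\<^sub>R R x - A (R x) = x" "\<And>x. x \<in> D \<Longrightarrow> R (\<mu> *\<^sub>R x - A x) = x"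
    using resolvent_exists[OF assms] by blast
  then show ?thesis
    by (intro bij_betwI[where g = R]) (auto simp: smul_of_real)
qed

lemma resolvent_linear_bound:
  assumes \<mu>: "\<mu> > \<omega>"
  shows "Vector_Spaces.linear smul smul (resolvent smul D A (of_real \<mu>))"
    and "\<omega> < \<alpha> \<Longrightarrow> \<alpha> < \<mu> \<Longrightarrow> p \<in> N \<Longrightarrow>
      hat \<alpha> p (resolvent smul D A (of_real \<mu>) x) \<le> 1 / (\<mu> - \<alpha>) * hat \<alpha> p x"
proof -
  obtain R where R: "Vector_Spaces.linear smul smul R"
      "\<And>x. R x \<in> D \<and> \<mu> *\<^sub>R R x - A (R x) = x"
      "\<And>\<alpha> p x. \<omega> < \<alpha> \<Longrightarrow> \<alpha> < \<mu> \<Longrightarrow> p \<in> N \<Longrightarrow> hat \<alpha> p (R x) \<le> 1 / (\<mu> - \<alpha>) * hat \<alpha> p x"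
    using resolvent_exists[OF \<mu>] by blast
  have "resolvent smul D A (of_real \<mu>) = R"
    unfolding resolvent_def
    by (rule ext, rule inv_into_f_eq)
       (use bij_betw_imp_inj_on[OF bij_resolvent[OF \<mu>]] R(2) in \<open>auto simp: smul_of_real\<close>)
  with R show "Vector_Spaces.linear smul smul (resolvent smul D A (of_real \<mu>))"
    and "\<omega> < \<alpha> \<Longrightarrow> \<alpha> < \<mu> \<Longrightarrow> p \<in> N \<Longrightarrow>
      hat \<alpha> p (resolvent smul D A (of_real \<mu>) x) \<le> 1 / (\<mu> - \<alpha>) * hat \<alpha> p x"
    by auto
qed

text \<open>In \<open>hat \<alpha> p\<close> the operator \<open>\<mu> - \<alpha>\<close> times the
  resolvent is a contraction, so its powers cost nothing and \<open>M\<close> enters once, through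
  \<open>hat \<alpha> p \<le> M * q\<close>. As \<open>hat \<alpha> p\<close> does not involve
  \<open>\<mu>\<close>, one \<open>q\<close> serves all \<open>\<mu>\<close> and
  \<open>m\<close>.\<close>

lemma resolvent_power_bound:
  assumes "\<alpha> > \<omega>" "p \<in> N"
  shows "\<exists>q\<in>N. \<forall>\<mu>>\<alpha>. \<forall>m x. p ((\<mu> - \<alpha>) ^ m *\<^sub>R (resolvent smul D A (of_real \<mu>) ^^ m) x) \<le> M * q x"
proof -
  obtain q where q: "q \<in> N" "\<forall>t\<ge>0. \<forall>x. p (exp (- \<alpha> * t) *\<^sub>R S t x) \<le> M * q x"
    using bound[OF assms] by blast
  have hat_q: "hat \<alpha> p x \<le> M * q x" for x
    unfolding hat_def using q(2) by (auto intro!: cSUP_least)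
  note hat = hat_seminorm[OF assms]
  have "p ((\<mu> - \<alpha>) ^ m *\<^sub>R (resolvent smul D A (of_real \<mu>) ^^ m) x) \<le> M * q x" if \<mu>: "\<mu> > \<alpha>" for \<mu> m x
  proof -
    let ?R = "resolvent smul D A (of_real \<mu>)"
    have "hat \<alpha> p ((\<mu> - \<alpha>) ^ m *\<^sub>R (?R ^^ m) x) \<le> hat \<alpha> p x"
    proof (induction m)
      case (Suc m)
      have "hat \<alpha> p ((\<mu> - \<alpha>) ^ Suc m *\<^sub>R (?R ^^ Suc m) x) = (\<mu> - \<alpha>) ^ m * (\<mu> - \<alpha>) * hat \<alpha> p (?R ((?R ^^ m) x))"
        using \<mu> by (simp add: seminorm_scaleR[OF hat] mult.commute)
      also have "\<dots> \<le> (\<mu> - \<alpha>) ^ m * (\<mu> - \<alpha>) * (1 / (\<mu> - \<alpha>) * hat \<alpha> p ((?R ^^ m) x))"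
        using \<mu> assms by (intro mult_left_mono resolvent_linear_bound(2)) auto
      also have "\<dots> = hat \<alpha> p ((\<mu> - \<alpha>) ^ m *\<^sub>R (?R ^^ m) x)"
        using \<mu> by (simp add: seminorm_scaleR[OF hat])
      finally show ?case
        using Suc by simp
    qed simp
    then show ?thesis
      using le_hat[OF assms, of "(\<mu> - \<alpha>) ^ m *\<^sub>R (?R ^^ m) x"] hat_q[of x] by linarith
  qed
  with q(1) show ?thesis by blast
qed

lemma in_resolvent_set:
  assumes \<mu>: "\<mu> > \<omega>"
  shows "of_real \<mu> \<in> resolvent_set smul \<tau> D A"
proof -
  let ?R = "resolvent smul D A (of_real \<mu>)"
  have "continuous_map \<tau> \<tau> ?R"
  proof (rule continuous_linear_mapI)
    show "linear ?R"
      by (rule linear_smul_imp_linear[OF resolvent_linear_bound(1)[OF \<mu>]])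
    fix p assume p: "p \<in> N"
    define \<alpha> where "\<alpha> = (\<omega> + \<mu>) / 2"
    have \<alpha>: "\<omega> < \<alpha>" "\<alpha> < \<mu>" using \<mu> by (auto simp: \<alpha>_def)
    obtain q where q: "q \<in> N" "\<And>m x. p ((\<mu> - \<alpha>) ^ m *\<^sub>R (?R ^^ m) x) \<le> M * q x"
      using resolvent_power_bound[OF \<alpha>(1) p] \<alpha> by blast
    have "p (?R x) \<le> M / (\<mu> - \<alpha>) * q x" for x
      using q(2)[of 1 x] \<alpha> unfolding seminorm_scaleR[OF N_seminorm[OF p]]
      by (simp add: pos_le_divide_eq mult.commute)
    with q(1) show "\<exists>q\<in>N. \<exists>C. \<forall>x. p (?R x) \<le> C * q x" by blast
  qed
  then show ?thesis
    using bij_resolvent[OF \<mu>] resolvent_linear_bound(1)[OF \<mu>]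
    by (simp add: resolvent_set_def cont_linear_maps_def)
qed

end

section \<open>From resolvents to semigroups\<close>

locale hille_yosida = seq_complete_lcs +
  fixes D :: "'b set" and A :: "'b \<Rightarrow> 'b" and \<omega> M :: real
  assumes operator: "linear_operator smul D A"
    and M: "M \<ge> 1"
    and dense: "\<tau> closure_of D = UNIV"
    and resolvents: "\<mu> > \<omega> \<Longrightarrow> of_real \<mu> \<in> resolvent_set smul \<tau> D A"
    and resolvent_bound: "\<alpha> > \<omega> \<Longrightarrow> p \<in> N \<Longrightarrow> \<exists>q\<in>N. \<forall>\<mu>>\<alpha>. \<forall>m\<ge>1. \<forall>x.
      p ((\<mu> - \<alpha>) ^ m *\<^sub>R (resolvent smul D A (of_real \<mu>) ^^ m) x) \<le> M * q x"
begin

lemma D_scaleR: "x \<in> D \<Longrightarrow> r *\<^sub>R x \<in> D"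
  and A_scaleR: "x \<in> D \<Longrightarrow> A (r *\<^sub>R x) = r *\<^sub>R A x"
  and D_add: "x \<in> D \<Longrightarrow> y \<in> D \<Longrightarrow> x + y \<in> D"
  and A_add: "x \<in> D \<Longrightarrow> y \<in> D \<Longrightarrow> A (x + y) = A x + A y"
  using operator subspace_scale[of D x "of_real r"] subspace_add[of D]
  unfolding linear_operator_def by (auto simp flip: smul_of_real)

lemma D_diff: "x \<in> D \<Longrightarrow> y \<in> D \<Longrightarrow> x - y \<in> D"
  and A_diff: "x \<in> D \<Longrightarrow> y \<in> D \<Longrightarrow> A (x - y) = A x - A y"
  using D_add[of x "(-1) *\<^sub>R y"] A_add[of x "(-1) *\<^sub>R y"] D_scaleR[of y "-1"] A_scaleR[of y "-1"]
  by simp_all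

text \<open>The implicit Euler step \<open>(1 - h A)\<^sup>-\<^sup>1\<close>.\<close>

definition F :: "real \<Rightarrow> 'b \<Rightarrow> 'b"
  where "F h x = (1 / h) *\<^sub>R resolvent smul D A (of_real (1 / h)) x"

text \<open>Equivalent to \<open>h > 0\<close> and \<open>1 / h > \<omega>\<close>: the resolvent at
  \<open>1 / h\<close> is available.\<close>

definition admissible :: "real \<Rightarrow> bool"
  where "admissible h \<longleftrightarrow> h > 0 \<and> \<omega> * h < 1"

context
  fixes h assumes h: "admissible h"
begin

lemma h_pos: "h > 0"
  using h by (simp add: admissible_def)

lemma h_resolvents: "of_real (1 / h) \<in> resolvent_set smul \<tau> D A"
  using h by (intro resolvents) (simp add: admissible_def pos_less_divide_eq)

lemma F_linear: "Vector_Spaces.linear smul smul (F h)"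
  using h_resolvents
  by (auto simp: resolvent_set_def cont_linear_maps_def Vector_Spaces.linear_iff F_def scaleR_add_right smul_scaleR)

lemma F_in_D [simp]: "F h x \<in> D"
  and F_eq: "F h x - h *\<^sub>R A (F h x) = x"
proof -
  let ?R = "resolvent smul D A (of_real (1 / h)) x" and ?f = "\<lambda>x. smul (of_real (1 / h)) x - A x"
  have bij: "bij_betw ?f D UNIV"
    using h_resolvents by (simp add: resolvent_set_def)
  then have x: "x \<in> ?f ` D"
    by (simp add: bij_betw_def)
  have R: "?R \<in> D"
    unfolding resolvent_def by (rule inv_into_into[OF x])
  then show "F h x \<in> D"
    unfolding F_def by (rule D_scaleR)
  have "?f ?R = x"
    unfolding resolvent_def by (rule f_inv_into_f[OF x])
  then show "F h x - h *\<^sub>R A (F h x) = x"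
    using h_pos R by (simp only: F_def A_scaleR smul_of_real scaleR_scaleR) simp
qed

lemma F_inv:
  assumes "x \<in> D"
  shows "F h (x - h *\<^sub>R A x) = x"
proof -
  let ?f = "\<lambda>x. smul (of_real (1 / h)) x - A x" and ?R = "resolvent smul D A (of_real (1 / h))"
  interpret linear "F h" by (rule linear_smul_imp_linear[OF F_linear])
  have "bij_betw ?f D UNIV"
    using h_resolvents by (simp add: resolvent_set_def)
  then have "?R (?f x) = x"
    unfolding resolvent_def using assms by (intro inv_into_f_f) (simp_all add: bij_betw_def)
  then have "F h (?f x) = (1 / h) *\<^sub>R x"
    by (simp add: F_def)
  then have "h *\<^sub>R F h ((1 / h) *\<^sub>R x - A x) = x"
    using h_pos by (simp only: smul_of_real) simp
  then show ?thesis
    using h_pos by (simp add: scale[symmetric] scaleR_diff_right)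
qed

lemma funpow_F_linear: "Vector_Spaces.linear smul smul (F h ^^ m)"
proof (induction m)
  case (Suc m)
  then show ?case
    using F_linear by (auto simp: Vector_Spaces.linear_iff)
qed (auto intro: linear_smulI)

lemma real_linear_funpow_F: "linear (F h ^^ m)"
  by (rule linear_smul_imp_linear[OF funpow_F_linear])

lemma real_linear_F: "linear (F h)"
  using real_linear_funpow_F[of 1] by simp

lemma A_F:
  assumes "x \<in> D"
  shows "A (F h x) = F h (A x)"
proof -
  interpret linear "F h" by (rule real_linear_F)
  have "F h x - h *\<^sub>R A (F h x) = F h x - h *\<^sub>R F h (A x)"
    using F_inv[OF assms] unfolding F_eq by (simp add: diff scale)
  then show ?thesis
    using h_pos by simp
qed

lemma funpow_F_in_D: "x \<in> D \<Longrightarrow> (F h ^^ m) x \<in> D"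
  by (induction m) auto

lemma A_funpow_F: "x \<in> D \<Longrightarrow> A ((F h ^^ m) x) = (F h ^^ m) (A x)"
  by (induction m) (auto simp: A_F funpow_F_in_D)

lemma F_diff: "x \<in> D \<Longrightarrow> F h x - x = h *\<^sub>R F h (A x)"
  using F_eq[of x] A_F[of x] by (simp add: algebra_simps)

text \<open>Discrete counterpart of writing \<open>S t x - x\<close> as the integral of
  \<open>S s (A x)\<close> over \<open>[0, t]\<close>; it telescopes \<open>F_diff\<close>.\<close>

lemma funpow_F_diff:
  assumes "x \<in> D"
  shows "(F h ^^ m) x - x = h *\<^sub>R (\<Sum>k<m. (F h ^^ Suc k) (A x))"
proof (induction m)
  case (Suc m)
  have "(F h ^^ Suc m) x - (F h ^^ m) x = (F h ^^ m) (F h x - x)"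
    by (simp only: linear_diff[OF real_linear_funpow_F] funpow_Suc_right o_apply)
  also have "\<dots> = h *\<^sub>R (F h ^^ Suc m) (A x)"
    unfolding F_diff[OF assms] by (simp only: linear_scale[OF real_linear_funpow_F] funpow_Suc_right o_apply)
  finally have "(F h ^^ Suc m) x - x = h *\<^sub>R (F h ^^ Suc m) (A x) + ((F h ^^ m) x - x)"
    by (simp add: algebra_simps)
  then show ?case
    unfolding Suc by (simp add: scaleR_add_right add.commute)
qed simp

end

text \<open>For \<open>u = F h (F g x)\<close> the equation
  \<open>u - h *\<^sub>R A u = F g x\<close> forces \<open>A u\<close> into \<open>D\<close>. Hence
  \<open>(1 - g A) (1 - h A) u\<close> is defined and its two factors can be exchanged.\<close>

lemma F_commute:
  assumes h: "admissible h" and g: "admissible g"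
  shows "F h (F g x) = F g (F h x)"
proof -
  define u where "u = F h (F g x)"
  have u: "u \<in> D" by (simp add: u_def h)
  have 1: "u - h *\<^sub>R A u = F g x" by (simp add: u_def F_eq h)
  then have hAu: "h *\<^sub>R A u \<in> D"
    using D_diff[OF u F_in_D[OF g, of x]] by (simp flip: 1)
  then have Au: "A u \<in> D"
    using D_scaleR[OF hAu, of "1 / h"] h_pos[OF h] by simp
  have "(u - h *\<^sub>R A u) - g *\<^sub>R A (u - h *\<^sub>R A u) = x"
    unfolding 1 by (simp add: F_eq g)
  then have "(u - g *\<^sub>R A u) - h *\<^sub>R A (u - g *\<^sub>R A u) = x"
    using u Au by (simp add: A_diff A_scaleR D_scaleR algebra_simps)
  moreover have "u - g *\<^sub>R A u \<in> D"
    using u Au by (simp add: D_diff D_scaleR)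
  ultimately have "u - g *\<^sub>R A u = F h x"
    using F_inv[OF h] by metis
  then show ?thesis
    using F_inv[OF g u] by (simp add: u_def)
qed

text \<open>The source is \<open>(1 - (h / 2) A)\<^sup>2 = (1 - h A) + (h\<^sup>2 / 4)
  A\<^sup>2\<close>. Both sides are applied to \<open>x\<close>, and then the inverses of the three
  first-order factors.\<close>

lemma two_half_steps:
  assumes h: "admissible h" and g: "admissible (h / 2)" and x: "x \<in> D" "A x \<in> D"
  shows "F (h / 2) (F (h / 2) x) - F h x = - (h\<^sup>2 / 4) *\<^sub>R F (h / 2) (F (h / 2) (F h (A (A x))))"
proof -
  let ?G = "F (h / 2)"
  interpret G: linear ?G by (rule real_linear_F[OF g])
  interpret F: linear "F h" by (rule real_linear_F[OF h])
  define z where "z = x - (h / 2) *\<^sub>R A x"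
  have z: "z \<in> D" using x by (simp add: z_def D_diff D_scaleR)
  have "?G z = x"
    unfolding z_def by (rule F_inv[OF g x(1)])
  moreover have "?G (z - (h / 2) *\<^sub>R A z) = z"
    by (rule F_inv[OF g z])
  moreover have "z - (h / 2) *\<^sub>R A z = (x - h *\<^sub>R A x) + (h\<^sup>2 / 4) *\<^sub>R A (A x)"
    using x by (simp add: z_def A_diff A_scaleR D_scaleR scaleR_diff_right power2_eq_square algebra_simps
        flip: scaleR_add_left)
  ultimately have "x = ?G (?G ((x - h *\<^sub>R A x) + (h\<^sup>2 / 4) *\<^sub>R A (A x)))"
    by simp
  then have "F h x = F h (?G (?G (x - h *\<^sub>R A x))) + (h\<^sup>2 / 4) *\<^sub>R F h (?G (?G (A (A x))))"
    by (metis G.add G.scale F.add F.scale)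
  also have "F h (?G (?G (x - h *\<^sub>R A x))) = ?G (?G x)"
    by (simp add: F_commute[OF h g] F_inv[OF h x(1)])
  also have "F h (?G (?G (A (A x)))) = ?G (?G (F h (A (A x))))"
    by (simp add: F_commute[OF h g])
  finally show ?thesis by simp
qed

text \<open>Transport of local errors: after \<open>k\<close> coarse steps one more is compared with
  two half steps, and the difference is carried on by the remaining fine steps. Each term is of
  order \<open>h\<^sup>2\<close>, so \<open>n\<close> of them with \<open>n * h \<le> t\<close>
  leave order \<open>h\<close>.\<close>

lemma half_steps_telescope:
  assumes h: "admissible h" and g: "admissible (h / 2)" and x: "x \<in> D" "A x \<in> D"
  shows "(F (h / 2) ^^ (2 * n)) x - (F h ^^ n) x
    = - (h\<^sup>2 / 4) *\<^sub>R (\<Sum>k<n. (F (h / 2) ^^ (2 * (n - k))) ((F h ^^ Suc k) (A (A x))))"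
proof (induction n)
  case (Suc n)
  let ?G = "F (h / 2)" and ?z = "A (A x)"
  interpret G2: linear "?G ^^ 2" by (rule real_linear_funpow_F[OF g])
  have "(?G ^^ (2 * Suc n)) x - (F h ^^ Suc n) x
      = (?G ^^ 2) ((?G ^^ (2 * n)) x - (F h ^^ n) x) + ((?G ^^ 2) ((F h ^^ n) x) - F h ((F h ^^ n) x))"
    unfolding mult_Suc_right funpow_add o_apply G2.diff by simp
  also have "(?G ^^ 2) ((F h ^^ n) x) - F h ((F h ^^ n) x) = - (h\<^sup>2 / 4) *\<^sub>R (?G ^^ 2) ((F h ^^ Suc n) ?z)"
    using two_half_steps[OF h g, of "(F h ^^ n) x"] x h
    by (simp add: numeral_2_eq_2 funpow_F_in_D A_funpow_F)
  also have "(?G ^^ 2) ((?G ^^ (2 * n)) x - (F h ^^ n) x)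
      = - (h\<^sup>2 / 4) *\<^sub>R (\<Sum>k<n. (?G ^^ (2 * (Suc n - k))) ((F h ^^ Suc k) ?z))"
  proof -
    have "(?G ^^ 2) ((?G ^^ (2 * (n - k))) y) = (?G ^^ (2 * (Suc n - k))) y" if "k < n" for k y
      using that by (simp add: Suc_diff_le numeral_2_eq_2)
    then show ?thesis
      unfolding Suc G2.scale G2.sum by (intro arg_cong[where f = "\<lambda>y. _ *\<^sub>R y"] sum.cong) auto
  qed
  finally show ?case
    by (simp add: scaleR_add_right)
qed simp

text \<open>With \<open>\<alpha>\<close> midway between \<open>\<omega>\<close> and
  \<open>\<beta>\<close>, the resolvent bound gives a factor
  \<open>M / (1 - \<alpha> * h) ^ m\<close>, and
  \<open>1 / (1 - \<alpha> * h) \<le> exp (\<beta> * h)\<close> for small \<open>h\<close>. The gap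
  between the exponents absorbs the discretisation, so \<open>M\<close> is not enlarged.\<close>

lemma stability:
  assumes \<beta>: "\<beta> > \<omega>" and p: "p \<in> N"
  shows "\<exists>q\<in>N. \<exists>h0>0. \<forall>h. 0 < h \<longrightarrow> h < h0 \<longrightarrow> admissible h \<and>
    (\<forall>m x. p ((F h ^^ m) x) \<le> M * exp (\<beta> * (m * h)) * q x)"
proof -
  define \<alpha> where "\<alpha> = (\<omega> + \<beta>) / 2"
  have \<alpha>: "\<omega> < \<alpha>" "\<alpha> < \<beta>" using \<beta> by (auto simp: \<alpha>_def)
  obtain q where q: "q \<in> N" "\<And>\<mu> m x. \<mu> > \<alpha> \<Longrightarrow> m \<ge> 1 \<Longrightarrow>
      p ((\<mu> - \<alpha>) ^ m *\<^sub>R (resolvent smul D A (of_real \<mu>) ^^ m) x) \<le> M * q x"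
    using resolvent_bound[OF \<alpha>(1) p] by blast
  \<comment> \<open>The first term yields \<open>\<alpha> * h < 1\<close>, the second
    \<open>h * (\<alpha> * \<beta>) \<le> \<beta> - \<alpha>\<close>, which is what
    \<open>1 \<le> (1 + \<beta> * h) * (1 - \<alpha> * h)\<close> amounts to. Absolute values are
    taken because the exponents may have any sign.\<close>
  define h0 where "h0 = min (1 / (\<bar>\<alpha>\<bar> + 1)) ((\<beta> - \<alpha>) / (\<bar>\<alpha> * \<beta>\<bar> + 1))"
  have "h0 > 0"
    using \<alpha> by (simp add: h0_def add_nonneg_pos)
  \<comment> \<open>The hypothesis on powers starts at \<open>m = 1\<close>. The maximum with
    \<open>p x\<close>, together with \<open>M \<ge> 1\<close>, covers \<open>m = 0\<close>.\<close>
  moreover have "admissible h \<and> p ((F h ^^ m) x) \<le> M * exp (\<beta> * (m * h)) * max (p x) (q x)"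
    if h: "0 < h" "h < h0" for h m x
  proof
    have "h * (\<bar>\<alpha>\<bar> + 1) < 1" "h * (\<bar>\<alpha> * \<beta>\<bar> + 1) < \<beta> - \<alpha>"
      using h by (auto simp: h0_def pos_less_divide_eq add_nonneg_pos)
    then have "h * \<bar>\<alpha>\<bar> + h < 1" "h * \<bar>\<alpha> * \<beta>\<bar> + h < \<beta> - \<alpha>"
      by (simp_all only: distrib_left mult_1_right)
    moreover have "h * \<alpha> \<le> h * \<bar>\<alpha>\<bar>" "h * (\<alpha> * \<beta>) \<le> h * \<bar>\<alpha> * \<beta>\<bar>" "h * \<omega> \<le> h * \<alpha>"
      using h \<alpha> by (auto intro: mult_left_mono)
    ultimately have "h * \<alpha> < 1" "h * (\<alpha> * \<beta>) \<le> \<beta> - \<alpha>" "h * \<omega> < 1"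
      using h(1) by linarith+
    then have small: "\<alpha> * h < 1" "h * (\<alpha> * \<beta>) \<le> \<beta> - \<alpha>" "\<omega> * h < 1"
      by (simp_all add: mult.commute)
    then show adm: "admissible h"
      using h by (simp add: admissible_def)
    let ?R = "resolvent smul D A (of_real (1 / h))"
    show "p ((F h ^^ m) x) \<le> M * exp (\<beta> * (m * h)) * max (p x) (q x)"
    proof (cases "m = 0")
      case True
      then show ?thesis
        using M N_nonneg[OF p, of x] mult_mono[of 1 M "p x" "max (p x) (q x)"] by simp
    next
      case False
      have "0 \<le> h * (\<beta> - \<alpha> - h * (\<alpha> * \<beta>))"
        using h small by simp
      then have "1 \<le> (1 + \<beta> * h) * (1 - \<alpha> * h)"
        by (simp add: algebra_simps)
      also have "\<dots> \<le> exp (\<beta> * h) * (1 - \<alpha> * h)"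
        using small by (intro mult_right_mono) auto
      finally have "1 \<le> (exp (\<beta> * h) * (1 - \<alpha> * h)) ^ m"
        by (rule one_le_power)
      then have growth: "1 \<le> exp (\<beta> * (m * h)) * (1 - \<alpha> * h) ^ m"
        by (simp add: power_mult_distrib mult_ac flip: exp_of_nat_mult)
      have "linear ?R"
        using h_resolvents[OF adm] by (auto simp: resolvent_set_def cont_linear_maps_def intro: linear_smul_imp_linear)
      then have "(?R ^^ m) x = h ^ m *\<^sub>R (F h ^^ m) x"
        using h by (induction m) (simp_all add: F_def linear_scale)
      then have "(1 / h - \<alpha>) ^ m *\<^sub>R (?R ^^ m) x = (1 - \<alpha> * h) ^ m *\<^sub>R (F h ^^ m) x"
        using h by (simp add: left_diff_distrib flip: power_mult_distrib)
      moreover have "1 / h > \<alpha>"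
        using h small by (simp add: pos_less_divide_eq)
      ultimately have *: "(1 - \<alpha> * h) ^ m * p ((F h ^^ m) x) \<le> M * q x"
        using q(2)[of "1 / h" m x] False small
        by (simp add: seminorm_scaleR[OF N_seminorm[OF p]])
      have "p ((F h ^^ m) x) \<le> exp (\<beta> * (m * h)) * (1 - \<alpha> * h) ^ m * p ((F h ^^ m) x)"
        using mult_right_mono[OF growth N_nonneg[OF p]] by simp
      also have "\<dots> \<le> exp (\<beta> * (m * h)) * (M * q x)"
        unfolding mult.assoc by (intro mult_left_mono *) simp
      also have "\<dots> \<le> exp (\<beta> * (m * h)) * (M * max (p x) (q x))"
        using M by (intro mult_left_mono) auto
      finally show ?thesis by (simp add: mult_ac)
    qed
  qed
  ultimately show ?thesis
    using N_max[OF p q(1)] by (intro bexI[of _ "\<lambda>x. max (p x) (q x)"] exI[of _ h0]) auto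
qed

text \<open>For convergence the size of the constant does not matter, only that it is uniform in the
  step on bounded time intervals. A positive exponent \<open>\<beta>\<close> lets
  \<open>exp (\<beta> * t0)\<close> bound all earlier times.\<close>

lemma locally_bounded:
  assumes p: "p \<in> N"
  shows "\<exists>q\<in>N. \<exists>K\<ge>0. \<exists>h0>0. \<forall>h. 0 < h \<longrightarrow> h < h0 \<longrightarrow> admissible h \<and>
    (\<forall>m x. m * h \<le> t0 \<longrightarrow> p ((F h ^^ m) x) \<le> K * q x)"
proof -
  define \<beta> where "\<beta> = \<bar>\<omega>\<bar> + 1"
  have \<beta>: "\<beta> > \<omega>" "\<beta> > 0" by (auto simp: \<beta>_def)
  obtain q h0 where q: "q \<in> N" "h0 > 0" and qb: "\<And>h. 0 < h \<Longrightarrow> h < h0 \<Longrightarrow> admissible h \<and>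
      (\<forall>m x. p ((F h ^^ m) x) \<le> M * exp (\<beta> * (m * h)) * q x)"
    using stability[OF \<beta>(1) p] by blast
  have "p ((F h ^^ m) x) \<le> M * exp (\<beta> * t0) * q x" if "0 < h" "h < h0" "m * h \<le> t0" for h m x
  proof -
    have "p ((F h ^^ m) x) \<le> M * exp (\<beta> * (m * h)) * q x"
      using qb that by blast
    also have "\<dots> \<le> M * exp (\<beta> * t0) * q x"
      using that \<beta> M by (intro mult_right_mono mult_left_mono N_nonneg[OF q(1)]) auto
    finally show ?thesis .
  qed
  then show ?thesis
    using q qb M by (intro bexI[of _ q] exI[of _ "M * exp (\<beta> * t0)"] exI[of _ h0] conjI allI impI) auto
qed

lemma dense_approx: "p \<in> N \<Longrightarrow> e > 0 \<Longrightarrow> \<exists>y\<in>D. p (x - y) < e"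
  using dense unfolding closure_eq_UNIV_iff by blast

text \<open>Continuity at time 0, uniformly in the step size. On \<open>D\<close> the increment is
  at most \<open>m * h\<close> times a constant, by \<open>funpow_F_diff\<close>; density and the
  local bound carry this over to every \<open>x\<close>.\<close>

lemma near_identity:
  assumes p: "p \<in> N" and e: "e > 0"
  shows "\<exists>d>0. \<forall>h m. 0 < h \<longrightarrow> h < d \<longrightarrow> m * h \<le> d \<longrightarrow> admissible h \<and> p ((F h ^^ m) x - x) \<le> e"
proof -
  note ps = N_seminorm[OF p]
  obtain q K h0 where q: "q \<in> N" "K \<ge> 0" "h0 > 0" and qb: "\<And>h. 0 < h \<Longrightarrow> h < h0 \<Longrightarrow> admissible h \<and>
      (\<forall>m x. m * h \<le> 1 \<longrightarrow> p ((F h ^^ m) x) \<le> K * q x)"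
    using locally_bounded[OF p, of 1] by blast
  obtain y where y: "y \<in> D" "max (p (x - y)) (q (x - y)) < e / (3 * (K + 1))"
    using dense_approx[OF N_max[OF p q(1)], of "e / (3 * (K + 1))" x] e q by auto
  have "(K + 1) * p (x - y) < e / 3" "(K + 1) * q (x - y) < e / 3"
    using y(2) q(2) by (simp_all add: pos_less_divide_eq algebra_simps)
  moreover have "p (x - y) \<le> (K + 1) * p (x - y)" "K * q (x - y) \<le> (K + 1) * q (x - y)"
    using q(2) N_nonneg[OF p, of "x - y"] N_nonneg[OF q(1), of "x - y"] by (simp_all add: distrib_right)
  ultimately have pq: "p (x - y) \<le> e / 3" "K * q (x - y) \<le> e / 3" by linarith+
  define B where "B = K * q (A y)"
  have B: "B \<ge> 0" using q N_nonneg[OF q(1)] by (simp add: B_def)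
  \<comment> \<open>\<open>h0\<close> secures admissibility and the bound on powers, 1 keeps
    \<open>m * h\<close> within the time range of that bound, and the last term makes the increment
    \<open>m * h * B\<close> at most \<open>e / 3\<close>.\<close>
  define d where "d = min (min h0 1) (e / (3 * (B + 1)))"
  have "d > 0" using q e B by (simp add: d_def)
  moreover have "admissible h \<and> p ((F h ^^ m) x - x) \<le> e" if h: "0 < h" "h < d" "m * h \<le> d" for h m
  proof
    have hd: "h < h0" "m * h \<le> 1" "m * h \<le> e / (3 * (B + 1))"
      using h by (auto simp: d_def)
    show adm: "admissible h" using qb[OF h(1) hd(1)] by blast
    note lin = real_linear_funpow_F[OF adm]
    have "p ((F h ^^ m) y - y) = h * p (\<Sum>k<m. (F h ^^ Suc k) (A y))"
      unfolding funpow_F_diff[OF adm y(1)] using h by (simp only: seminorm_scaleR[OF ps])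
    also have "\<dots> \<le> h * (\<Sum>k<m. B)"
    proof (intro mult_left_mono order_trans[OF seminorm_sum[OF ps]] sum_mono)
      fix k assume "k \<in> {..<m}"
      then have "Suc k * h \<le> m * h"
        using h by (intro mult_right_mono) auto
      then have "Suc k * h \<le> 1"
        using hd(2) by linarith
      then show "p ((F h ^^ Suc k) (A y)) \<le> B"
        unfolding B_def using qb[OF h(1) hd(1)] by blast
    qed (use h in simp)
    also have "\<dots> = m * h * B" by simp
    also have "\<dots> \<le> e / (3 * (B + 1)) * B"
      using hd(3) B by (rule mult_right_mono)
    also have "\<dots> \<le> e / 3"
      using B e by (simp add: field_simps)
    finally have 1: "p ((F h ^^ m) y - y) \<le> e / 3" .
    have "p ((F h ^^ m) x - (F h ^^ m) y) = p ((F h ^^ m) (x - y))"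
      by (simp add: linear_diff[OF lin])
    also have "\<dots> \<le> K * q (x - y)"
      using qb[OF h(1) hd(1)] hd(2) by blast
    finally have 2: "p ((F h ^^ m) x - (F h ^^ m) y) \<le> e / 3"
      using pq by linarith
    show "p ((F h ^^ m) x - x) \<le> e"
      using seminorm_diff_trans[OF ps, of "(F h ^^ m) x" x "(F h ^^ m) y"]
        seminorm_diff_trans[OF ps, of "(F h ^^ m) y" x y] 1 2 pq(1) seminorm_commute[OF ps, of x y]
      by linarith
  qed
  ultimately show ?thesis by blast
qed

text \<open>\<open>F h\<close> maps \<open>D\<close> into the domain of \<open>A\<^sup>2\<close> and
  is close to the identity at \<open>x\<close> for small \<open>h\<close>. The approximation within
  \<open>D\<close> is made in the seminorm \<open>q\<close> that controls \<open>p\<close> after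
  \<open>F h\<close>.\<close>

lemma dense_square:
  assumes p: "p \<in> N" and e: "e > 0"
  shows "\<exists>y. y \<in> D \<and> A y \<in> D \<and> p (x - y) < e"
proof -
  note ps = N_seminorm[OF p]
  obtain q K h0 where q: "q \<in> N" "K \<ge> 0" "h0 > 0" and qb: "\<And>h. 0 < h \<Longrightarrow> h < h0 \<Longrightarrow> admissible h \<and>
      (\<forall>m x. m * h \<le> 1 \<longrightarrow> p ((F h ^^ m) x) \<le> K * q x)"
    using locally_bounded[OF p, of 1] by blast
  obtain d where d: "d > 0" "\<And>h m. 0 < h \<Longrightarrow> h < d \<Longrightarrow> m * h \<le> d \<Longrightarrow> p ((F h ^^ m) x - x) \<le> e / 3"
    using near_identity[OF p, of "e / 3" x] e by auto
  define h where "h = min (min h0 d) 1 / 2"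
  have h: "0 < h" "h < h0" "h < d" "h \<le> 1"
    using q(3) d(1) by (auto simp: h_def min_def)
  have adm: "admissible h" using qb h by blast
  obtain w where w: "w \<in> D" "q (x - w) < e / (3 * (K + 1))"
    using dense_approx[OF q(1), of "e / (3 * (K + 1))" x] e q by auto
  have "p (F h x - F h w) = p ((F h ^^ 1) (x - w))"
    by (simp add: linear_diff[OF real_linear_F[OF adm]])
  also have "\<dots> \<le> K * q (x - w)"
    using qb[OF h(1,2)] h(4) by (metis mult_1 of_nat_1)
  also have "\<dots> \<le> (K + 1) * q (x - w)"
    using N_nonneg[OF q(1)] by (intro mult_right_mono) auto
  also have "\<dots> < e / 3"
    using w(2) q(2) by (simp add: pos_less_divide_eq algebra_simps)
  finally have "p (F h x - F h w) < e / 3" .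
  moreover have "p (F h x - x) \<le> e / 3"
    using d(2)[of h 1] h by simp
  ultimately have "p (x - F h w) < e"
    using seminorm_diff_trans[OF ps, of x "F h w" "F h x"] seminorm_commute[OF ps, of x "F h x"] e
    by linarith
  moreover have "A (F h w) \<in> D"
    using A_F[OF adm w(1)] adm by simp
  ultimately show ?thesis
    using adm F_in_D by blast
qed

section \<open>Rounding times to the dyadic grid, and convergence of the Euler scheme\<close>

definition steps :: "real \<Rightarrow> nat \<Rightarrow> nat"
  where "steps t j = nat \<lfloor>t * 2 ^ j\<rfloor>"

lemma steps_bounds:
  assumes "t \<ge> 0"
  shows "steps t j * (1 / 2 ^ j) \<le> t" "t < (steps t j + 1) * (1 / 2 ^ j)"
proof -
  have "real (steps t j) = of_int \<lfloor>t * 2 ^ j\<rfloor>"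
    using assms by (simp add: steps_def)
  then have "real (steps t j) \<le> t * 2 ^ j" "t * 2 ^ j < real (steps t j) + 1"
    by linarith+
  then show "steps t j * (1 / 2 ^ j) \<le> t" "t < (steps t j + 1) * (1 / 2 ^ j)"
    by (simp_all add: pos_divide_le_eq pos_less_divide_eq)
qed

lemma steps_le_iff: "t \<ge> 0 \<Longrightarrow> n \<le> steps t j \<longleftrightarrow> n \<le> t * 2 ^ j"
  unfolding steps_def by (simp add: le_nat_iff le_floor_iff)

lemma steps_unique:
  assumes "t \<ge> 0" "real n \<le> t * 2 ^ j" "t * 2 ^ j < real n + 1"
  shows "steps t j = n"
proof -
  have "n \<le> steps t j" "\<not> Suc n \<le> steps t j"
    using assms by (simp_all only: steps_le_iff)
  then show ?thesis by simp
qed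

text \<open>Rounding down at the coarse level can lose one fine step; \<open>E_step\<close> pays for
  the second alternative.\<close>

lemma steps_Suc:
  assumes "t \<ge> 0"
  shows "steps t (Suc j) = 2 * steps t j \<or> steps t (Suc j) = Suc (2 * steps t j)"
proof -
  have "real (steps t j) \<le> t * 2 ^ j" "t * 2 ^ j < real (steps t j) + 1"
    using steps_bounds[OF assms, of j] by (simp_all add: pos_divide_le_eq pos_less_divide_eq)
  then show ?thesis
    using assms steps_unique[of t "2 * steps t j" "Suc j"] steps_unique[of t "Suc (2 * steps t j)" "Suc j"]
    by (cases "t * 2 ^ Suc j < 2 * steps t j + 1") auto
qed

text \<open>The two rounding errors can add up to a full step; \<open>S_add\<close> has to absorb
  the second alternative.\<close>

lemma steps_add:
  assumes "t \<ge> 0" "s \<ge> 0"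
  shows "steps (t + s) j = steps t j + steps s j \<or> steps (t + s) j = Suc (steps t j + steps s j)"
proof -
  have "real (steps t j) \<le> t * 2 ^ j" "t * 2 ^ j < real (steps t j) + 1"
    "real (steps s j) \<le> s * 2 ^ j" "s * 2 ^ j < real (steps s j) + 1"
    using steps_bounds[OF assms(1), of j] steps_bounds[OF assms(2), of j]
    by (simp_all add: pos_divide_le_eq pos_less_divide_eq)
  then show ?thesis
    using assms steps_unique[of "t + s" "steps t j + steps s j" j]
      steps_unique[of "t + s" "Suc (steps t j + steps s j)" j]
    by (cases "(t + s) * 2 ^ j < real (steps t j + steps s j) + 1") (auto simp: distrib_right)
qed

lemma steps_tendsto:
  assumes "t \<ge> 0"
  shows "(\<lambda>j. steps t j * (1 / 2 ^ j)) \<longlonglongrightarrow> t"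
proof (rule tendsto_sandwich)
  show "(\<lambda>j. t - (1 / 2) ^ j) \<longlonglongrightarrow> t"
    by (rule tendsto_eq_intros LIMSEQ_realpow_zero refl | simp)+
  have "t - (1 / 2) ^ j \<le> steps t j * (1 / 2 ^ j)" for j
    using steps_bounds(2)[OF assms, of j] by (simp add: power_one_over add_divide_distrib)
  then show "\<forall>\<^sub>F j in sequentially. t - (1 / 2) ^ j \<le> steps t j * (1 / 2 ^ j)"
    by simp
qed (use steps_bounds(1)[OF assms] in auto)

text \<open>The implicit Euler approximation of the semigroup at time \<open>t\<close> with step
  \<open>1 / 2 ^ j\<close>, where \<open>t\<close> is rounded down to the grid.\<close>

definition E :: "nat \<Rightarrow> real \<Rightarrow> 'b \<Rightarrow> 'b"
  where "E j t = F (1 / 2 ^ j) ^^ steps t j"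

lemma E_bounded:
  assumes p: "p \<in> N" and t: "t \<ge> 0"
  shows "\<exists>q\<in>N. \<exists>K\<ge>0. \<forall>\<^sub>F j in sequentially. \<forall>x. p (E j t x) \<le> K * q x"
proof -
  obtain q K h0 where q: "q \<in> N" "K \<ge> 0" "h0 > 0" and qb: "\<And>h. 0 < h \<Longrightarrow> h < h0 \<Longrightarrow> admissible h \<and>
      (\<forall>m x. m * h \<le> t \<longrightarrow> p ((F h ^^ m) x) \<le> K * q x)"
    using locally_bounded[OF p, of t] by blast
  have "\<forall>\<^sub>F j in sequentially. \<forall>x. p (E j t x) \<le> K * q x"
    using eventually_dyadic_lt[OF q(3)]
  proof eventually_elim
    case (elim j)
    then show ?case
      unfolding E_def using qb[of "1 / 2 ^ j"] steps_bounds(1)[OF t, of j] by auto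
  qed
  with q show ?thesis by blast
qed

lemma eventually_admissible: "\<forall>\<^sub>F j in sequentially. admissible (1 / 2 ^ j)"
proof -
  have "\<forall>\<^sub>F j in sequentially. 1 / 2 ^ j < 1 / (\<bar>\<omega>\<bar> + 1)"
    by (rule eventually_dyadic_lt) (simp add: add_nonneg_pos)
  then show ?thesis
  proof eventually_elim
    case (elim j)
    have "\<omega> * (1 / 2 ^ j) \<le> (\<bar>\<omega>\<bar> + 1) * (1 / 2 ^ j)"
      by (intro mult_right_mono) auto
    also have "\<dots> < 1"
      using elim by (simp add: pos_less_divide_eq mult.commute add_nonneg_pos)
    finally show ?case by (simp add: admissible_def)
  qed
qed

lemma eventually_linear_E: "\<forall>\<^sub>F j in sequentially. Vector_Spaces.linear smul smul (E j t)"
  using eventually_admissible by eventually_elim (simp add: E_def funpow_F_linear)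

text \<open>Halving the step costs at most \<open>t * B * h\<close> by the telescope, and the fine
  step that rounding may add costs another multiple of \<open>h\<close>. Halving \<open>h\<close> at
  each level then gives summable increments.\<close>

lemma E_step:
  assumes p: "p \<in> N" and t: "t \<ge> 0" and x: "x \<in> D" "A x \<in> D"
  shows "\<exists>K\<ge>0. \<forall>\<^sub>F j in sequentially. p (E (Suc j) t x - E j t x) \<le> K * (1 / 2 ^ j)"
proof -
  note ps = N_seminorm[OF p]
  let ?z = "A (A x)"
  obtain q K h0 where q: "q \<in> N" "K \<ge> 0" "h0 > 0" and qb: "\<And>h. 0 < h \<Longrightarrow> h < h0 \<Longrightarrow> admissible h \<and>
      (\<forall>m x. m * h \<le> t \<longrightarrow> p ((F h ^^ m) x) \<le> K * q x)"
    using locally_bounded[OF p, of t] by blast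
  \<comment> \<open>The telescoped terms are products of powers of two different operators, so the
    local bound is applied twice and the seminorm passes from \<open>p\<close> to \<open>q\<close>
    to \<open>q'\<close>.\<close>
  obtain q' K' h0' where q': "q' \<in> N" "K' \<ge> 0" "h0' > 0" and qb': "\<And>h. 0 < h \<Longrightarrow> h < h0' \<Longrightarrow> admissible h \<and>
      (\<forall>m x. m * h \<le> t \<longrightarrow> q ((F h ^^ m) x) \<le> K' * q' x)"
    using locally_bounded[OF q(1), of t] by blast
  define B where "B = K * (K' * q' ?z)"
  have B: "B \<ge> 0" using q q' N_nonneg[OF q'(1)] by (simp add: B_def)
  have K0: "K * q (A x) \<ge> 0" using q N_nonneg[OF q(1)] by simp
  have "\<forall>\<^sub>F j in sequentially. 1 / 2 ^ j < min h0 h0'"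
    using q q' by (intro eventually_dyadic_lt) auto
  then have "\<forall>\<^sub>F j in sequentially. p (E (Suc j) t x - E j t x) \<le> (t * B + K * q (A x)) * (1 / 2 ^ j)"
  proof eventually_elim
    case (elim j)
    define h :: real where "h = 1 / 2 ^ j"
    define n where "n = steps t j"
    have h: "0 < h" "h < h0" "h < h0'" and half: "1 / 2 ^ Suc j = h / 2"
      using elim by (auto simp: h_def)
    have h2: "0 < h / 2" "h / 2 < h0" "h / 2 < h0'" using h by auto
    have adm: "admissible h" "admissible (h / 2)" using qb h h2 by blast+
    have h1: "h \<le> 1" by (simp add: h_def)
    have nh: "n * h \<le> t" using steps_bounds(1)[OF t, of j] by (simp add: n_def h_def)
    have "(F (h / 2) ^^ (2 * n)) x - (F h ^^ n) x
        = - (h\<^sup>2 / 4) *\<^sub>R (\<Sum>k<n. (F (h / 2) ^^ (2 * (n - k))) ((F h ^^ Suc k) ?z))"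
      by (rule half_steps_telescope[OF adm x])
    then have "p ((F (h / 2) ^^ (2 * n)) x - (F h ^^ n) x)
        = h\<^sup>2 / 4 * p (\<Sum>k<n. (F (h / 2) ^^ (2 * (n - k))) ((F h ^^ Suc k) ?z))"
      by (simp only: seminorm_scaleR[OF ps]) simp
    also have "\<dots> \<le> h\<^sup>2 / 4 * (\<Sum>k<n. B)"
    proof (intro mult_left_mono order_trans[OF seminorm_sum[OF ps]] sum_mono)
      fix k assume k: "k \<in> {..<n}"
      have "real (Suc k) * h \<le> n * h" "real (n - k) * h \<le> n * h"
        using k h by (intro mult_right_mono; simp)+
      then have le: "real (Suc k) * h \<le> t" "real (2 * (n - k)) * (h / 2) \<le> t"
        using nh by auto
      have "p ((F (h / 2) ^^ (2 * (n - k))) ((F h ^^ Suc k) ?z)) \<le> K * q ((F h ^^ Suc k) ?z)"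
        using qb[OF h2(1,2)] le(2) by blast
      also have "\<dots> \<le> B"
        unfolding B_def using qb'[OF h(1,3)] le(1) q(2) by (intro mult_left_mono) blast+
      finally show "p ((F (h / 2) ^^ (2 * (n - k))) ((F h ^^ Suc k) ?z)) \<le> B" .
    qed simp
    also have "\<dots> = (n * h) * B * h / 4"
      by (simp add: power2_eq_square)
    also have "\<dots> \<le> t * B * h / 4"
      using nh B h by (intro divide_right_mono mult_right_mono) auto
    also have "\<dots> \<le> t * B * h"
      using t B h by simp
    finally have 1: "p ((F (h / 2) ^^ (2 * n)) x - (F h ^^ n) x) \<le> t * B * h" .
    \<comment> \<open>The fine level has either \<open>2 * n\<close> steps or one more; the
      additional step is estimated by \<open>F_diff\<close>.\<close>
    have 2: "p ((F (h / 2) ^^ steps t (Suc j)) x - (F (h / 2) ^^ (2 * n)) x) \<le> K * q (A x) * h"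
      using steps_Suc[OF t, of j]
    proof (elim disjE)
      assume s: "steps t (Suc j) = Suc (2 * steps t j)"
      have "(F (h / 2) ^^ Suc (2 * n)) x - (F (h / 2) ^^ (2 * n)) x = (F (h / 2) ^^ (2 * n)) (F (h / 2) x - x)"
        by (simp only: linear_diff[OF real_linear_funpow_F[OF adm(2)]] funpow_Suc_right o_apply)
      also have "\<dots> = (h / 2) *\<^sub>R (F (h / 2) ^^ Suc (2 * n)) (A x)"
        by (simp only: F_diff[OF adm(2) x(1)] linear_scale[OF real_linear_funpow_F[OF adm(2)]]
            funpow_Suc_right o_apply)
      finally have "p ((F (h / 2) ^^ Suc (2 * n)) x - (F (h / 2) ^^ (2 * n)) x)
          = h / 2 * p ((F (h / 2) ^^ Suc (2 * n)) (A x))"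
        using h by (simp only: seminorm_scaleR[OF ps])
      also have "\<dots> \<le> h / 2 * (K * q (A x))"
      proof (intro mult_left_mono)
        have "real (Suc (2 * n)) * (h / 2) \<le> t"
          using steps_bounds(1)[OF t, of "Suc j"] unfolding half s n_def[symmetric] by simp
        then show "p ((F (h / 2) ^^ Suc (2 * n)) (A x)) \<le> K * q (A x)"
          using qb[OF h2(1,2)] by blast
      qed (use h in simp)
      also have "\<dots> \<le> K * q (A x) * h"
        using K0 h by simp
      finally show ?thesis unfolding s n_def[symmetric] .
    qed (use K0 h in \<open>simp add: seminorm_zero[OF ps] flip: n_def\<close>)
    have "p (E (Suc j) t x - E j t x) \<le> K * q (A x) * h + t * B * h"
      unfolding E_def half h_def[symmetric] n_def[symmetric]
      by (rule order_trans[OF seminorm_diff_trans[OF ps, where y = "(F (h / 2) ^^ (2 * n)) x"]])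
         (intro add_mono 1 2)
    then show ?case
      by (simp add: h_def algebra_simps)
  qed
  then show ?thesis
    using t B K0 by (intro exI[of _ "t * B + K * q (A x)"]) auto
qed

text \<open>The parameter \<open>k\<close> allows \<open>n0\<close> to be pushed beyond the level
  from which other bounds hold.\<close>

lemma E_Cauchy_D2:
  assumes p: "p \<in> N" and t: "t \<ge> 0" and x: "x \<in> D" "A x \<in> D" and e: "e > 0"
  shows "\<exists>n0. \<forall>m\<ge>n0. p (E m t x - E n0 t x) < e \<and> n0 \<ge> k"
proof -
  note ps = N_seminorm[OF p]
  obtain K where K: "K \<ge> 0" "\<forall>\<^sub>F j in sequentially. p (E (Suc j) t x - E j t x) \<le> K * (1 / 2 ^ j)"
    using E_step[OF p t x] by blast
  have "\<forall>\<^sub>F j in sequentially. 1 / 2 ^ j < e / (2 * (K + 1))"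
    using K e by (intro eventually_dyadic_lt) auto
  then have "\<forall>\<^sub>F j in sequentially. j \<ge> k \<and> 1 / 2 ^ j < e / (2 * (K + 1)) \<and>
      p (E (Suc j) t x - E j t x) \<le> K * (1 / 2 ^ j)"
    by (intro eventually_conj eventually_ge_at_top K(2))
  then obtain n0 where n0: "n0 \<ge> k" "1 / 2 ^ n0 < e / (2 * (K + 1))"
      "\<And>j. j \<ge> n0 \<Longrightarrow> p (E (Suc j) t x - E j t x) \<le> K * (1 / 2 ^ j)"
    unfolding eventually_sequentially by blast
  \<comment> \<open>The exact partial geometric sum is kept, since the bound
    \<open>2 * K * (1 / 2 ^ n0)\<close> alone would not survive the induction.\<close>
  have "p (E (n0 + d) t x - E n0 t x) \<le> 2 * K * (1 / 2 ^ n0 - 1 / 2 ^ (n0 + d))" for d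
  proof (induction d)
    case (Suc d)
    have "p (E (n0 + Suc d) t x - E n0 t x) \<le> K * (1 / 2 ^ (n0 + d)) + 2 * K * (1 / 2 ^ n0 - 1 / 2 ^ (n0 + d))"
      using seminorm_diff_trans[OF ps, of "E (n0 + Suc d) t x" "E n0 t x" "E (n0 + d) t x"] Suc
        n0(3)[of "n0 + d"] by simp
    then show ?case by (simp add: algebra_simps)
  qed (simp add: seminorm_zero[OF ps])
  moreover have "2 * K * (1 / 2 ^ n0 - 1 / 2 ^ (n0 + d)) < e" for d
  proof -
    have "2 * K * (1 / 2 ^ n0 - 1 / 2 ^ (n0 + d)) \<le> 2 * (K + 1) * (1 / 2 ^ n0)"
      using K(1) by (intro mult_mono) (auto simp: frac_le)
    also have "\<dots> < e"
      using n0(2) K(1) by (simp add: pos_less_divide_eq mult_ac)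
    finally show ?thesis .
  qed
  ultimately have "p (E (n0 + d) t x - E n0 t x) < e" for d
    by (rule order_le_less_trans)
  then have "p (E m t x - E n0 t x) < e" if "m \<ge> n0" for m
    using that by (metis le_add_diff_inverse)
  then show ?thesis
    using n0(1) by blast
qed

text \<open>Convergence on the domain of \<open>A\<^sup>2\<close> spreads to every \<open>x\<close>,
  because that domain is dense and the operators \<open>E j t\<close> are eventually bounded
  uniformly in \<open>j\<close>.\<close>

lemma E_convergent:
  assumes t: "t \<ge> 0"
  shows "\<exists>l. limitin \<tau> (\<lambda>j. E j t x) l sequentially"
proof (rule Cauchy_convergent)
  fix p and e :: real assume p: "p \<in> N" and e: "e > 0"
  note ps = N_seminorm[OF p]
  obtain q K where q: "q \<in> N" "K \<ge> 0" "\<forall>\<^sub>F j in sequentially. \<forall>x. p (E j t x) \<le> K * q x"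
    using E_bounded[OF p t] by blast
  obtain k where k: "\<And>j x. j \<ge> k \<Longrightarrow> p (E j t x) \<le> K * q x" "\<And>j. j \<ge> k \<Longrightarrow> linear (E j t)"
    using eventually_conj[OF q(3) eventually_linear_E[of t]] linear_smul_imp_linear
    unfolding eventually_sequentially by blast
  obtain y where y: "y \<in> D" "A y \<in> D" "q (x - y) < e / (4 * (K + 1))"
    using dense_square[OF q(1), of "e / (4 * (K + 1))" x] e q by auto
  have "K * q (x - y) \<le> (K + 1) * q (x - y)"
    using N_nonneg[OF q(1)] by (intro mult_right_mono) auto
  also have "\<dots> < e / 4"
    using y(3) q(2) by (simp add: pos_less_divide_eq algebra_simps)
  finally have Kq: "K * q (x - y) < e / 4" .
  obtain n0 where n0: "n0 \<ge> k" "\<And>m. m \<ge> n0 \<Longrightarrow> p (E m t y - E n0 t y) < e / 4"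
    using E_Cauchy_D2[OF p t y(1,2), of "e / 4" k] e by auto
  have close: "p (E m t x - E n0 t y) < e / 2" if "m \<ge> n0" for m
  proof -
    have "p (E m t x - E m t y) \<le> K * q (x - y)"
      using k[of m] that n0(1) by (simp flip: linear_diff)
    then show ?thesis
      using seminorm_diff_trans[OF ps, of "E m t x" "E n0 t y" "E m t y"] n0(2)[OF that] Kq by linarith
  qed
  have "p (E m t x - E n t x) < e" if "m \<ge> n0" "n \<ge> n0" for m n
    using seminorm_diff_trans[OF ps, of "E m t x" "E n t x" "E n0 t y"] close[OF that(1)] close[OF that(2)]
      seminorm_commute[OF ps, of "E n t x" "E n0 t y"] by linarith
  then show "\<exists>n0. \<forall>m\<ge>n0. \<forall>n\<ge>n0. p (E m t x - E n t x) < e" by blast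
qed

section \<open>The limit semigroup and its generator\<close>

definition S :: "real \<Rightarrow> 'b \<Rightarrow> 'b"
  where "S t x = (SOME l. limitin \<tau> (\<lambda>j. E j t x) l sequentially)"

lemma limitin_S: "t \<ge> 0 \<Longrightarrow> limitin \<tau> (\<lambda>j. E j t x) (S t x) sequentially"
  unfolding S_def by (rule someI_ex[OF E_convergent])

lemma S_linear: "t \<ge> 0 \<Longrightarrow> Vector_Spaces.linear smul smul (S t)"
  by (rule linear_limitin[OF eventually_linear_E limitin_S]) auto

text \<open>The rounded times \<open>steps t j * (1 / 2 ^ j)\<close> tend to \<open>t\<close>, so
  the stability bound passes to the limit with the same \<open>M\<close> and
  \<open>\<beta>\<close>.\<close>

lemma S_bound:
  assumes \<beta>: "\<beta> > \<omega>" and p: "p \<in> N"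
  shows "\<exists>q\<in>N. \<forall>t\<ge>0. \<forall>x. p (S t x) \<le> M * exp (\<beta> * t) * q x"
proof -
  obtain q h0 where q: "q \<in> N" "h0 > 0" and qb: "\<And>h. 0 < h \<Longrightarrow> h < h0 \<Longrightarrow> admissible h \<and>
      (\<forall>m x. p ((F h ^^ m) x) \<le> M * exp (\<beta> * (m * h)) * q x)"
    using stability[OF \<beta> p] by blast
  have "p (S t x) \<le> M * exp (\<beta> * t) * q x" if t: "t \<ge> 0" for t x
  proof (rule tendsto_le[OF sequentially_bot])
    show "(\<lambda>j. p (E j t x)) \<longlonglongrightarrow> p (S t x)"
      by (rule limitin_N[OF p limitin_S[OF t]])
    show "(\<lambda>j. M * exp (\<beta> * (steps t j * (1 / 2 ^ j))) * q x) \<longlonglongrightarrow> M * exp (\<beta> * t) * q x"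
      by (intro tendsto_intros steps_tendsto t)
    show "\<forall>\<^sub>F j in sequentially. p (E j t x) \<le> M * exp (\<beta> * (steps t j * (1 / 2 ^ j))) * q x"
      using eventually_dyadic_lt[OF q(2)]
    proof eventually_elim
      case (elim j)
      then show ?case unfolding E_def using qb[of "1 / 2 ^ j"] by auto
    qed
  qed
  with q show ?thesis by blast
qed

lemma S_0: "S 0 = id"
proof
  fix x
  have "limitin \<tau> (\<lambda>j. E j 0 x) x sequentially"
    by (simp add: E_def steps_def)
  then show "S 0 x = id x"
    using limitin_unique[OF limitin_S[of 0 x]] by simp
qed

lemma S_near_identity:
  assumes p: "p \<in> N" and e: "e > 0"
  shows "\<exists>d>0. \<forall>t. 0 \<le> t \<longrightarrow> t < d \<longrightarrow> p (S t x - x) \<le> e"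
proof -
  obtain d where d: "d > 0" "\<And>h m. 0 < h \<Longrightarrow> h < d \<Longrightarrow> m * h \<le> d \<Longrightarrow> p ((F h ^^ m) x - x) \<le> e"
    using near_identity[OF p e, of x] by blast
  have "p (S t x - x) \<le> e" if t: "0 \<le> t" "t < d" for t
  proof (rule tendsto_upperbound[OF _ _ sequentially_bot])
    show "(\<lambda>j. p (E j t x - x)) \<longlonglongrightarrow> p (S t x - x)"
      by (intro limitin_N[OF p] limitin_diff limitin_S t) simp
    show "\<forall>\<^sub>F j in sequentially. p (E j t x - x) \<le> e"
      using eventually_dyadic_lt[OF d(1)]
    proof eventually_elim
      case (elim j)
      then show ?case
        unfolding E_def using d(2)[of "1 / 2 ^ j" "steps t j"] steps_bounds(1)[OF t(1), of j] t by simp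
    qed
  qed
  with d(1) show ?thesis by blast
qed

text \<open>One additional Euler step is invisible in the limit; this disposes of the rounding error
  in \<open>S_add\<close>.\<close>

lemma limitin_F: "limitin \<tau> (\<lambda>j. F (1 / 2 ^ j) x) x sequentially"
  unfolding limitin_iff tendsto_iff
proof (intro ballI allI impI)
  fix p and e :: real assume p: "p \<in> N" and e: "e > 0"
  obtain d where d: "d > 0" "\<And>h m. 0 < h \<Longrightarrow> h < d \<Longrightarrow> m * h \<le> d \<Longrightarrow> p ((F h ^^ m) x - x) \<le> e / 2"
    using near_identity[OF p, of "e / 2" x] e by auto
  show "\<forall>\<^sub>F j in sequentially. dist (p (F (1 / 2 ^ j) x - x)) 0 < e"
    using eventually_dyadic_lt[OF d(1)]
  proof eventually_elim
    case (elim j)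
    then show ?case
      using d(2)[of "1 / 2 ^ j" 1] e N_nonneg[OF p] by simp
  qed
qed

text \<open>Uniform boundedness upgrades pointwise convergence to convergence along moving
  arguments, so that limits of products can be taken.\<close>

lemma limitin_E:
  assumes t: "t \<ge> 0" and lim: "limitin \<tau> f l sequentially"
  shows "limitin \<tau> (\<lambda>j. E j t (f j)) (S t l) sequentially"
proof (rule limitinI_le)
  fix p assume p: "p \<in> N"
  note ps = N_seminorm[OF p]
  obtain q K where q: "q \<in> N" "K \<ge> 0" "\<forall>\<^sub>F j in sequentially. \<forall>x. p (E j t x) \<le> K * q x"
    using E_bounded[OF p t] by blast
  have "(\<lambda>j. K * q (f j - l) + p (E j t l - S t l)) \<longlonglongrightarrow> K * 0 + 0"
    using lim limitin_S[OF t, of l] p q(1) unfolding limitin_iff by (intro tendsto_intros) auto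
  moreover have "\<forall>\<^sub>F j in sequentially. p (E j t (f j) - S t l) \<le> K * q (f j - l) + p (E j t l - S t l)"
    using q(3) eventually_linear_E[of t]
  proof eventually_elim
    case (elim j)
    have "p (E j t (f j) - E j t l) = p (E j t (f j - l))"
      using linear_diff[OF linear_smul_imp_linear[OF elim(2)]] by simp
    also have "\<dots> \<le> K * q (f j - l)"
      using elim by blast
    finally show ?case
      using seminorm_diff_trans[OF ps, of "E j t (f j)" "S t l" "E j t l"] by linarith
  qed
  ultimately show "\<exists>g. g \<longlonglongrightarrow> 0 \<and> (\<forall>\<^sub>F j in sequentially. p (E j t (f j) - S t l) \<le> g j)"
    by auto
qed

lemma S_add:
  assumes t: "t \<ge> 0" and s: "s \<ge> 0"
  shows "S (t + s) x = S t (S s x)"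
proof -
  \<comment> \<open>\<open>f\<close> performs the surplus step whenever the rounded times do not add
    up, so that \<open>E j t (E j s (f j))\<close> equals \<open>E j (t + s) x\<close>
    exactly.\<close>
  define f where "f j = (if steps (t + s) j = steps t j + steps s j then x else F (1 / 2 ^ j) x)" for j
  have "limitin \<tau> f x sequentially"
    unfolding limitin_def
  proof (intro conjI allI impI)
    fix U assume U: "openin \<tau> U \<and> x \<in> U"
    then have "\<forall>\<^sub>F j in sequentially. F (1 / 2 ^ j) x \<in> U"
      using limitin_F[of x] unfolding limitin_def by blast
    then show "\<forall>\<^sub>F j in sequentially. f j \<in> U"
      by eventually_elim (use U in \<open>simp add: f_def\<close>)
  qed simp
  then have "limitin \<tau> (\<lambda>j. E j t (E j s (f j))) (S t (S s x)) sequentially"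
    by (intro limitin_E t s)
  moreover have "E j t (E j s (f j)) = E j (t + s) x" for j
    using steps_add[OF t s, of j]
    by (auto simp: f_def E_def funpow_add funpow_swap1)
  ultimately show ?thesis
    using limitin_unique[OF limitin_S[of "t + s" x]] t s by simp
qed

lemma S_semigroup: "semigroup_on smul S"
  unfolding semigroup_on_def using S_linear S_0 S_add by (auto simp: fun_eq_iff)

text \<open>Left and right continuity both reduce to time 0: \<open>S\<close> at the smaller of the
  two times is factored out, and its bound is uniform on \<open>[0, t + 1]\<close>.\<close>

lemma S_strongly_continuous: "strongly_continuous \<tau> S"
  unfolding strongly_continuous_iff
proof (intro allI impI ballI)
  fix x and t :: real and p and e :: real assume t: "t \<ge> 0" and p: "p \<in> N" and e: "e > 0"
  note ps = N_seminorm[OF p]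
  define \<beta> where "\<beta> = \<bar>\<omega>\<bar> + 1"
  have \<beta>: "\<beta> > \<omega>" "\<beta> > 0" by (auto simp: \<beta>_def)
  obtain q where q: "q \<in> N" "\<And>t x. t \<ge> 0 \<Longrightarrow> p (S t x) \<le> M * exp (\<beta> * t) * q x"
    using S_bound[OF \<beta>(1) p] by blast
  define K where "K = M * exp (\<beta> * (t + 1))"
  have K: "K > 0" using M by (simp add: K_def)
  obtain d where d: "d > 0" "\<And>u. 0 \<le> u \<Longrightarrow> u < d \<Longrightarrow> q (S u x - x) \<le> e / (2 * K)"
    using S_near_identity[OF q(1), of "e / (2 * K)" x] e K by auto
  have close: "p (S (r + u) x - S r x) < e" if "0 \<le> r" "r \<le> t + 1" "0 \<le> u" "u < d" for r u
  proof -
    have "p (S (r + u) x - S r x) = p (S r (S u x - x))"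
      using that by (simp add: S_add linear_diff[OF linear_smul_imp_linear[OF S_linear]])
    also have "\<dots> \<le> M * exp (\<beta> * r) * q (S u x - x)"
      by (rule q(2)[OF that(1)])
    also have "\<dots> \<le> K * q (S u x - x)"
      unfolding K_def using that \<beta> M by (intro mult_right_mono mult_left_mono N_nonneg[OF q(1)]) auto
    also have "\<dots> \<le> K * (e / (2 * K))"
      using K d that by (intro mult_left_mono) auto
    also have "\<dots> < e"
      using K e by simp
    finally show ?thesis .
  qed
  have "p (S s x - S t x) < e" if s: "s \<ge> 0" "\<bar>s - t\<bar> < min d 1" for s
  proof (cases "s \<ge> t")
    case True
    then show ?thesis
      using close[of t "s - t"] s t by simp
  next
    case False
    then show ?thesis
      using close[of s "t - s"] s t seminorm_commute[OF ps, of "S s x"] by simp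
  qed
  then show "\<exists>d>0. \<forall>s\<ge>0. \<bar>s - t\<bar> < d \<longrightarrow> p (S s x - S t x) < e"
    using d(1) by (intro exI[of _ "min d 1"]) auto
qed

text \<open>Subtracting \<open>n * h\<close> times \<open>A x\<close> in
  \<open>funpow_F_diff\<close> leaves a sum of terms \<open>(F h ^^ Suc k) (A x) - A x\<close>.
  These are small by \<open>near_identity\<close>, uniformly in \<open>h\<close>, so the estimate
  survives the limit in \<open>j\<close>.\<close>

lemma S_generator_extends:
  assumes x: "x \<in> D"
  shows "limitin \<tau> (\<lambda>t. (1 / t) *\<^sub>R (S t x - x)) (A x) (at_right 0)"
  unfolding limitin_iff tendsto_iff
proof (intro ballI allI impI)
  fix p and e :: real assume p: "p \<in> N" and e: "e > 0"
  note ps = N_seminorm[OF p]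
  obtain d where d: "d > 0" "\<And>h m. 0 < h \<Longrightarrow> h < d \<Longrightarrow> m * h \<le> d \<Longrightarrow>
      admissible h \<and> p ((F h ^^ m) (A x) - A x) \<le> e / 2"
    using near_identity[OF p, of "e / 2" "A x"] e by auto
  have "p ((1 / t) *\<^sub>R (S t x - x) - A x) < e" if t: "0 < t" "t < d" for t
  proof -
    have "p (S t x - x - t *\<^sub>R A x) \<le> t * (e / 2)"
    proof (rule tendsto_upperbound[OF _ _ sequentially_bot])
      show "(\<lambda>j. p (E j t x - x - (steps t j * (1 / 2 ^ j)) *\<^sub>R A x)) \<longlonglongrightarrow> p (S t x - x - t *\<^sub>R A x)"
        using t by (intro limitin_N[OF p] limitin_diff limitin_S limitin_scaleR_left steps_tendsto) auto
      show "\<forall>\<^sub>F j in sequentially. p (E j t x - x - (steps t j * (1 / 2 ^ j)) *\<^sub>R A x) \<le> t * (e / 2)"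
        using eventually_dyadic_lt[OF d(1)]
      proof eventually_elim
        case (elim j)
        define h :: real where "h = 1 / 2 ^ j"
        define n where "n = steps t j"
        have h: "0 < h" "h < d" using elim by (auto simp: h_def)
        have adm: "admissible h" using d(2)[OF h, of 0] d(1) by simp
        have nh: "n * h \<le> t" using steps_bounds(1)[of t j] t by (simp add: n_def h_def)
        have "(F h ^^ n) x - x - (n * h) *\<^sub>R A x = h *\<^sub>R (\<Sum>k<n. (F h ^^ Suc k) (A x) - A x)"
          unfolding funpow_F_diff[OF adm x]
          by (simp add: sum_subtractf scaleR_diff_right sum_constant_scaleR mult.commute)
        then have "p ((F h ^^ n) x - x - (n * h) *\<^sub>R A x) = h * p (\<Sum>k<n. (F h ^^ Suc k) (A x) - A x)"
          using h by (simp only: seminorm_scaleR[OF ps])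
        also have "\<dots> \<le> h * (\<Sum>k<n. e / 2)"
        proof (intro mult_left_mono order_trans[OF seminorm_sum[OF ps]] sum_mono)
          fix k assume k: "k \<in> {..<n}"
          have "real (Suc k) * h \<le> n * h"
            using k h by (intro mult_right_mono) auto
          then have "real (Suc k) * h \<le> d"
            using nh t by linarith
          then show "p ((F h ^^ Suc k) (A x) - A x) \<le> e / 2"
            using d(2)[OF h] by blast
        qed (use h in simp)
        also have "\<dots> = n * h * (e / 2)" by simp
        also have "\<dots> \<le> t * (e / 2)"
          using nh e by (intro mult_right_mono) auto
        finally show ?case
          by (simp add: E_def h_def n_def)
      qed
    qed
    then have "(1 / t) * p (S t x - x - t *\<^sub>R A x) \<le> (1 / t) * (t * (e / 2))"
      using t by (intro mult_left_mono) auto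
    also have "\<dots> < e" using t e by simp
    also have "(1 / t) * p (S t x - x - t *\<^sub>R A x) = p ((1 / t) *\<^sub>R (S t x - x - t *\<^sub>R A x))"
      using t by (simp only: seminorm_scaleR[OF ps]) simp
    also have "(1 / t) *\<^sub>R (S t x - x - t *\<^sub>R A x) = (1 / t) *\<^sub>R (S t x - x) - A x"
      using t by (simp add: scaleR_diff_right)
    finally show ?thesis .
  qed
  then show "\<forall>\<^sub>F t in at_right 0. dist (p ((1 / t) *\<^sub>R (S t x - x) - A x)) 0 < e"
    unfolding eventually_at_right_field using d(1) N_nonneg[OF p] by auto
qed

lemma S_exp_bounded:
  assumes "\<alpha> > \<omega>" "p \<in> N"
  shows "\<exists>q\<in>N. \<forall>t\<ge>0. \<forall>x. p (exp (- \<alpha> * t) *\<^sub>R S t x) \<le> M * q x"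
proof -
  obtain q where q: "q \<in> N" "\<And>t x. t \<ge> 0 \<Longrightarrow> p (S t x) \<le> M * exp (\<alpha> * t) * q x"
    using S_bound[OF assms] by blast
  have "p (exp (- \<alpha> * t) *\<^sub>R S t x) \<le> M * q x" if "t \<ge> 0" for t x
  proof -
    have "p (exp (- \<alpha> * t) *\<^sub>R S t x) = exp (- \<alpha> * t) * p (S t x)"
      by (simp add: seminorm_scaleR[OF N_seminorm[OF assms(2)]])
    also have "\<dots> \<le> exp (- \<alpha> * t) * (M * exp (\<alpha> * t) * q x)"
      using q(2)[OF that] by (intro mult_left_mono) auto
    also have "\<dots> = (exp (- \<alpha> * t) * exp (\<alpha> * t)) * (M * q x)"
      by (simp only: mult_ac)
    also have "\<dots> = M * q x"
      by (simp flip: exp_add)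
    finally show ?thesis .
  qed
  with q(1) show ?thesis by blast
qed

text \<open>The generator \<open>B\<close> of \<open>S\<close> extends \<open>A\<close>; since \<open>\<mu> - A\<close> is onto and \<open>\<mu> - B\<close> is injective,
  the extension cannot be proper.\<close>

lemma S_is_generator: "is_generator \<tau> S D A"
proof -
  define D' where "D' = {x. \<exists>y. limitin \<tau> (\<lambda>t. (1 / t) *\<^sub>R (S t x - x)) y (at_right 0)}"
  define B where "B x = (SOME y. limitin \<tau> (\<lambda>t. (1 / t) *\<^sub>R (S t x - x)) y (at_right 0))" for x
  have B: "limitin \<tau> (\<lambda>t. (1 / t) *\<^sub>R (S t x - x)) (B x) (at_right 0)" if "x \<in> D'" for x
    using that unfolding D'_def B_def by (auto intro: someI_ex)
  \<comment> \<open>The implication from semigroups to resolvents, applied to \<open>S\<close> and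
    its full generator, supplies the bijectivity of \<open>\<mu> - B\<close>.\<close>
  interpret B: exp_bounded_semigroup smul \<tau> S D' B \<omega> M
  proof (intro exp_bounded_semigroup.intro exp_bounded_semigroup_axioms.intro seq_complete_lcs_axioms)
    show "is_generator \<tau> S D' B"
      using B unfolding is_generator_def D'_def by auto
  qed (use S_semigroup S_strongly_continuous S_exp_bounded in auto)
  have sub: "x \<in> D' \<and> B x = A x" if "x \<in> D" for x
    by (rule B.generatorI[OF S_generator_extends[OF that]])
  define \<mu> where "\<mu> = \<omega> + 1"
  have "x \<in> D" if x: "x \<in> D'" for x
  proof -
    let ?f = "\<lambda>B x. smul (of_real \<mu>) x - B x"
    have "bij_betw (?f A) D UNIV"
      using resolvents[of \<mu>] by (simp add: resolvent_set_def \<mu>_def)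
    then have "?f B x \<in> ?f A ` D"
      by (simp add: bij_betw_def)
    then obtain y where y: "y \<in> D" "?f A y = ?f B x"
      by force
    then have "?f B y = ?f B x"
      using sub by simp
    moreover have "inj_on (?f B) D'"
      using B.bij_resolvent[of \<mu>] by (simp add: bij_betw_def \<mu>_def)
    moreover have "y \<in> D'"
      using sub y(1) by blast
    ultimately have "y = x"
      using x by (meson inj_onD)
    then show ?thesis using y by simp
  qed
  then have "D = D'" using sub by auto
  then show ?thesis
    unfolding is_generator_def using S_generator_extends D'_def by auto
qed

end

section \<open>Growth bounds\<close>

context seq_complete_lcs
begin

text \<open>Dividing \<open>b\<close> by its sum would multiply the final bound by that sum and
  spoil \<open>M\<close>. Instead only a tail of total weight below 1 is merged by quasi-convexity;
  the finitely many other seminorms are joined by maxima, for which \<open>b n \<le> 1\<close> is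
  enough.\<close>

lemma quasi_convex_summable:
  fixes p :: "nat \<Rightarrow> 'a \<Rightarrow> real" and b :: "nat \<Rightarrow> real"
  assumes cqc: "countably_quasi_convex N"
    and p: "\<And>n. p n \<in> N" and b: "\<And>n. 0 \<le> b n" "\<And>n. b n \<le> 1" "summable b"
  shows "\<exists>q\<in>N. \<forall>n x. b n * p n x \<le> q x"
proof -
  obtain K where K: "(\<Sum>i. b (i + K)) < 1"
  proof -
    obtain K where "\<forall>n\<ge>K. norm (\<Sum>i. b (i + n)) < 1"
      using suminf_exist_split[OF _ b(3), of 1] by auto
    then have "norm (\<Sum>i. b (i + K)) < 1"
      by blast
    then have "(\<Sum>i. b (i + K)) < 1"
      by (simp add: abs_less_iff)
    then show thesis by (rule that)
  qed
  have nonneg: "0 \<le> (\<Sum>i. b (i + K))"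
    by (intro suminf_nonneg summable_ignore_initial_segment b)
  \<comment> \<open>Slot 0 takes up the missing weight so that the total is exactly 1, and the tail
    of \<open>b\<close> moves up by one place. The choice of \<open>p 0\<close> for that slot is
    arbitrary.\<close>
  define a where "a n = (case n of 0 \<Rightarrow> 1 - (\<Sum>i. b (i + K)) | Suc i \<Rightarrow> b (i + K))" for n
  define p' where "p' n = (case n of 0 \<Rightarrow> p 0 | Suc i \<Rightarrow> p (i + K))" for n
  have "(\<lambda>n. a (Suc n)) sums (\<Sum>i. b (i + K))"
    unfolding a_def using b(3) by (auto intro!: summable_sums summable_ignore_initial_segment)
  from sums_Suc[OF this] have "a sums ((\<Sum>i. b (i + K)) + a 0)" .
  moreover have "a 0 = 1 - (\<Sum>i. b (i + K))"
    by (simp add: a_def)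
  ultimately have "a sums 1"
    by simp
  moreover have a: "0 \<le> a n" "a n \<le> 1" for n
    using b K nonneg by (auto simp: a_def split: nat.splits)
  moreover have p': "p' n \<in> N" for n
    using p by (auto simp: p'_def split: nat.splits)
  ultimately obtain q where q: "q \<in> N" "\<And>x. (SUP n. a n * p' n x) \<le> q x"
    using cqc unfolding countably_quasi_convex_def by blast
  have "a n * p' n x \<le> norm x" for n x
  proof -
    have "a n * p' n x \<le> 1 * norm x"
      using a N_le_norm[OF p'] N_nonneg[OF p'] by (intro mult_mono) auto
    then show ?thesis by simp
  qed
  then have tail: "a n * p' n x \<le> q x" for n x
    using q(2)[of x] cSUP_upper[of n UNIV "\<lambda>n. a n * p' n x"]
    by (meson UNIV_I bdd_aboveI2 order_trans)
  have "\<exists>r\<in>N. \<forall>n<k. \<forall>x. p n x \<le> r x" for k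
  proof (induction k)
    case (Suc k)
    then obtain r where "r \<in> N" "\<forall>n<k. \<forall>x. p n x \<le> r x" by blast
    then show ?case
      using N_max[OF \<open>r \<in> N\<close> p[of k]]
      by (intro bexI[of _ "\<lambda>x. max (r x) (p k x)"]) (auto simp: less_Suc_eq le_max_iff_disj)
  qed (use p in auto)
  then obtain r where r: "r \<in> N" "\<And>n x. n < K \<Longrightarrow> p n x \<le> r x" by blast
  have "b n * p n x \<le> max (r x) (q x)" for n x
  proof (cases "n < K")
    case True
    have "b n * p n x \<le> 1 * p n x"
      using b N_nonneg[OF p] by (intro mult_right_mono) auto
    then show ?thesis using r(2)[OF True, of x] by simp
  next
    case False
    then show ?thesis
      using tail[of "Suc (n - K)" x] by (simp add: a_def p'_def)
  qed
  then show ?thesis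
    using N_max[OF r(1) q(1)] by (intro bexI[of _ "\<lambda>x. max (r x) (q x)"]) auto
qed

lemma local_bound_imp_global_bound:
  assumes cqc: "countably_quasi_convex N" and M: "M \<ge> 1" and p: "p \<in> N" and \<alpha>: "\<alpha> > \<omega>"
    and loc: "\<And>t0. t0 \<ge> 0 \<Longrightarrow> \<exists>q\<in>N. \<forall>t\<in>{0..t0}. \<forall>x. p (exp (- \<omega> * t) *\<^sub>R S t x) \<le> M * q x"
  shows "\<exists>q\<in>N. \<forall>t\<ge>0. \<forall>x. p (exp (- \<alpha> * t) *\<^sub>R S t x) \<le> M * q x"
proof -
  note ps = N_seminorm[OF p]
  define c where "c = exp (- (\<alpha> - \<omega>))"
  have c: "0 < c" "c < 1" using \<alpha> by (auto simp: c_def)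
  have "\<forall>n. \<exists>q\<in>N. \<forall>t\<in>{0..real n + 1}. \<forall>x. p (exp (- \<omega> * t) *\<^sub>R S t x) \<le> M * q x"
    using loc by simp
  then obtain r where r: "\<And>n. r n \<in> N"
      "\<And>n t x. 0 \<le> t \<Longrightarrow> t \<le> real n + 1 \<Longrightarrow> p (exp (- \<omega> * t) *\<^sub>R S t x) \<le> M * r n x"
    unfolding Bex_def by (metis atLeastAtMost_iff)
  obtain q where q: "q \<in> N" "\<And>n x. c ^ n * r n x \<le> q x"
    using quasi_convex_summable[where p = r and b = "\<lambda>n. c ^ n", OF cqc r(1)] c
    by (auto simp: power_le_one summable_geometric)
  have "p (exp (- \<alpha> * t) *\<^sub>R S t x) \<le> M * q x" if t: "t \<ge> 0" for t x
  proof -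
    define n where "n = nat \<lfloor>t\<rfloor>"
    have "real n = of_int \<lfloor>t\<rfloor>" using t by (simp add: n_def)
    then have n: "real n \<le> t" "t \<le> real n + 1" by linarith+
    \<comment> \<open>On \<open>[n, n + 1]\<close> the decay factor is taken at the left end and the
      local seminorm \<open>r n\<close> is valid up to the right end.\<close>
    have "exp (- (\<alpha> - \<omega>) * t) \<le> exp (- (\<alpha> - \<omega>) * n)"
      using n \<alpha> by simp
    also have "\<dots> = c ^ n"
      unfolding c_def by (simp add: mult.commute flip: exp_of_nat_mult)
    finally have le: "exp (- (\<alpha> - \<omega>) * t) \<le> c ^ n" .
    have "exp (- \<alpha> * t) *\<^sub>R S t x = exp (- (\<alpha> - \<omega>) * t) *\<^sub>R (exp (- \<omega> * t) *\<^sub>R S t x)"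
      by (simp add: algebra_simps flip: exp_add)
    then have "p (exp (- \<alpha> * t) *\<^sub>R S t x) = exp (- (\<alpha> - \<omega>) * t) * p (exp (- \<omega> * t) *\<^sub>R S t x)"
      by (simp only: seminorm_scaleR[OF ps, of "exp (- (\<alpha> - \<omega>) * t)"] abs_exp_cancel)
    also have "\<dots> \<le> c ^ n * (M * r n x)"
      using le r(2)[OF t n(2)] by (intro mult_mono) (auto simp: c less_imp_le N_nonneg[OF p])
    also have "\<dots> = M * (c ^ n * r n x)" by simp
    also have "\<dots> \<le> M * q x"
      using M q(2) by (intro mult_left_mono) auto
    finally show ?thesis .
  qed
  with q(1) show ?thesis by blast
qed

text \<open>The estimate \<open>est\<close> is used in two ways. One fixed \<open>\<epsilon>\<close>
  shows that the supremum is dominated by a multiple of a member of \<open>N\<close>, hence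
  continuous. Letting \<open>\<epsilon> \<rightarrow> 0\<close> places it below the norm: the
  seminorm in \<open>est\<close> may change with \<open>\<epsilon>\<close>, but it always stays
  below the norm.\<close>

lemma global_bound_imp_local_bound:
  assumes S: "semigroup_on smul S" and M: "M \<ge> 1" and p: "p \<in> N" and t0: "t0 \<ge> 0"
    and glob: "\<And>\<alpha>. \<alpha> > \<omega> \<Longrightarrow> \<exists>q\<in>N. \<forall>t\<ge>0. \<forall>x. p (exp (- \<alpha> * t) *\<^sub>R S t x) \<le> M * q x"
  shows "\<exists>q\<in>N. \<forall>t\<in>{0..t0}. \<forall>x. p (exp (- \<omega> * t) *\<^sub>R S t x) \<le> M * q x"
proof -
  note ps = N_seminorm[OF p]
  let ?T = "\<lambda>t x. (exp (- \<omega> * t) / M) *\<^sub>R S t x"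
  have T: "p (?T t x) = p (exp (- \<omega> * t) *\<^sub>R S t x) / M" for t x
    using M by (simp add: seminorm_scaleR[OF ps])
  have est: "\<exists>q\<in>N. \<forall>t\<in>{0..t0}. \<forall>x. p (?T t x) \<le> exp (\<epsilon> * t0) * q x" if \<epsilon>: "\<epsilon> > 0" for \<epsilon>
  proof -
    obtain q where q: "q \<in> N" "\<And>t x. t \<ge> 0 \<Longrightarrow> p (exp (- (\<omega> + \<epsilon>) * t) *\<^sub>R S t x) \<le> M * q x"
      using glob[of "\<omega> + \<epsilon>"] \<epsilon> by auto
    have "p (?T t x) \<le> exp (\<epsilon> * t0) * q x" if t: "t \<in> {0..t0}" for t x
    proof -
      have "exp (- \<omega> * t) *\<^sub>R S t x = exp (\<epsilon> * t) *\<^sub>R (exp (- (\<omega> + \<epsilon>) * t) *\<^sub>R S t x)"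
        by (simp add: algebra_simps flip: exp_add)
      then have "p (exp (- \<omega> * t) *\<^sub>R S t x) = exp (\<epsilon> * t) * p (exp (- (\<omega> + \<epsilon>) * t) *\<^sub>R S t x)"
        by (simp only: seminorm_scaleR[OF ps, of "exp (\<epsilon> * t)"] abs_exp_cancel)
      also have "\<dots> \<le> exp (\<epsilon> * t0) * (M * q x)"
        using t \<epsilon> q(2)[of t x] by (intro mult_mono) (auto simp: N_nonneg[OF p])
      finally show ?thesis
        unfolding T using M by (simp add: pos_divide_le_eq mult_ac)
    qed
    with q(1) show ?thesis by blast
  qed
  have T_le_norm: "p (?T t x) \<le> norm x" if t: "t \<in> {0..t0}" for t x
  proof (rule tendsto_lowerbound)
    have "((\<lambda>\<epsilon>. exp (\<epsilon> * t0) * norm x) \<longlongrightarrow> exp (0 * t0) * norm x) (at_right 0)"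
      by (intro tendsto_intros)
    then show "((\<lambda>\<epsilon>. exp (\<epsilon> * t0) * norm x) \<longlongrightarrow> norm x) (at_right 0)"
      by simp
    show "\<forall>\<^sub>F \<epsilon> in at_right 0. p (?T t x) \<le> exp (\<epsilon> * t0) * norm x"
      using eventually_at_right_less[of 0]
    proof eventually_elim
      case (elim \<epsilon>)
      obtain q where q: "q \<in> N" "p (?T t x) \<le> exp (\<epsilon> * t0) * q x"
        using est[OF elim] t by blast
      then show ?case
        using N_le_norm[OF q(1), of x] by (meson exp_ge_zero mult_left_mono order_trans)
    qed
  qed simp
  define q where "q x = (SUP t\<in>{0..t0}. p (?T t x))" for x
  have bdd: "bdd_above ((\<lambda>t. p (?T t x)) ` {0..t0})" for x
    using T_le_norm by (rule bdd_aboveI2)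
  have lin: "Vector_Spaces.linear smul smul (?T t)" if "t \<in> {0..t0}" for t
    using S that unfolding semigroup_on_def
    by (auto simp: Vector_Spaces.linear_iff scaleR_add_right smul_scaleR)
  \<comment> \<open>For continuity any fixed \<open>\<epsilon>\<close> would do; 1 is taken.\<close>
  obtain r where r: "r \<in> N" "\<And>t x. t \<in> {0..t0} \<Longrightarrow> p (?T t x) \<le> exp (1 * t0) * r x"
    using est[of 1] by auto
  have "q \<in> N"
  proof (rule N_I[OF _ r(1)])
    show "seminorm smul q"
      unfolding q_def using t0 bdd lin by (intro seminorm_SUP ps) auto
    show "q x \<le> exp (1 * t0) * r x" "q x \<le> norm x" for x
      unfolding q_def using t0 r(2) T_le_norm by (auto intro!: cSUP_least simp del: mult_1)
  qed
  moreover have "p (exp (- \<omega> * t) *\<^sub>R S t x) \<le> M * q x" if "t \<in> {0..t0}" for t x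
  proof -
    have "p (?T t x) \<le> q x"
      unfolding q_def using that bdd by (rule cSUP_upper)
    then show ?thesis
      unfolding T using M by (simp add: pos_divide_le_eq mult.commute)
  qed
  ultimately show ?thesis by blast
qed

end

theorem theorem6p6:
  fixes smul :: "'k::real_normed_field \<Rightarrow> 'a::real_normed_vector \<Rightarrow> 'a"
    and \<tau> :: "'a topology"
    and D :: "'a set" and A :: "'a \<Rightarrow> 'a"
    and \<omega> M :: real
  assumes "normed_space_over smul"
    and "locally_convex_topology smul \<tau>"
    and "Hausdorff_space \<tau>"
    and "\<And>U. openin \<tau> U \<Longrightarrow> open U"
    and "seq_complete \<tau>"
    and "\<And>B. bounded_in smul \<tau> B \<Longrightarrow> bounded B"
    and "countably_quasi_convex (cont_seminorms smul \<tau>)"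
    and "linear_operator smul D A"
    and "M \<ge> 1"
  defines "a \<equiv> \<exists>S. semigroup_on smul S \<and> strongly_continuous \<tau> S \<and> is_generator \<tau> S D A \<and>
      (\<forall>t\<^sub>0\<ge>0. \<forall>p\<in>cont_seminorms smul \<tau>. \<exists>q\<in>cont_seminorms smul \<tau>.
         \<forall>t\<in>{0..t\<^sub>0}. \<forall>x. p (exp (- \<omega> * t) *\<^sub>R S t x) \<le> M * q x)"
    and "b \<equiv> \<exists>S. semigroup_on smul S \<and> strongly_continuous \<tau> S \<and> is_generator \<tau> S D A \<and>
      (\<forall>\<alpha>>\<omega>. \<forall>p\<in>cont_seminorms smul \<tau>. \<exists>q\<in>cont_seminorms smul \<tau>.
         \<forall>t\<ge>0. \<forall>x. p (exp (- \<alpha> * t) *\<^sub>R S t x) \<le> M * q x)"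
    and "c \<equiv> \<tau> closure_of D = UNIV \<and>
      of_real ` {\<omega><..} \<subseteq> resolvent_set smul \<tau> D A \<and>
      (\<forall>\<alpha>>\<omega>. \<forall>p\<in>cont_seminorms smul \<tau>. \<exists>q\<in>cont_seminorms smul \<tau>.
         \<forall>\<mu>>\<alpha>. \<forall>m\<ge>1. \<forall>x.
           p ((\<mu> - \<alpha>) ^ m *\<^sub>R (resolvent smul D A (of_real \<mu>) ^^ m) x) \<le> M * q x)"
  shows "(a \<longleftrightarrow> b) \<and> (b \<longleftrightarrow> c)"
proof -
  interpret seq_complete_lcs smul \<tau>
    using assms(1-5) by (simp add: seq_complete_lcs_def seq_complete_lcs_axioms_def)
  have "a \<longleftrightarrow> b"
  proof
    assume a
    then obtain S where S: "semigroup_on smul S" "strongly_continuous \<tau> S" "is_generator \<tau> S D A"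
        "\<And>t0 p. t0 \<ge> 0 \<Longrightarrow> p \<in> N \<Longrightarrow> \<exists>q\<in>N. \<forall>t\<in>{0..t0}. \<forall>x. p (exp (- \<omega> * t) *\<^sub>R S t x) \<le> M * q x"
      unfolding a_def by blast
    show b
      unfolding b_def
      using S local_bound_imp_global_bound[OF assms(7) assms(9)] by (intro exI[of _ S]) blast
  next
    assume b
    then obtain S where S: "semigroup_on smul S" "strongly_continuous \<tau> S" "is_generator \<tau> S D A"
        "\<And>\<alpha> p. \<alpha> > \<omega> \<Longrightarrow> p \<in> N \<Longrightarrow> \<exists>q\<in>N. \<forall>t\<ge>0. \<forall>x. p (exp (- \<alpha> * t) *\<^sub>R S t x) \<le> M * q x"
      unfolding b_def by blast
    show a
      unfolding a_def
      using S global_bound_imp_local_bound[OF S(1) assms(9)] by (intro exI[of _ S]) blast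
  qed
  moreover have "b \<longleftrightarrow> c"
  proof
    assume b
    then obtain S where S: "semigroup_on smul S" "strongly_continuous \<tau> S" "is_generator \<tau> S D A"
        "\<And>\<alpha> p. \<alpha> > \<omega> \<Longrightarrow> p \<in> N \<Longrightarrow> \<exists>q\<in>N. \<forall>t\<ge>0. \<forall>x. p (exp (- \<alpha> * t) *\<^sub>R S t x) \<le> M * q x"
      unfolding b_def by blast
    interpret exp_bounded_semigroup smul \<tau> S D A \<omega> M
      by (intro exp_bounded_semigroup.intro exp_bounded_semigroup_axioms.intro
          seq_complete_lcs_axioms S)
    show c
      unfolding c_def using dense in_resolvent_set resolvent_power_bound by blast
  next
    assume c
    interpret hille_yosida smul \<tau> D A \<omega> M
      using \<open>c\<close> unfolding c_def
      by (intro hille_yosida.intro hille_yosida_axioms.intro seq_complete_lcs_axioms assms(8,9)) auto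
    show b
      unfolding b_def using S_semigroup S_strongly_continuous S_is_generator S_exp_bounded by blast
  qed
  ultimately show ?thesis ..
qed

end
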